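(* Suppose $h\ge3$ is odd and $n\ge1$. Then $\mathcal{CSP}_h(n)=\mathcal{RP}_h(n)$ if and only if $h\ge n$. Hence every irreducible $\mathcal H_n(q)$-module is completely splittable if and only if $h\ge n$.
   Context: Standing assumptions: $\mathbb F$ is an algebraically closed field with $\operatorname{char}\mathbb F\ne 2$; $q\in\mathbb F^*$ is a primitive $h$-th root of unity, $h\ge3$ odd; $\varepsilon=q-q^{-1}$. $\mathcal H_n(q)$ is the $\mathbb F$-superalgebra generated by even $T_1,\dots,T_{n-1}$ and odd $C_1,\dots,C_n$ subject to: $T_i^2=\varepsilon T_i+1$; $T_iT_j=T_jT_i$ for $|i-j|>1$; $T_iT_{i+1}T_i=T_{i+1}T_iT_{i+1}$; $C_i^2=1$; $C_iC_j=-C_jC_i$ for $i\ne j$; $T_iC_i=C_{i+1}T_i$; $T_iC_{i+1}=C_iT_i-\varepsilon(C_i-C_{i+1})$; $T_iC_j=C_jT_i$ for $j\neq i,i+1$. Modules are $\mathbb Z_2$-graded left modules. The Jucys–Murphy elements $L_1=1$, $L_{k+1}=(T_k+\varepsilon C_kC_{k+1})L_kT_k$ commute and are invertible; a finite dimensional $\mathcal H_n(q)$-module is completely splittable if $L_1,\dots,L_n$ act semisimply on it. Partitions $\lambda=(\lambda_1\ge\lambda_2\ge\cdots\ge0)$. $\mathcal{SP}_0(n)$ is the set of strict partitions of $n$ (nonzero parts distinct). $\mathcal{CSP}_h(n)=\{\xi\in\mathcal{SP}_0(n):\ \xi_1=h-u\text{ and }\xi_2\le u\text{ for some }1\le u\le\frac{h-3}2,\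 \text{or }1\le\xi_1\le\frac{h+1}2\}$. $\mathcal{RP}_h(n)$ is the set of partitions $\lambda$ of $n$ that are $h$-strict ($h\mid\lambda_r$ whenever $\lambda_r=\lambda_{r+1}$) and $h$-restricted ($\lambda_r-\lambda_{r+1}<h$ if $h\mid\lambda_r$, and $\lambda_r-\lambda_{r+1}\le h$ if $h\nmid\lambda_r$). *)

theory Defs
  imports
    "HOL-Library.Poly_Mapping"
    "HOL-Library.Z2"
    "HOL-Computational_Algebra.Polynomial"
    "HOL-Algebra.QuotRing"
    "HOL-Algebra.Module"
begin

section \<open>Partitions\<close>

text \<open>A partition is the infinite, eventually zero sequence of its parts. Indexing starts at 0,
  so the part usually written with subscript \<open>r\<close> is \<open>\<mu> (r - 1)\<close>.\<close>

definition partitions :: "nat \<Rightarrow> (nat \<Rightarrow> nat) set" where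
  "partitions n =
    {\<mu>. antimono \<mu> \<and> finite {r. \<mu> r \<noteq> 0} \<and> (\<Sum>r | \<mu> r \<noteq> 0. \<mu> r) = n}"

definition strict_partitions :: "nat \<Rightarrow> (nat \<Rightarrow> nat) set" where
  "strict_partitions n = {\<mu> \<in> partitions n. inj_on \<mu> {r. \<mu> r \<noteq> 0}}"

definition CSP :: "nat \<Rightarrow> nat \<Rightarrow> (nat \<Rightarrow> nat) set" where
  "CSP h n =
    {\<xi> \<in> strict_partitions n.
      (\<exists>u. 1 \<le> u \<and> u \<le> (h - 3) div 2 \<and> \<xi> 0 = h - u \<and> \<xi> 1 \<le> u) \<or>
      (1 \<le> \<xi> 0 \<and> \<xi> 0 \<le> (h + 1) div 2)}"

definition h_strict :: "nat \<Rightarrow> (nat \<Rightarrow> nat) \<Rightarrow> bool" where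
  "h_strict h \<mu> \<longleftrightarrow> (\<forall>r. \<mu> r = \<mu> (Suc r) \<longrightarrow> h dvd \<mu> r)"

definition h_restricted :: "nat \<Rightarrow> (nat \<Rightarrow> nat) \<Rightarrow> bool" where
  "h_restricted h \<mu> \<longleftrightarrow>
    (\<forall>r. (h dvd \<mu> r \<longrightarrow> \<mu> r - \<mu> (Suc r) < h) \<and> (\<not> h dvd \<mu> r \<longrightarrow> \<mu> r - \<mu> (Suc r) \<le> h))"

definition RP :: "nat \<Rightarrow> nat \<Rightarrow> (nat \<Rightarrow> nat) set" where
  "RP h n = {\<mu> \<in> partitions n. h_strict h \<mu> \<and> h_restricted h \<mu>}"


section \<open>The free superalgebra on the generators\<close>

datatype gen = T nat | C nat

definition gens :: "nat \<Rightarrow> gen set" where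
  "gens n = T ` {1..<n} \<union> C ` {1..n}"

text \<open>Words form a monoid under concatenation, written additively because the product of
  \<open>poly_mapping\<close> is convolution with respect to \<open>+\<close>. Hence \<open>'a free_alg\<close>
  is the free unital associative algebra on all of \<open>gen\<close>, and its product
  \<open>*\<close> is the noncommutative one.\<close>

datatype word = Word (letters: "gen list")

instantiation word :: monoid_add
begin

definition zero_word :: word where "0 = Word []"

definition plus_word :: "word \<Rightarrow> word \<Rightarrow> word" where "v + w = Word (letters v @ letters w)"

instance by standard (auto simp: zero_word_def plus_word_def)

end

type_synonym 'a free_alg = "word \<Rightarrow>\<^sub>0 'a"

definition const :: "'a::field \<Rightarrow> 'a free_alg" where
  "const a = Poly_Mapping.single 0 a"

definition var :: "gen \<Rightarrow> 'a::field free_alg" where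
  "var g = Poly_Mapping.single (Word [g]) 1"

definition parity :: "word \<Rightarrow> bit" where
  "parity w = of_nat (length (filter (\<lambda>g. \<exists>j. g = C j) (letters w)))"

definition free_ring :: "nat \<Rightarrow> 'a::field free_alg ring" where
  "free_ring n =
    \<lparr>carrier = {f. \<forall>w \<in> Poly_Mapping.keys f. set (letters w) \<subseteq> gens n},
     mult = (*), one = 1, zero = 0, add = (+)\<rparr>"


section \<open>The Hecke--Clifford superalgebra\<close>

definition eps :: "'a::field \<Rightarrow> 'a" where
  "eps q = q - inverse q"

text \<open>Each defining relation \<open>x = y\<close> contributes the element \<open>x - y\<close>.\<close>

definition relators :: "nat \<Rightarrow> 'a::field \<Rightarrow> 'a free_alg set" where
  "relators n q =
    (let t = (\<lambda>i. var (T i)); c = (\<lambda>i. var (C i)); e = const (eps q) in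
      {t i * t i - (e * t i + 1) | i. i \<in> {1..<n}} \<union>
      {t i * t j - t j * t i | i j. i \<in> {1..<n} \<and> j \<in> {1..<n} \<and> \<bar>int i - int j\<bar> > 1} \<union>
      {t i * t (i+1) * t i - t (i+1) * t i * t (i+1) | i. i \<in> {1..<n} \<and> i + 1 \<in> {1..<n}} \<union>
      {c i * c i - 1 | i. i \<in> {1..n}} \<union>
      {c i * c j - (- (c j * c i)) | i j. i \<in> {1..n} \<and> j \<in> {1..n} \<and> i \<noteq> j} \<union>
      {t i * c i - c (i+1) * t i | i. i \<in> {1..<n}} \<union>
      {t i * c (i+1) - (c i * t i - e * (c i - c (i+1))) | i. i \<in> {1..<n}} \<union>
      {t i * c j - c j * t i | i j. i \<in> {1..<n} \<and> j \<in> {1..n} \<and> j \<noteq> i \<and> j \<noteq> i + 1})"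

definition relation_ideal :: "nat \<Rightarrow> 'a::field \<Rightarrow> 'a free_alg set" where
  "relation_ideal n q = Idl\<^bsub>free_ring n\<^esub> (relators n q)"

definition HC :: "nat \<Rightarrow> 'a::field \<Rightarrow> 'a free_alg set ring" where
  "HC n q = free_ring n Quot relation_ideal n q"

definition proj :: "nat \<Rightarrow> 'a::field \<Rightarrow> 'a free_alg \<Rightarrow> 'a free_alg set" where
  "proj n q x = relation_ideal n q +>\<^bsub>free_ring n\<^esub> x"

definition HC_part :: "nat \<Rightarrow> 'a::field \<Rightarrow> bit \<Rightarrow> 'a free_alg set set" where
  "HC_part n q p =
    proj n q ` {f \<in> carrier (free_ring n). \<forall>w \<in> Poly_Mapping.keys f. parity w = p}"

abbreviation HC_T :: "nat \<Rightarrow> 'a::field \<Rightarrow> nat \<Rightarrow> 'a free_alg set" where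
  "HC_T n q i \<equiv> proj n q (var (T i))"

abbreviation HC_C :: "nat \<Rightarrow> 'a::field \<Rightarrow> nat \<Rightarrow> 'a free_alg set" where
  "HC_C n q i \<equiv> proj n q (var (C i))"

abbreviation HC_const :: "nat \<Rightarrow> 'a::field \<Rightarrow> 'a \<Rightarrow> 'a free_alg set" where
  "HC_const n q a \<equiv> proj n q (const a)"

text \<open>Jucys--Murphy elements. They are indexed from 1; the value at 0 is a dummy.\<close>

fun JM :: "nat \<Rightarrow> 'a::field \<Rightarrow> nat \<Rightarrow> 'a free_alg set" where
  "JM n q 0 = \<one>\<^bsub>HC n q\<^esub>"
| "JM n q (Suc 0) = \<one>\<^bsub>HC n q\<^esub>"
| "JM n q (Suc (Suc k)) =
    (HC_T n q (Suc k) \<oplus>\<^bsub>HC n q\<^esub>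
      HC_const n q (eps q) \<otimes>\<^bsub>HC n q\<^esub> HC_C n q (Suc k) \<otimes>\<^bsub>HC n q\<^esub> HC_C n q (Suc (Suc k)))
    \<otimes>\<^bsub>HC n q\<^esub> JM n q (Suc k) \<otimes>\<^bsub>HC n q\<^esub> HC_T n q (Suc k)"

lemma free_ring_simps:
  "\<one>\<^bsub>free_ring n\<^esub> = 1" "\<zero>\<^bsub>free_ring n\<^esub> = 0"
  "x \<otimes>\<^bsub>free_ring n\<^esub> y = x * y" "x \<oplus>\<^bsub>free_ring n\<^esub> y = x + y"
  by (simp_all add: free_ring_def)

lemma free_ring_carrier_iff:
  "f \<in> carrier (free_ring n) \<longleftrightarrow> (\<forall>w \<in> Poly_Mapping.keys f. set (letters w) \<subseteq> gens n)"
  by (simp add: free_ring_def)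

lemma free_ring_closed:
  fixes x y :: "'a::field free_alg"
  shows free_ring_one: "(1 :: 'a free_alg) \<in> carrier (free_ring n)"
    and free_ring_const: "const b \<in> carrier (free_ring n)"
    and free_ring_var: "g \<in> gens n \<Longrightarrow> (var g :: 'a free_alg) \<in> carrier (free_ring n)"
    and free_ring_zero: "(0 :: 'a free_alg) \<in> carrier (free_ring n)"
    and free_ring_uminus: "x \<in> carrier (free_ring n) \<Longrightarrow> - x \<in> carrier (free_ring n)"
    and free_ring_add: "\<lbrakk>x \<in> carrier (free_ring n); y \<in> carrier (free_ring n)\<rbrakk> \<Longrightarrow>
      x + y \<in> carrier (free_ring n)"
    and free_ring_diff: "\<lbrakk>x \<in> carrier (free_ring n); y \<in> carrier (free_ring n)\<rbrakk> \<Longrightarrow>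
      x - y \<in> carrier (free_ring n)"
    and free_ring_mult: "\<lbrakk>x \<in> carrier (free_ring n); y \<in> carrier (free_ring n)\<rbrakk> \<Longrightarrow>
      x * y \<in> carrier (free_ring n)"
proof -
  show "(1 :: 'a free_alg) \<in> carrier (free_ring n)" "const b \<in> carrier (free_ring n)"
    by (simp_all add: free_ring_carrier_iff const_def zero_word_def)
  show "(0 :: 'a free_alg) \<in> carrier (free_ring n)"
    by (simp add: free_ring_carrier_iff)
  show "(var g :: 'a free_alg) \<in> carrier (free_ring n)" if "g \<in> gens n"
    using that by (simp add: free_ring_carrier_iff var_def)
  show m: "- x \<in> carrier (free_ring n)" if "x \<in> carrier (free_ring n)" for x :: "'a free_alg"
    using that by (simp add: free_ring_carrier_iff in_keys_iff)
  show a: "x + y \<in> carrier (free_ring n)"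
    if "x \<in> carrier (free_ring n)" "y \<in> carrier (free_ring n)" for x y :: "'a free_alg"
    using that Poly_Mapping.keys_add[of x y] unfolding free_ring_carrier_iff by blast
  show "x - y \<in> carrier (free_ring n)"
    if "x \<in> carrier (free_ring n)" "y \<in> carrier (free_ring n)" for x y :: "'a free_alg"
    using a[OF that(1) m[OF that(2)]] by simp
  show "x * y \<in> carrier (free_ring n)"
    if x: "x \<in> carrier (free_ring n)" and y: "y \<in> carrier (free_ring n)"
  proof (unfold free_ring_carrier_iff, rule ballI)
    fix w assume "w \<in> Poly_Mapping.keys (x * y)"
    then obtain u v where "w = u + v" "u \<in> Poly_Mapping.keys x" "v \<in> Poly_Mapping.keys y"
      using keys_mult[of x y] by blast
    then show "set (letters w) \<subseteq> gens n"
      using x y by (simp add: free_ring_carrier_iff plus_word_def)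
  qed
qed

lemma free_ring_ring: "ring (free_ring n)"
proof (rule ringI)
  show "abelian_group (free_ring n :: 'a free_alg ring)"
  proof (rule abelian_groupI)
    fix x :: "'a free_alg" assume "x \<in> carrier (free_ring n)"
    then show "\<exists>y\<in>carrier (free_ring n). y \<oplus>\<^bsub>free_ring n\<^esub> x = \<zero>\<^bsub>free_ring n\<^esub>"
      by (intro bexI[of _ "- x"] free_ring_uminus) (simp_all add: free_ring_simps)
  qed (simp_all add: free_ring_simps free_ring_zero free_ring_add add.assoc add.commute)
  show "Group.monoid (free_ring n :: 'a free_alg ring)"
    by (rule monoidI) (simp_all add: free_ring_simps free_ring_one free_ring_mult mult.assoc)
qed (simp_all add: free_ring_simps distrib_left distrib_right)

lemma relators_carrier: "relators n q \<subseteq> carrier (free_ring n)"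
proof -
  have t: "i \<in> {1..<n} \<Longrightarrow> T i \<in> gens n" and c: "i \<in> {1..n} \<Longrightarrow> C i \<in> gens n"
    and c': "i \<in> {1..<n} \<Longrightarrow> C i \<in> gens n" "i \<in> {1..<n} \<Longrightarrow> C (i + 1) \<in> gens n" for i
    by (auto simp: gens_def)
  show ?thesis
    unfolding relators_def Let_def
    by (intro Un_least subsetI; elim CollectE exE conjE; hypsubst;
        intro free_ring_closed t c c'; assumption)
qed

lemma HC_ring: "ring (HC n q)"
  unfolding HC_def relation_ideal_def
  by (intro ideal.quotient_is_ring ring.genideal_ideal free_ring_ring relators_carrier)


section \<open>Graded modules\<close>

text \<open>The HOL-Algebra locale of modules requires a commutative base ring; the records it uses do not.\<close>

locale left_module = R?: ring R + M?: abelian_group M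
  for R :: "('r, 's) ring_scheme" (structure) and M :: "('r, 'v, 'm) module_scheme" (structure) +
  assumes smult_closed: "\<lbrakk>a \<in> carrier R; x \<in> carrier M\<rbrakk> \<Longrightarrow> a \<odot>\<^bsub>M\<^esub> x \<in> carrier M"
    and smult_l_distr: "\<lbrakk>a \<in> carrier R; b \<in> carrier R; x \<in> carrier M\<rbrakk> \<Longrightarrow>
      (a \<oplus>\<^bsub>R\<^esub> b) \<odot>\<^bsub>M\<^esub> x = a \<odot>\<^bsub>M\<^esub> x \<oplus>\<^bsub>M\<^esub> b \<odot>\<^bsub>M\<^esub> x"
    and smult_r_distr: "\<lbrakk>a \<in> carrier R; x \<in> carrier M; y \<in> carrier M\<rbrakk> \<Longrightarrow>
      a \<odot>\<^bsub>M\<^esub> (x \<oplus>\<^bsub>M\<^esub> y) = a \<odot>\<^bsub>M\<^esub> x \<oplus>\<^bsub>M\<^esub> a \<odot>\<^bsub>M\<^esub> y"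
    and smult_assoc: "\<lbrakk>a \<in> carrier R; b \<in> carrier R; x \<in> carrier M\<rbrakk> \<Longrightarrow>
      (a \<otimes>\<^bsub>R\<^esub> b) \<odot>\<^bsub>M\<^esub> x = a \<odot>\<^bsub>M\<^esub> (b \<odot>\<^bsub>M\<^esub> x)"
    and smult_one: "x \<in> carrier M \<Longrightarrow> \<one>\<^bsub>R\<^esub> \<odot>\<^bsub>M\<^esub> x = x"

record ('r, 'v) graded_module = "('r, 'v) module" +
  part :: "bit \<Rightarrow> 'v set"

text \<open>Quantifying over all modules of this type ranges over all isomorphism classes of
  finite-dimensional modules as soon as \<open>'v\<close> contains a copy of
  \<open>nat \<Rightarrow> 'a\<close>.\<close>

type_synonym ('a, 'v) HC_mod = "('a free_alg set, 'v) graded_module"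

definition direct_sum_of :: "('v, 'm) ring_scheme \<Rightarrow> 'v set \<Rightarrow> 'v set \<Rightarrow> bool" where
  "direct_sum_of M A B \<longleftrightarrow> A \<inter> B = {\<zero>\<^bsub>M\<^esub>} \<and> A <+>\<^bsub>M\<^esub> B = carrier M"

definition HC_module :: "nat \<Rightarrow> 'a::field \<Rightarrow> ('a, 'v) HC_mod \<Rightarrow> bool" where
  "HC_module n q M \<longleftrightarrow>
    left_module (HC n q) M \<and>
    (\<forall>r. subgroup (part M r) (add_monoid M)) \<and>
    direct_sum_of M (part M 0) (part M 1) \<and>
    (\<forall>p r. \<forall>a \<in> HC_part n q p. \<forall>x \<in> part M r. a \<odot>\<^bsub>M\<^esub> x \<in> part M (p + r))"

definition graded_submodule :: "nat \<Rightarrow> 'a::field \<Rightarrow> ('a, 'v) HC_mod \<Rightarrow> 'v set \<Rightarrow> bool" where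
  "graded_submodule n q M N \<longleftrightarrow>
    submodule N (HC n q) M \<and> N = (N \<inter> part M 0) <+>\<^bsub>M\<^esub> (N \<inter> part M 1)"

definition irreducible_HC_module :: "nat \<Rightarrow> 'a::field \<Rightarrow> ('a, 'v) HC_mod \<Rightarrow> bool" where
  "irreducible_HC_module n q M \<longleftrightarrow>
    HC_module n q M \<and> carrier M \<noteq> {\<zero>\<^bsub>M\<^esub>} \<and>
    (\<forall>N. graded_submodule n q M N \<longrightarrow> N = {\<zero>\<^bsub>M\<^esub>} \<or> N = carrier M)"

text \<open>The base field acts on a module through the scalars of the algebra. Subspaces need not be
  graded.\<close>

definition lin_subspace :: "nat \<Rightarrow> 'a::field \<Rightarrow> ('a, 'v) HC_mod \<Rightarrow> 'v set \<Rightarrow> bool" where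
  "lin_subspace n q M W \<longleftrightarrow>
    subgroup W (add_monoid M) \<and> (\<forall>a. \<forall>x \<in> W. HC_const n q a \<odot>\<^bsub>M\<^esub> x \<in> W)"

definition finite_dim :: "nat \<Rightarrow> 'a::field \<Rightarrow> ('a, 'v) HC_mod \<Rightarrow> bool" where
  "finite_dim n q M \<longleftrightarrow>
    (\<exists>B. finite B \<and> B \<subseteq> carrier M \<and>
      (\<forall>W. lin_subspace n q M W \<and> B \<subseteq> W \<longrightarrow> W = carrier M))"

text \<open>An operator is semisimple if every invariant subspace has an invariant complement.\<close>

definition acts_semisimply ::
    "nat \<Rightarrow> 'a::field \<Rightarrow> ('a, 'v) HC_mod \<Rightarrow> 'a free_alg set \<Rightarrow> bool" where
  "acts_semisimply n q M a \<longleftrightarrow>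
    (\<forall>W. lin_subspace n q M W \<and> (\<forall>x \<in> W. a \<odot>\<^bsub>M\<^esub> x \<in> W) \<longrightarrow>
      (\<exists>W'. lin_subspace n q M W' \<and> (\<forall>x \<in> W'. a \<odot>\<^bsub>M\<^esub> x \<in> W') \<and> direct_sum_of M W W'))"

definition completely_splittable :: "nat \<Rightarrow> 'a::field \<Rightarrow> ('a, 'v) HC_mod \<Rightarrow> bool" where
  "completely_splittable n q M \<longleftrightarrow>
    HC_module n q M \<and> finite_dim n q M \<and> (\<forall>k \<in> {1..n}. acts_semisimply n q M (JM n q k))"

definition primitive_root_of_unity :: "nat \<Rightarrow> 'a::field \<Rightarrow> bool" where
  "primitive_root_of_unity h q \<longleftrightarrow>
    h > 0 \<and> q ^ h = 1 \<and> (\<forall>k. 0 < k \<and> k < h \<longrightarrow> q ^ k \<noteq> 1)"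

end

(* Suppose n <= h. By induction on m < h, a joint eigenvector of L_1, ..., L_m carries a standard
   shifted tableau whose contents are the eigenvalues of the L_k + L_k^-1, and none of L_1, ..., L_m
   has a Jordan block. Intertwiners phi_k move between tableaux; they reduce a hypothetical Jordan
   block of L_(m+1), or an eigenvalue that is not the content of an addable box, to a configuration
   of adjacent generators which the quadratic or the braid relation excludes. Equal eigenvalues at k
   and k+1 would produce a Jordan block of L_k, so the intertwiners exist for all k < n, the joint
   eigenvectors of L_1, ..., L_n span a graded submodule, and this is all of an irreducible module.

   Suppose n > h. In the basic spin module L_h and L_(h+1) satisfy (L - 1)^2 = 0: this holds on the
   vacuum vector, and the set where it holds is stable under the Clifford generators. On a minimal
   graded submodule, semisimplicity would give L_h = L_(h+1) = 1, but then
   L_(h+1) = (T_h + eps C_h C_(h+1)) T_h contradicts T_h^2 = eps T_h + 1. *)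

theory Submission
  imports Defs "HOL-Library.Function_Algebras"
begin


section \<open>Jucys--Murphy operators\<close>

text \<open>\<open>c k\<close> conjugates \<open>L k\<close> to its inverse, so an eigenvalue a
  matters only through a + 1/a, and the values \<open>cont j\<close> that occur satisfy cont j =
  cont (-1 - j) = cont (j + h). The bound on n enters through one inequality: two different row
  lengths a, b of a shape with m boxes satisfy a + b <= m, which keeps competing contents apart
  while m < h. One coincidence survives, cont (d - 1) = cont (d + 1) for h dividing 2d + 1. There,
  and for a Jordan block with eigenvalue 1, the braid relation is consistent on a single
  eigenvector; this is why the intertwiners carry coefficients differentiated in b, and the
  first-order terms on a Jordan pair give the contradiction. The tableau argument stops at h - 1
  boxes. For n = h nothing is shown about L_h in advance: the intertwiners need L_k for k < h only,
  and irreducibility settles the rest. The indices h and h + 1 of the counterexample come from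
  contents too: cont (h - 1) = cont h = 2, the value of the eigenvalue 1. Irreducible modules have
  an arbitrary carrier and no dimension bound, so they are replaced by subspaces of the free
  algebra, and finite dimension is derived.\<close>

locale hc_rep = vector_space scale
  for scale :: "'a::field \<Rightarrow> 'w::ab_group_add \<Rightarrow> 'w" (infixr "*s" 75) +
  fixes n :: nat and q :: 'a and V :: "'w set" and t c :: "nat \<Rightarrow> 'w \<Rightarrow> 'w"
  assumes V_subspace: "subspace V"
    and t_add: "t i (v + w) = t i v + t i w" and t_scale: "t i (a *s w) = a *s t i w"
    and c_add: "c i (v + w) = c i v + c i w" and c_scale: "c i (a *s w) = a *s c i w"
    and t_closed: "w \<in> V \<Longrightarrow> t i w \<in> V" and c_closed: "w \<in> V \<Longrightarrow> c i w \<in> V"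
    and t_sq: "\<lbrakk>1 \<le> i; i < n; w \<in> V\<rbrakk> \<Longrightarrow> t i (t i w) = eps q *s t i w + w"
    and t_t: "\<lbrakk>1 \<le> i; Suc i < j; j < n; w \<in> V\<rbrakk> \<Longrightarrow> t i (t j w) = t j (t i w)"
    and braid: "\<lbrakk>1 \<le> i; Suc i < n; w \<in> V\<rbrakk> \<Longrightarrow> t i (t (Suc i) (t i w)) = t (Suc i) (t i (t (Suc i) w))"
    and c_sq: "\<lbrakk>1 \<le> i; i \<le> n; w \<in> V\<rbrakk> \<Longrightarrow> c i (c i w) = w"
    and c_c: "\<lbrakk>1 \<le> i; i \<le> n; 1 \<le> j; j \<le> n; i \<noteq> j; w \<in> V\<rbrakk> \<Longrightarrow> c i (c j w) = - c j (c i w)"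
    and t_c: "\<lbrakk>1 \<le> i; i < n; w \<in> V\<rbrakk> \<Longrightarrow> t i (c i w) = c (Suc i) (t i w)"
    and t_c_Suc: "\<lbrakk>1 \<le> i; i < n; w \<in> V\<rbrakk> \<Longrightarrow>
      t i (c (Suc i) w) = c i (t i w) - eps q *s (c i w - c (Suc i) w)"
    and t_c_other: "\<lbrakk>1 \<le> i; i < n; 1 \<le> j; j \<le> n; j \<noteq> i; j \<noteq> Suc i; w \<in> V\<rbrakk> \<Longrightarrow> t i (c j w) = c j (t i w)"
    and two_neq_0: "(2 :: 'a) \<noteq> 0" and eps_neq_0: "eps q \<noteq> 0"
begin

abbreviation e :: 'a where "e \<equiv> eps q"

lemma t_zero: "t i 0 = 0" and c_zero: "c i 0 = 0"
  using t_scale[of i 0 0] c_scale[of i 0 0] by simp_all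

lemma t_neg: "t i (- w) = - t i w" and c_neg: "c i (- w) = - c i w"
  using t_scale[of i "-1" w] c_scale[of i "-1" w] by simp_all

lemma t_diff: "t i (v - w) = t i v - t i w" and c_diff: "c i (v - w) = c i v - c i w"
  using t_add[of i v "- w"] c_add[of i v "- w"] by (simp_all add: t_neg c_neg)

lemmas V_closed = subspace_0[OF V_subspace] subspace_add[OF V_subspace] subspace_diff[OF V_subspace]
  subspace_neg[OF V_subspace] subspace_scale[OF V_subspace] t_closed c_closed

lemmas lin = t_add t_scale t_zero t_neg t_diff c_add c_scale c_zero c_neg c_diff
  scale_right_distrib scale_right_diff_distrib scale_left_distrib scale_left_diff_distrib

declare V_closed [simp]

lemma t_t': "\<lbrakk>1 \<le> i; i < n; 1 \<le> j; j < n; Suc i < j \<or> Suc j < i; w \<in> V\<rbrakk> \<Longrightarrow> t i (t j w) = t j (t i w)"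
  using t_t by metis

primrec L :: "nat \<Rightarrow> 'w \<Rightarrow> 'w" where
  "L 0 w = w"
| "L (Suc k) w = (if k = 0 then w else t k (L k (t k w)) + e *s c k (c (Suc k) (L k (t k w))))"

lemma L_1: "L (Suc 0) w = w"
  by simp

lemma L_Suc: "1 \<le> k \<Longrightarrow> L (Suc k) w = t k (L k (t k w)) + e *s c k (c (Suc k) (L k (t k w)))"
  by simp

declare L.simps(2) [simp del]

lemma L_add: "L k (v + w) = L k v + L k w"
  by (induction k arbitrary: v w) (simp_all add: L.simps(2) lin)

lemma L_scale: "L k (a *s w) = a *s L k w"
  by (induction k arbitrary: w) (simp_all add: L.simps(2) lin mult.commute)

lemma L_zero: "L k 0 = 0"
  using L_scale[of k 0 0] by simp

lemma L_neg: "L k (- w) = - L k w"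
  using L_scale[of k "-1" w] by simp

lemma L_diff: "L k (v - w) = L k v - L k w"
  using L_add[of k v "- w"] by (simp add: L_neg)

lemmas lin_L = L_add L_scale L_zero L_neg L_diff

lemma L_closed [simp]: "w \<in> V \<Longrightarrow> L k w \<in> V"
  by (induction k arbitrary: w) (simp_all add: L.simps(2))

lemma L_c_above: "\<lbrakk>k < j; j \<le> n; w \<in> V\<rbrakk> \<Longrightarrow> L k (c j w) = c j (L k w)"
proof (induction k arbitrary: w)
  case (Suc k)
  show ?case
  proof (cases "k = 0")
    case False
    then have "c k (c (Suc k) (c j x)) = c j (c k (c (Suc k) x))" if "x \<in> V" for x
      using Suc.prems that by (simp add: c_c[of _ j] lin)
    then show ?thesis using False Suc
      by (simp add: L_Suc t_c_other lin)
  qed (simp add: L_1)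
qed simp

lemma L_t_above: "\<lbrakk>1 \<le> k; k < i; i < n; w \<in> V\<rbrakk> \<Longrightarrow> L k (t i w) = t i (L k w)"
proof (induction k arbitrary: w)
  case (Suc k)
  show ?case
  proof (cases "k = 0")
    case False
    have "t k (t i x) = t i (t k x)" "t i (c k x) = c k (t i x)"
        "t i (c (Suc k) x) = c (Suc k) (t i x)" if "x \<in> V" for x
      using Suc.prems that False by (simp_all add: t_t' t_c_other)
    then show ?thesis using False Suc
      by (simp add: L_Suc lin)
  qed (simp add: L_1)
qed simp

lemma cct: "\<lbrakk>1 \<le> k; k < n; w \<in> V\<rbrakk> \<Longrightarrow>
    t k (c k (c (Suc k) w)) = - c k (c (Suc k) (t k w)) + e *s c k (c (Suc k) w) + e *s w"
  by (simp add: t_c t_c_Suc lin c_sq c_c[of "Suc k" k])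

text \<open>The operator identity L_k C_k L_k = C_k: conjugation by C_k inverts L_k. It also makes
  all eigenvalues of L_k nonzero. In the inductive step the quadratic relation absorbs the eps terms
  that arise when C passes T.\<close>

lemma L_c_self: "\<lbrakk>1 \<le> k; k \<le> n; w \<in> V\<rbrakk> \<Longrightarrow> L k (c k (L k w)) = c k w"
proof (induction k arbitrary: w)
  case (Suc k)
  show ?case
  proof (cases "k = 0")
    case False
    have 1: "t k (c (Suc k) (t k x + e *s c k (c (Suc k) x))) = c k x" if "x \<in> V" for x
      using that False Suc.prems
      by (simp add: lin t_c_Suc t_sq c_c[of "Suc k" k] c_sq t_c)
    have 2: "t k (c k (t k x)) + e *s c k (c (Suc k) (c k (t k x))) = c (Suc k) x" if "x \<in> V" for x
      using that False Suc.prems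
      by (simp add: lin t_c t_sq c_c[of "Suc k" k] c_sq)
    show ?thesis using False Suc
      by (simp add: L_Suc 1 2)
  qed (simp add: L_1)
qed simp

lemma L_c_below: "\<lbrakk>1 \<le> j; j < k; k \<le> n; w \<in> V\<rbrakk> \<Longrightarrow> L k (c j w) = c j (L k w)"
proof (induction k arbitrary: w)
  case (Suc k)
  then have k: "1 \<le> k" by simp
  show ?case
  proof (cases "j = k")
    case False
    then have "c k (c (Suc k) (c j x)) = c j (c k (c (Suc k) x))" if "x \<in> V" for x
      using Suc.prems that k by (simp add: c_c[of _ j] lin)
    then show ?thesis using False Suc k
      by (simp add: L_Suc t_c_other lin)
  next
    case True
    have "t k (c (Suc k) x) + e *s c k (c (Suc k) (c (Suc k) x)) = c k (t k x + e *s c k (c (Suc k) x))"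
      if "x \<in> V" for x
      using that k Suc.prems by (simp add: lin t_c_Suc c_sq c_c[of "Suc k" k])
    then show ?thesis
      using True k Suc.prems by (simp add: L_Suc t_c L_c_above)
  qed
qed simp

lemma L_c_other: "\<lbrakk>1 \<le> j; j \<le> n; 1 \<le> k; k \<le> n; j \<noteq> k; w \<in> V\<rbrakk> \<Longrightarrow> L k (c j w) = c j (L k w)"
  using L_c_above L_c_below by (metis nat_neq_iff)


text \<open>The left factor in the recursion for \<open>L\<close>. On V it satisfies the same
  quadratic relation as \<open>t k\<close>.\<close>

abbreviation tt :: "nat \<Rightarrow> 'w \<Rightarrow> 'w" where
  "tt k x \<equiv> t k x + e *s c k (c (Suc k) x)"

text \<open>The braid relation survives when two of the three factors are replaced by
  \<open>tt\<close>. This carries T_i past the two outermost factors of L_(i+2), the one case of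
  \<open>L_t_below\<close> that is not plain commutation.\<close>

lemma tt_braid:
  assumes "1 \<le> k" "Suc k < n" "w \<in> V"
  shows "t k (tt (Suc k) (tt k w)) = tt (Suc k) (tt k (t (Suc k) w))"
  using assms
  by (simp add: lin braid t_c t_c_Suc t_c_other c_sq t_sq c_c[of "Suc k" k] c_c[of "Suc (Suc k)" k]
     c_c[of "Suc (Suc k)" "Suc k"] algebra_simps)

lemma L_t_below: "\<lbrakk>1 \<le> i; Suc i < k; k \<le> n; w \<in> V\<rbrakk> \<Longrightarrow> L k (t i w) = t i (L k w)"
proof (induction k arbitrary: w)
  case (Suc k)
  then have k: "1 \<le> k" "k < n" by simp_all
  show ?case
  proof (cases "Suc i = k")
    case False
    then have "Suc i < k" using Suc.prems by simp
    then have "t k (t i x) = t i (t k x)" "t i (c k x) = c k (t i x)"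
        "t i (c (Suc k) x) = c (Suc k) (t i x)" if "x \<in> V" for x
      using Suc.prems that by (simp_all add: t_t' t_c_other)
    then show ?thesis using False Suc k
      by (simp add: L_Suc lin)
  next
    case True
    \<comment> \<open>L_(i+2) w unfolds to tt_(i+1) tt_i L_i T_i T_(i+1) w; x is the part to the
      right of the two \<open>tt\<close> factors.\<close>
    define x where "x = L i (t i (t (Suc i) w))"
    have "t (Suc i) x = L i (t i (t (Suc i) (t i w)))"
      using True k Suc.prems braid[of i w] by (simp add: x_def L_t_above[symmetric])
    then have "t i (tt (Suc i) (tt i x)) = tt (Suc i) (tt i (L i (t i (t (Suc i) (t i w)))))"
      using True k Suc.prems tt_braid[of i x] by (simp add: x_def)
    then show ?thesis
      using True[symmetric] k Suc.prems by (simp add: L_Suc x_def)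
  qed
qed simp

lemma L_t: "\<lbrakk>1 \<le> i; i < n; 1 \<le> k; k \<le> n; k \<noteq> i; k \<noteq> Suc i; w \<in> V\<rbrakk> \<Longrightarrow> L k (t i w) = t i (L k w)"
  by (metis L_t_above L_t_below linorder_neqE_nat not_less_eq less_antisym)

lemma L_L_less: "\<lbrakk>1 \<le> j; j < k; k \<le> n; w \<in> V\<rbrakk> \<Longrightarrow> L k (L j w) = L j (L k w)"
proof (induction j arbitrary: w)
  case (Suc j)
  show ?case
  proof (cases "j = 0")
    case False
    then show ?thesis using Suc by (simp add: L_Suc L_t L_c_other lin_L)
  qed (simp add: L_1)
qed simp

lemma L_L: "\<lbrakk>1 \<le> j; j \<le> n; 1 \<le> k; k \<le> n; w \<in> V\<rbrakk> \<Longrightarrow> L k (L j w) = L j (L k w)"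
  using L_L_less by (metis nat_neq_iff)

text \<open>\<open>tt k - e\<close> inverts \<open>tt k\<close>, so L_(k+1) = tt_k L_k T_k can be
  solved for L_k T_k. The companion \<open>L_Suc_t_self\<close> uses the quadratic relation for T_k
  on the other side.\<close>

lemma L_t_self:
  assumes k: "1 \<le> k" "k < n" and w: "w \<in> V"
  shows "L k (t k w) = tt k (L (Suc k) w) - e *s L (Suc k) w"
  using assms by (simp add: L_Suc lin cct t_sq c_sq c_c[of "Suc k" k])

lemma L_Suc_t_self:
  assumes k: "1 \<le> k" "k < n" and w: "w \<in> V"
  shows "L (Suc k) (t k w) = tt k (L k w) + e *s L (Suc k) w"
  using assms by (simp add: L_Suc lin lin_L t_sq)

end

section \<open>Jordan pairs and intertwiners\<close>

context hc_rep
begin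

abbreviation cd :: "nat \<Rightarrow> 'w \<Rightarrow> 'w" where
  "cd k w \<equiv> c k (c (Suc k) w)"

lemma c_inj: "\<lbrakk>1 \<le> k; k \<le> n; w \<in> V; c k w = 0\<rbrakk> \<Longrightarrow> w = 0"
  by (metis c_sq c_zero)

lemma c_c_sq: "\<lbrakk>1 \<le> i; i \<le> n; 1 \<le> j; j \<le> n; i \<noteq> j; w \<in> V\<rbrakk> \<Longrightarrow> c i (c j (c i (c j w))) = - w"
  by (simp add: c_c[of j i] lin c_sq)

lemma double_zero:
  fixes w :: 'w
  shows "w + w = 0 \<longleftrightarrow> w = 0"
proof -
  have "w + w = 2 *s w" by (metis mult_2 one_add_one scale_left_distrib scale_one)
  then show ?thesis using two_neq_0 by simp
qed

lemma eig_nonzero: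
  assumes "1 \<le> k" "k \<le> n" "w \<in> V" "w \<noteq> 0" "L k w = a *s w"
  shows "a \<noteq> 0"
  using L_c_self[of k w] c_inj[of k w] assms by (auto simp: c_zero L_zero)

text \<open>\<open>c k\<close> turns a Jordan pair for a into one for 1/a; the coefficient of
  \<open>c k v\<close> is the derivative of 1/a.\<close>

lemma jordan_c_self:
  assumes "1 \<le> k" "k \<le> n" "u \<in> V" "v \<in> V" "L k u = a *s u + v" "L k v = a *s v" "a \<noteq> 0"
  shows "L k (c k u) = inverse a *s c k u - (inverse a * inverse a) *s c k v"
proof -
  have v: "a *s L k (c k v) = c k v" using L_c_self[of k v] assms by (simp add: lin lin_L)
  then have v': "L k (c k v) = inverse a *s c k v" using assms
    by (metis scale_one scale_scale left_inverse)
  have "a *s L k (c k u) + L k (c k v) = c k u" using L_c_self[of k u] assms by (simp add: lin lin_L)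
  then have "a *s L k (c k u) = c k u - inverse a *s c k v" by (simp add: v' algebra_simps)
  then have "inverse a *s (a *s L k (c k u)) = inverse a *s (c k u - inverse a *s c k v)" by simp
  then show ?thesis using assms by (simp add: lin)
qed

lemma eig_c_self:
  assumes "1 \<le> k" "k \<le> n" "v \<in> V" "L k v = a *s v" "a \<noteq> 0"
  shows "L k (c k v) = inverse a *s c k v"
  using jordan_c_self[of k v 0 a] assms by (simp add: c_zero L_zero)

text \<open>Testing the square of L_k - a is enough: kernels of higher powers grow only if that of
  the square does.\<close>

definition no_jordan :: "nat \<Rightarrow> bool" where
  "no_jordan k \<longleftrightarrow> (\<forall>u \<in> V. \<forall>a. L k (L k u - a *s u) = a *s (L k u - a *s u) \<longrightarrow> L k u = a *s u)"

lemma no_jordanD: "\<lbrakk>no_jordan k; u \<in> V; L k u = a *s u + v; L k v = a *s v\<rbrakk> \<Longrightarrow> v = 0"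
  unfolding no_jordan_def by (metis add_diff_cancel_left' add_cancel_left_right)

text \<open>The block comes from T_k w: v = (L_k - a) T_k w lies in the span of w and C_k C_(k+1) w,
  on which L_k has the eigenvalues a and 1/a. If these are equal, T_k w and v form a Jordan pair; if
  not, applying L_k - 1/a first removes the second component.\<close>

lemma jordan_of_equal_eigenvalues:
  assumes k: "1 \<le> k" "k < n" and w: "w \<in> V" "w \<noteq> 0"
    and eig: "L k w = a *s w" "L (Suc k) w = a *s w"
  shows "\<not> no_jordan k"
proof
  assume nj: "no_jordan k"
  have a: "a \<noteq> 0" using eig_nonzero[of k w a] assms by simp
  define v where "v = (a * e) *s (cd k w - w)"
  have v: "v \<in> V" using w k by (simp add: v_def)
  have 1: "L k (t k w) = a *s t k w + v"
    using assms by (simp add: L_t_self v_def lin algebra_simps)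
  have cdw: "L k (cd k w) = inverse a *s cd k w"
    using assms a eig_c_self[of k "c (Suc k) w" a] by (simp add: L_c_above lin)
  have Lv: "L k v = (a * e) *s (inverse a *s cd k w - a *s w)"
    by (simp add: v_def lin lin_L cdw eig)
  have "v \<noteq> 0"
  proof
    assume "v = 0"
    then have "cd k w = w" using a eps_neq_0 by (simp add: v_def)
    then have "w = - w" using c_c_sq[of k "Suc k" w] k w by simp
    then show False using double_zero w by (metis add.right_inverse)
  qed
  show False
  proof (cases "inverse a = a")
    case True
    then have "L k v = a *s v" by (simp add: Lv) (simp add: v_def lin algebra_simps)
    then show False using no_jordanD[OF nj _ 1] w \<open>v \<noteq> 0\<close> by simp
  next
    case False
    define u where "u = L k (t k w) - inverse a *s t k w"
    define v' where "v' = L k v - inverse a *s v"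
    have v': "v' = ((a * e) * (inverse a - a)) *s w"
      by (simp add: v'_def Lv) (simp add: v_def lin algebra_simps)
    have "L k u = a *s u + v'"
      by (simp add: u_def v'_def 1 lin lin_L algebra_simps)
    moreover have "L k v' = a *s v'" by (simp add: v' lin_L eig mult.commute)
    ultimately have "v' = 0" using no_jordanD[OF nj, of u a v'] w by (simp add: u_def)
    then show False using v' False a eps_neq_0 w by simp
  qed
qed

text \<open>The intertwiner \<open>T k - A - B C k C (k + 1)\<close> between eigenvalues \<open>a\<close> of \<open>L k\<close> and \<open>b\<close> of
  \<open>L (k + 1)\<close>. For a Jordan pair \<open>L (k + 1) u = b u + v\<close> the coefficients become
  \<open>A + A1 N\<close> and \<open>B + B1 N\<close> with \<open>N u = v\<close>, where \<open>A1\<close> and \<open>B1\<close> are the derivatives in \<open>b\<close>.\<close>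

definition fA :: "'a \<Rightarrow> 'a \<Rightarrow> 'a" where "fA a b = e * b / (b - a)"
definition fA1 :: "'a \<Rightarrow> 'a \<Rightarrow> 'a" where "fA1 a b = - (e * a / (b - a)^2)"
definition fB :: "'a \<Rightarrow> 'a \<Rightarrow> 'a" where "fB a b = e * a * b / (1 - a * b)"
definition fB1 :: "'a \<Rightarrow> 'a \<Rightarrow> 'a" where "fB1 a b = e * a / (1 - a * b)^2"

definition phi :: "nat \<Rightarrow> 'a \<Rightarrow> 'a \<Rightarrow> 'w \<Rightarrow> 'w \<Rightarrow> 'w" where
  "phi k a b u v = t k u - fA a b *s u - fA1 a b *s v - fB a b *s cd k u - fB1 a b *s cd k v"

lemma phi_closed [simp]: "u \<in> V \<Longrightarrow> v \<in> V \<Longrightarrow> phi k a b u v \<in> V"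
  by (simp add: phi_def)

lemma phi_0 [simp]: "phi k a b 0 0 = 0"
  by (simp add: phi_def lin)

text \<open>L_k has eigenvalue 1/a on C_k C_(k+1) u, so comparing coefficients of u, v and their
  images under C_k C_(k+1) leaves scalar identities. Those belonging to v are the derivatives in b
  of those belonging to u.\<close>

lemma phi_intertwines:
  assumes k: "1 \<le> k" "k < n" and uv: "u \<in> V" "v \<in> V"
    and X: "L k u = a *s u" "L k v = a *s v"
    and Y: "L (Suc k) u = b *s u + v" "L (Suc k) v = b *s v"
    and ab: "a \<noteq> 0" "b \<noteq> 0" "a \<noteq> b" "a * b \<noteq> 1"
  shows "L k (phi k a b u v) = b *s phi k a b u v + phi k a b v 0"
    and "L (Suc k) (phi k a b u v) = a *s phi k a b u v"
proof -
  let ?A = "fA a b" and ?A1 = "fA1 a b" and ?B = "fB a b" and ?B1 = "fB1 a b"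
  have ba: "b - a \<noteq> 0" "1 - a * b \<noteq> 0" using ab by auto
  have Xcd: "L k (cd k u) = inverse a *s cd k u" "L k (cd k v) = inverse a *s cd k v"
    using eig_c_self[of k "c (Suc k) u" a] eig_c_self[of k "c (Suc k) v" a] assms
    by (simp_all add: L_c_above lin)
  have Ycd: "L (Suc k) (cd k v) = inverse b *s cd k v"
    "L (Suc k) (cd k u) = inverse b *s cd k u - (inverse b * inverse b) *s cd k v"
    using jordan_c_self[of "Suc k" u v b] eig_c_self[of "Suc k" v b] assms
    by (simp_all add: L_c_below lin)
  have 1: "- (e * b) - ?A * a + b * ?A = 0" "- e - ?A1 * a + ?A1 * b + ?A = 0"
    "e * b - ?B * inverse a + b * ?B = 0" "e - ?B1 * inverse a + ?B1 * b + ?B = 0"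
    using ab ba unfolding fA_def fA1_def fB_def fB1_def
    by (simp_all add: divide_simps) (simp_all add: algebra_simps power2_eq_square)
  have "L k (phi k a b u v) - b *s phi k a b u v - phi k a b v 0 =
      (- (e * b) - ?A * a + b * ?A) *s u + (- e - ?A1 * a + ?A1 * b + ?A) *s v
    + (e * b - ?B * inverse a + b * ?B) *s cd k u + (e - ?B1 * inverse a + ?B1 * b + ?B) *s cd k v"
    using k uv by (simp add: phi_def lin lin_L X Y Xcd L_t_self algebra_simps)
  then show "L k (phi k a b u v) = b *s phi k a b u v + phi k a b v 0"
    unfolding 1 by (simp add: diff_eq_eq add.commute)
  have 2: "e * b - ?A * b + a * ?A = 0" "e - ?A - ?A1 * b + ?A1 * a = 0"
    "e * a - ?B * inverse b + a * ?B = 0" "?B * (inverse b * inverse b) - ?B1 * inverse b + a * ?B1 = 0"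
    using ab ba unfolding fA_def fA1_def fB_def fB1_def
    by (simp_all add: divide_simps) (simp_all add: algebra_simps power2_eq_square)
  have "L (Suc k) (phi k a b u v) - a *s phi k a b u v =
      (e * b - ?A * b + a * ?A) *s u + (e - ?A - ?A1 * b + ?A1 * a) *s v
    + (e * a - ?B * inverse b + a * ?B) *s cd k u
    + (?B * (inverse b * inverse b) - ?B1 * inverse b + a * ?B1) *s cd k v"
    using k uv by (simp add: phi_def lin lin_L X Y Ycd L_Suc_t_self algebra_simps)
  then show "L (Suc k) (phi k a b u v) = a *s phi k a b u v" by (simp add: 2)
qed

lemma fA_sum: "a \<noteq> b \<Longrightarrow> fA a b + fA b a = e"
proof -
  assume "a \<noteq> b"
  then have ba: "b - a \<noteq> 0" by simp
  have "fA b a = - (e * a / (b - a))"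
    by (metis fA_def minus_diff_eq minus_divide_right)
  then have "fA a b + fA b a = (e * b - e * a) / (b - a)" by (simp add: fA_def diff_divide_distrib)
  also have "\<dots> = e * (b - a) / (b - a)" by (simp only: right_diff_distrib)
  finally show ?thesis using ba by simp
qed

lemma fB_commute: "fB a b = fB b a"
  by (simp add: fB_def ac_simps)

text \<open>If \<open>phi\<close> vanishes on \<open>v\<close>, the composite of the two opposite intertwiners is \<open>kap + kap1 N\<close>,
  with \<open>N\<close> as above.\<close>

definition kap :: "'a \<Rightarrow> 'a \<Rightarrow> 'a" where "kap a b = 1 + fA a b * fA b a - fB a b * (fB a b + e)"
definition kap1 :: "'a \<Rightarrow> 'a \<Rightarrow> 'a" where
  "kap1 a b = fA1 a b * (fA b a - fA a b) - fB1 a b * (fB a b + fB a b + e)"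

lemma scale_numeral:
  "(x * 2) *s w = x *s w + x *s w" "(x * 3) *s w = x *s w + x *s w + x *s w"
  "(x * 4) *s w = x *s w + x *s w + x *s w + x *s w"
  by (simp_all flip: scale_left_distrib)

lemmas scale_numerals = scale_numeral scale_numeral[of "y * z" for y z, unfolded mult.assoc]
  scale_numeral[of "x * (y * z)" for x y z, unfolded mult.assoc]

text \<open>Since \<open>phi\<close> kills v, T_k v is a combination of v and C_k C_(k+1) v. The
  remaining terms in T_k u cancel because fA a b + fA b a = eps and because T_k anticommutes with
  C_k C_(k+1) up to terms without T_k.\<close>

lemma phi_phi:
  assumes k: "1 \<le> k" "k < n" and uv: "u \<in> V" "v \<in> V" and ab: "a \<noteq> b"
    and v: "phi k a b v 0 = 0"
  shows "phi k b a (phi k a b u v) 0 = kap a b *s u + kap1 a b *s v"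
proof -
  define A A' A1 B B1 where AB: "A = fA a b" "A' = fA b a" "A1 = fA1 a b" "B = fB a b" "B1 = fB1 a b"
  have e: "e = A + A'" using fA_sum[OF ab] by (simp add: AB)
  have tv: "t k v = A *s v + B *s cd k v" using v by (simp add: phi_def AB lin algebra_simps)
  have cdcd: "cd k (cd k x) = - x" if "x \<in> V" for x
    using that k by (simp add: c_c_sq)
  define w where "w = t k u - A *s u - A1 *s v - B *s cd k u - B1 *s cd k v"
  have tw: "t k w = e *s t k u + u - A *s t k u - A1 *s t k v - B *s t k (cd k u) - B1 *s t k (cd k v)"
    using k uv by (simp add: w_def lin t_sq)
  have cdw: "cd k w = cd k (t k u) - A *s cd k u - A1 *s cd k v + B *s u + B1 *s v"
    using k uv by (simp add: w_def lin cdcd)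
  have "t k w - A' *s w - B *s cd k w = (1 + A * A' - B * (B + e)) *s u + (A1 * (A' - A) - B1 * (B + B + e)) *s v"
    unfolding tw cdw cct[OF k uv(1)] cct[OF k uv(2)] tv
    using k uv unfolding w_def
    by (simp add: cct cdcd tv lin e) (simp add: lin algebra_simps scale_numerals)
  then show ?thesis
    by (simp add: phi_def kap_def kap1_def AB w_def fB_commute[of b a] lin)
qed

text \<open>The full expansion of the braid relation on u also contains a multiple of C_k C_(k+1) v
  + C_(k+1) C_(k+2) v; hypothesis \<open>eq\<close> makes its coefficient vanish.\<close>

lemma braid_constraint:
  assumes k: "1 \<le> k" "Suc k < n" and uv: "u \<in> V" "v \<in> V"
    and t1: "t k u = A *s u + B *s cd k u" "t k v = A *s v + B *s cd k v"
    and t2: "t (Suc k) u = A' *s u + A1 *s v + B *s cd (Suc k) u + B1 *s cd (Suc k) v"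
      "t (Suc k) v = A' *s v + B *s cd (Suc k) v"
    and e: "A + A' = e" and eq: "B * (B + e) * A1 = A * A' * B1"
  shows "(A * A' * (A - A') - B * (B + e) * (B + B + e)) *s u
    + (A1 * A * (A - A' - A') - B1 * (B + e) * (B + B + B + e)) *s v
    + (B1 * A' * (A' + B + B) - A1 * B * (B + A' + A')) *s c k (c (Suc (Suc k)) v) = 0"
proof -
  \<comment> \<open>The generators get names of their own so that \<open>anti\<close> and
    \<open>ct\<close> rewrite every word to increasing Clifford monomials applied to u or v.\<close>
  define c1 c2 c3 where "c1 = c k" "c2 = c (Suc k)" "c3 = c (Suc (Suc k))"
  note cs = c1_c2_c3_def
  define T1 T2 where T12: "T1 = t k" "T2 = t (Suc k)"
  have Vc: "c1 w \<in> V" "c2 w \<in> V" "c3 w \<in> V" "T1 w \<in> V" "T2 w \<in> V" if "w \<in> V" for w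
    using that by (simp_all add: cs T12)
  have anti: "c2 (c1 w) = - c1 (c2 w)" "c3 (c1 w) = - c1 (c3 w)" "c3 (c2 w) = - c2 (c3 w)"
    "c1 (c1 w) = w" "c2 (c2 w) = w" "c3 (c3 w) = w" if "w \<in> V" for w
    using that k unfolding cs by (auto simp: c_sq intro: c_c)
  have ct: "T1 (c1 w) = c2 (T1 w)" "T1 (c2 w) = c1 (T1 w) - e *s (c1 w - c2 w)" "T1 (c3 w) = c3 (T1 w)"
    "T2 (c2 w) = c3 (T2 w)" "T2 (c3 w) = c2 (T2 w) - e *s (c2 w - c3 w)" "T2 (c1 w) = c1 (T2 w)"
    if "w \<in> V" for w
    using that k unfolding cs T12 by (simp_all add: t_c t_c_Suc t_c_other)
  have l: "ci (x + y) = ci x + ci y" "ci (a *s x) = a *s ci x" "ci (x - y) = ci x - ci y" "ci (- x) = - ci x"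
    if "ci \<in> {c1, c2, c3, T1, T2}" for ci x y a
    using that unfolding cs T12 by (auto simp: lin)
  note ll = l[of c1, simplified] l[of c2, simplified] l[of c3, simplified] l[of T1, simplified] l[of T2, simplified]
  have t1': "T1 u = A *s u + B *s c1 (c2 u)" "T1 v = A *s v + B *s c1 (c2 v)"
    and t2': "T2 u = A' *s u + A1 *s v + B *s c2 (c3 u) + B1 *s c2 (c3 v)" "T2 v = A' *s v + B *s c2 (c3 v)"
    using t1 t2 unfolding cs T12 by simp_all
  have "T1 (T2 (T1 u)) - T2 (T1 (T2 u)) = 0"
    using braid[of k u] k uv by (simp add: T12)
  moreover have "T1 (T2 (T1 u)) - T2 (T1 (T2 u)) =
      (A * A' * (A - A') - B * (B + e) * (B + B + e)) *s u
    + (A1 * A * (A - A' - A') - B1 * (B + e) * (B + B + B + e)) *s v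
    + (B1 * A' * (A' + B + B) - A1 * B * (B + A' + A')) *s c1 (c3 v)
    + (B * (B + e) * A1 - A * A' * B1) *s (c1 (c2 v) + c2 (c3 v))"
    using uv by (simp add: ll Vc anti ct t1' t2' e[symmetric] scale_right_distrib scale_right_diff_distrib)
      (simp add: lin algebra_simps scale_numerals)
  ultimately show ?thesis by (simp add: eq cs)
qed

lemma phi_zero_iff: "phi k a b u v = 0 \<longleftrightarrow>
    t k u = fA a b *s u + fA1 a b *s v + fB a b *s cd k u + fB1 a b *s cd k v"
  by (auto simp: phi_def algebra_simps)

text \<open>If two adjacent intertwiners vanish, the braid relation reduces to \<open>gam = 0\<close> on an eigenvector;
  \<open>gam1\<close> and \<open>gam2\<close> are the corrections on a Jordan pair.\<close>

definition gam :: "'a \<Rightarrow> 'a \<Rightarrow> 'a" where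
  "gam a b = fA a b * fA b a * (fA a b - fA b a) - fB a b * (fB a b + e) * (fB a b + fB a b + e)"
definition gam1 :: "'a \<Rightarrow> 'a \<Rightarrow> 'a" where
  "gam1 a b = fA1 b a * fA a b * (fA a b - fA b a - fA b a) - fB1 b a * (fB a b + e) * (fB a b + fB a b + fB a b + e)"
definition gam2 :: "'a \<Rightarrow> 'a \<Rightarrow> 'a" where
  "gam2 a b = fB1 b a * fA b a * (fA b a + fB a b + fB a b) - fA1 b a * fB a b * (fB a b + fA b a + fA b a)"

lemma fB_plus: "a * b \<noteq> 1 \<Longrightarrow> fB a b + e = e / (1 - a * b)"
  by (simp add: fB_def divide_simps) (simp add: algebra_simps)

text \<open>Meant for eigenvalues a, b, a at k, k + 1, k + 2, with a possible Jordan block at k + 2.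
  Both generators share one coefficient B in \<open>braid_constraint\<close> because
  \<open>fB\<close> is symmetric.\<close>

lemma phi_braid:
  assumes k: "1 \<le> k" "Suc k < n" and uv: "u \<in> V" "v \<in> V"
    and ab: "a \<noteq> b" "a * b \<noteq> 1"
    and phi: "phi k a b u 0 = 0" "phi k a b v 0 = 0" "phi (Suc k) b a u v = 0" "phi (Suc k) b a v 0 = 0"
  shows "gam a b *s u + gam1 a b *s v + gam2 a b *s c k (c (Suc (Suc k)) v) = 0"
proof -
  have "fB a b * (fB a b + e) * fA1 b a = fA a b * fA b a * fB1 b a"
  proof -
    have "fA b a = e * a / (a - b)" "fA a b = - (e * b / (a - b))"
      by (simp add: fA_def) (metis fA_def minus_diff_eq minus_divide_right)
    then show ?thesis
      using ab by (simp add: fB_plus) (simp add: fB_def fB1_def fA1_def ac_simps power2_eq_square)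
  qed
  then show ?thesis
    using braid_constraint[of k u v "fA a b" "fB a b" "fA b a" "fA1 b a" "fB1 b a"] assms
    by (simp add: phi_zero_iff fA_sum fB_commute[of b a] lin(6-10) gam_def gam1_def gam2_def)
qed

end

section \<open>Vanishing of the scalar coefficients\<close>

context hc_rep
begin

text \<open>Invariant under inversion of a, hence insensitive to applying
  \<open>c k\<close>.\<close>

abbreviation xv :: "'a \<Rightarrow> 'a" where "xv a \<equiv> a + inverse a"

lemma xv_eq_iff:
  assumes "a \<noteq> 0" "b \<noteq> 0"
  shows "xv a = xv b \<longleftrightarrow> a = b \<or> a * b = 1"
proof -
  have "(a - b) * (a * b - 1) = a * b * (xv a - xv b)"
    using assms by (simp add: field_simps)
  then show ?thesis using assms by (metis eq_iff_diff_eq_0 mult_eq_0_iff)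
qed

text \<open>With d = b - a and r = 1 - a b, clearing denominators leaves d r and a b (r^2 + d^2),
  both of which are expressible through a + 1/a and b + 1/b up to powers of a b. The resulting
  equation says that the two contents are neighbours; see \<open>adjacent_cases\<close>.\<close>

lemma kap_zero:
  assumes nz: "a \<noteq> 0" "b \<noteq> 0" and ab: "a \<noteq> b" "a * b \<noteq> 1" and kap: "kap a b = 0"
  shows "(xv a - xv b)^2 = e^2 * (xv a * xv b - 4)"
proof -
  define d r where "d = b - a" and "r = 1 - a * b"
  have dr: "d \<noteq> 0" "r \<noteq> 0" using ab by (auto simp: d_def r_def)
  have "fA b a = - (e * a / d)"
    by (metis fA_def minus_diff_eq minus_divide_right d_def)
  then have "kap a b = 1 - e^2 * (a * b) / d^2 - e^2 * (a * b) / r^2"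
    using ab by (simp add: kap_def fB_plus) (simp add: fB_def fA_def flip: d_def r_def add: power2_eq_square ac_simps)
  then have "d^2 * r^2 * kap a b = d^2 * r^2 - e^2 * (a * b) * (r^2 + d^2)"
    using dr by (simp add: field_simps)
  then have "d^2 * r^2 = e^2 * (a * b) * (r^2 + d^2)" using kap by simp
  moreover have "d * r = (a * b) * (xv a - xv b)"
    using nz unfolding d_def r_def by (simp add: field_simps)
  then have "d^2 * r^2 = (a * b)^2 * (xv a - xv b)^2"
    by (simp flip: power_mult_distrib)
  moreover have "(a * b) * (r^2 + d^2) = (a * b)^2 * (xv a * xv b - 4)"
    using nz unfolding d_def r_def power2_eq_square by (simp add: field_simps)
  ultimately have "(a * b)^2 * (xv a - xv b)^2 = (a * b)^2 * (e^2 * (xv a * xv b - 4))"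
    by (simp add: mult.assoc mult.left_commute)
  then show ?thesis using nz by simp
qed

text \<open>The numerator of \<open>kap1\<close> is divisible by 1 - b^2, and up to a monomial the
  cofactor depends only on a + 1/a and b + 1/b.\<close>

lemma kap1_zero:
  assumes nz: "a \<noteq> 0" "b \<noteq> 0" and ab: "a \<noteq> b" "a * b \<noteq> 1" and kap: "kap1 a b = 0"
  shows "b^2 = 1 \<or> (xv a)^2 + xv a * xv b = 8"
proof -
  define d r where "d = b - a" and "r = 1 - a * b"
  have dr: "d \<noteq> 0" "r \<noteq> 0" using ab by (auto simp: d_def r_def)
  have 1: "fA b a = - (e * a / d)"
    by (metis fA_def minus_diff_eq minus_divide_right d_def)
  have 2: "fB a b + fB a b + e = e * (1 + a * b) / r"
    unfolding add.assoc fB_plus[OF ab(2)]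
    by (simp add: fB_def algebra_simps flip: add_divide_distrib r_def)
  have "kap1 a b = e^2 * a * (a + b) / d^3 - e^2 * a * (1 + a * b) / r^3"
    unfolding kap1_def 1 2 unfolding fA_def fA1_def fB1_def d_def[symmetric] r_def[symmetric] using dr
    by (simp add: field_simps power2_eq_square power3_eq_cube)
  then have "d^3 * r^3 * kap1 a b = e^2 * a * ((a + b) * r^3 - (1 + a * b) * d^3)"
    using dr by (simp add: field_simps)
  then have "(a + b) * r^3 - (1 + a * b) * d^3 = 0" using kap nz eps_neq_0 by simp
  moreover have "(a + b) * r^3 - (1 + a * b) * d^3 =
      (1 - b^2) * (b * (a^2 + 1)^2 + a * (a^2 + 1) * (b^2 + 1) - 8 * a^2 * b)"
    unfolding d_def r_def by (simp add: algebra_simps power2_eq_square power3_eq_cube)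
  moreover have "b * (a^2 + 1)^2 + a * (a^2 + 1) * (b^2 + 1) - 8 * a^2 * b
      = a^2 * b * ((xv a)^2 + xv a * xv b - 8)"
    using nz by (simp add: field_simps power2_eq_square)
  ultimately show ?thesis using nz by simp
qed

text \<open>The polynomial of \<open>kap1_zero\<close> reappears with a and b exchanged. Hence the
  quadratic relation on a Jordan pair and the braid relation leave the same exceptional
  configurations open.\<close>

lemma gam_eq:
  assumes nz: "a \<noteq> 0" "b \<noteq> 0" and ab: "a \<noteq> b" "a * b \<noteq> 1"
  shows "(a - b)^3 * (1 - a * b)^3 * gam a b =
    e^3 * a * b * ((1 - a^2) * (a * b^2 * ((xv b)^2 + xv a * xv b - 8)))"
proof -
  define d r where "d = a - b" and "r = 1 - a * b"
  have dr: "d \<noteq> 0" "r \<noteq> 0" using ab by (auto simp: d_def r_def)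
  have 1: "fA a b = - (e * b / d)"
    by (metis fA_def minus_diff_eq minus_divide_right d_def)
  have 2: "fB a b + fB a b + e = e * (1 + a * b) / r"
    unfolding add.assoc fB_plus[OF ab(2)]
    by (simp add: fB_def algebra_simps flip: add_divide_distrib r_def)
  have "gam a b = e^3 * a * b * ((a + b) / d^3 - (1 + a * b) / r^3)"
    unfolding gam_def 2 fB_plus[OF ab(2)] 1 unfolding fA_def fB_def d_def[symmetric] r_def[symmetric]
    using dr by (simp add: field_simps power2_eq_square power3_eq_cube)
  then have "d^3 * r^3 * gam a b = e^3 * a * b * ((a + b) * r^3 - (1 + a * b) * d^3)"
    using dr by (simp add: field_simps)
  also have "(a + b) * r^3 - (1 + a * b) * d^3 =
      (1 - a^2) * (a * (b^2 + 1)^2 + b * (a^2 + 1) * (b^2 + 1) - 8 * b^2 * a)"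
    unfolding d_def r_def by (simp add: algebra_simps power2_eq_square power3_eq_cube)
  also have "a * (b^2 + 1)^2 + b * (a^2 + 1) * (b^2 + 1) - 8 * b^2 * a
      = a * b^2 * ((xv b)^2 + xv a * xv b - 8)"
    using nz by (simp add: field_simps power2_eq_square)
  finally show ?thesis by (simp add: d_def r_def)
qed

lemma gam_zero_iff:
  assumes nz: "a \<noteq> 0" "b \<noteq> 0" and ab: "a \<noteq> b" "a * b \<noteq> 1"
  shows "gam a b = 0 \<longleftrightarrow> a^2 = 1 \<or> (xv b)^2 + xv a * xv b = 8"
  using arg_cong[OF gam_eq[OF assms], of "\<lambda>z. z = 0"] assms eps_neq_0 by auto

lemma gam12_eq:
  assumes ab: "a \<noteq> b" "a * b \<noteq> 1"
  defines "d \<equiv> a - b" and "r \<equiv> 1 - a * b"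
  shows "d^4 * r^4 * gam1 a b = - (e^3 * b * ((b^2 + 2 * a * b) * r^4 + (1 + 2 * a * b) * d^4))"
    and "d^3 * r^3 * gam2 a b = e^3 * a^2 * b * ((1 + b^2) * d * r + 2 * b * (r^2 + d^2))"
proof -
  have dr: "d \<noteq> 0" "r \<noteq> 0" using ab by (auto simp: d_def r_def)
  have 1: "fA a b = - (e * b / d)"
    by (metis fA_def minus_diff_eq minus_divide_right d_def)
  have 3: "fB a b + fB a b + fB a b + e = e * (1 + 2 * a * b) / r"
    unfolding add.assoc fB_plus[OF ab(2)]
    by (simp add: fB_def algebra_simps flip: add_divide_distrib r_def)
  have r: "r = 1 - b * a" by (simp add: r_def)
  show "d^4 * r^4 * gam1 a b = - (e^3 * b * ((b^2 + 2 * a * b) * r^4 + (1 + 2 * a * b) * d^4))"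
    unfolding gam1_def 3 fB_plus[OF ab(2)] 1
    unfolding fA_def fB_def fA1_def fB1_def d_def[symmetric] r_def[symmetric] r[symmetric]
    using dr by (simp add: field_simps) (simp add: algebra_simps eval_nat_numeral)
  show "d^3 * r^3 * gam2 a b = e^3 * a^2 * b * ((1 + b^2) * d * r + 2 * b * (r^2 + d^2))"
    unfolding gam2_def fB_plus[OF ab(2)] 1
    unfolding fA_def fB_def fA1_def fB1_def d_def[symmetric] r_def[symmetric] r[symmetric]
    using dr by (simp add: field_simps) (simp add: algebra_simps eval_nat_numeral)
qed

text \<open>At a = 1 one has d = r, and \<open>gam1\<close> and \<open>gam2\<close> become opposite
  to each other; their sum of squares is then twice a square. This sum is the norm of gam1 + gam2
  C_k C_(k+2), whose Clifford product squares to -1.\<close>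

lemma gam12_one:
  assumes b: "b \<noteq> 0" "1 \<noteq> b" and y: "xv b \<noteq> - 4"
  shows "(gam1 1 b)^2 + (gam2 1 b)^2 \<noteq> 0"
proof -
  define r where "r = 1 - b"
  have r: "r \<noteq> 0" using b by (auto simp: r_def)
  define s where "s = b * b + 4 * b + 1"
  have s: "s \<noteq> 0"
  proof
    assume "s = 0"
    moreover have "s = b * (xv b + 4)" using b by (simp add: s_def field_simps)
    ultimately have "xv b + 4 = 0" using b by simp
    then show False using y by (simp add: eq_neg_iff_add_eq_0)
  qed
  have "r^8 * gam1 1 b = - (e^3 * b * r^4 * s)"
    using gam12_eq(1)[of 1 b] b by (simp add: s_def flip: r_def) (simp add: algebra_simps eval_nat_numeral)
  moreover have "r^6 * gam2 1 b = e^3 * b * r^2 * s"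
    using gam12_eq(2)[of 1 b] b by (simp add: s_def flip: r_def) (simp add: algebra_simps eval_nat_numeral)
  ultimately have "r^4 * (r^4 * gam1 1 b) = r^4 * (- (e^3 * b * s))" "r^2 * (r^4 * gam2 1 b) = r^2 * (e^3 * b * s)"
    by (simp_all add: algebra_simps eval_nat_numeral)
  then have "r^4 * gam1 1 b = - (e^3 * b * s)" and "r^4 * gam2 1 b = e^3 * b * s"
    unfolding mult_cancel_left using r by simp_all
  then have "(r^4 * gam1 1 b)^2 + (r^4 * gam2 1 b)^2 = 2 * (e^3 * b * s)^2" by simp
  then have "r^8 * ((gam1 1 b)^2 + (gam2 1 b)^2) = 2 * (e^3 * b * s)^2"
    by (simp add: algebra_simps flip: power_mult)
  then show ?thesis using b s eps_neq_0 two_neq_0 by auto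
qed

lemma gam2_zero:
  assumes nz: "a \<noteq> 0" "b \<noteq> 0" and ab: "a \<noteq> b" "a * b \<noteq> 1" and y: "(xv b)^2 + xv a * xv b = 8"
  shows "gam2 a b = 0"
proof -
  define d r where "d = a - b" and "r = 1 - a * b"
  have dr: "d \<noteq> 0" "r \<noteq> 0" using ab by (auto simp: d_def r_def)
  have "(1 + b^2) * d * r + 2 * b * (r^2 + d^2) = - a * b^2 * (8 - ((xv b)^2 + xv a * xv b))"
    using nz unfolding d_def r_def by (simp add: field_simps power2_eq_square)
  then have "(1 + b^2) * d * r + 2 * b * (r^2 + d^2) = 0" unfolding y by simp
  then have "d^3 * r^3 * gam2 a b = 0"
    using gam12_eq(2)[OF ab] by (simp flip: d_def r_def)
  then show ?thesis using dr by simp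
qed

text \<open>With d = a - b and r = 1 - a b, hypothesis \<open>y\<close> becomes E = 0 and gam1 = 0
  becomes D = 0. The identity a (r + b d) = d + r b eliminates a without division, and modulo E the
  product D (r + b d) d splits into two factors.\<close>

lemma gam1_zero:
  assumes nz: "a \<noteq> 0" "b \<noteq> 0" and ab: "a \<noteq> b" "a * b \<noteq> 1" and y: "(xv b)^2 + xv a * xv b = 8"
    and "gam1 a b = 0"
  shows "xv b \<in> {0, 4, -4}"
proof -
  define d r where "d = a - b" and "r = 1 - a * b"
  have dr: "d \<noteq> 0" "r \<noteq> 0" using ab by (auto simp: d_def r_def)
  define E where "E = (b^2 + 1) * (r * d) + 2 * b * (r^2 + d^2)"
  have "E = - a * b^2 * (8 - ((xv b)^2 + xv a * xv b))"
    using nz unfolding d_def r_def E_def by (simp add: field_simps power2_eq_square)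
  then have E: "E = 0" unfolding y by simp
  have y_b: "b^2 + 1 = b * xv b" using nz by (simp add: field_simps power2_eq_square)
  define D where "D = (b^2 + 2 * a * b) * r^4 + (1 + 2 * a * b) * d^4"
  have "e^3 * b * D = 0" using gam12_eq(1)[OF ab] \<open>gam1 a b = 0\<close> by (simp add: D_def d_def r_def)
  then have D: "D = 0" using nz eps_neq_0 by simp
  have a: "a * (r + b * d) = d + r * b" by (simp add: d_def r_def algebra_simps)
  have "D * (r + b * d) = (b^2 * (r + b * d) + 2 * b * (a * (r + b * d))) * r^4
      + ((r + b * d) + 2 * b * (a * (r + b * d))) * d^4"
    by (simp add: D_def algebra_simps)
  then have "D * (r + b * d) * d = E * (r^3 * d * b + r^4 - 2 * r^2 * d^2 + 2 * d^4)
      - (r^2 - d^2)^2 * (r * d + b * (2 * r^2 + d^2))"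
    unfolding a E_def by (simp add: algebra_simps eval_nat_numeral)
  then have "(r^2 - d^2)^2 * (r * d + b * (2 * r^2 + d^2)) = 0" by (simp add: D E)
  then consider "r^2 = d^2" | "r * d = - b * (2 * r^2 + d^2)"
    by (auto simp: eq_neg_iff_add_eq_0)
  then show ?thesis
  proof cases
    case 1
    then have "r = d \<or> r = - d" by (simp add: power2_eq_iff)
    then have "d^2 * b * (xv b + 4) = 0 \<or> d^2 * b * (- xv b + 4) = 0"
      using E unfolding E_def y_b by (auto simp: algebra_simps power2_eq_square)
    then have "xv b + 4 = 0 \<or> - xv b + 4 = 0" using nz dr by (metis mult_eq_0_iff power_not_zero)
    then have "xv b = - 4 \<or> xv b = 4"
      by (metis add_eq_0_iff2 minus_equation_iff neg_eq_iff_add_eq_0)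
    then show ?thesis by blast
  next
    case 2
    \<comment> \<open>Combining this case with E = 0 yields r^2 + d^2 = 0, after which E leaves only
      b^2 + 1 = 0.\<close>
    have "(r * d)^2 = b^2 * (2 * r^2 + d^2)^2" unfolding 2 by (simp add: power_mult_distrib)
    moreover have "E = b * (2 * (r^2 + d^2)) - b * ((b^2 + 1) * (2 * r^2 + d^2))"
      unfolding E_def 2 by (simp add: algebra_simps)
    then have "b * ((b^2 + 1) * (2 * r^2 + d^2)) = b * (2 * (r^2 + d^2))" unfolding E by (metis eq_iff_diff_eq_0)
    then have "(b^2 + 1) * (2 * r^2 + d^2) = 2 * (r^2 + d^2)" using nz by (metis mult_cancel_left)
    then have "(b^2 + 1) * (2 * r^2 + d^2) * (2 * r^2 + d^2) = 2 * (r^2 + d^2) * (2 * r^2 + d^2)" by simp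
    then have "b^2 * (2 * r^2 + d^2)^2 + (2 * r^2 + d^2)^2 = 2 * (r^2 + d^2) * (2 * r^2 + d^2)"
      by (simp add: power2_eq_square algebra_simps)
    ultimately have "(r * d)^2 + (2 * r^2 + d^2)^2 = 2 * (r^2 + d^2) * (2 * r^2 + d^2)" by simp
    then have "d^2 * (r^2 + d^2) = 0" by (simp add: algebra_simps power2_eq_square)
    then have "r^2 + d^2 = 0" using dr by simp
    then have "(b^2 + 1) * (r * d) = 0" using E unfolding E_def by simp
    then have "xv b = 0" using dr nz by (simp add: y_b)
    then show ?thesis by simp
  qed
qed

lemma phi_braid_true:
  assumes "1 \<le> k" "Suc k < n" "v \<in> V" "v \<noteq> 0"
    and "a \<noteq> 0" "b \<noteq> 0" "a \<noteq> b" "a * b \<noteq> 1"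
    and "phi k a b v 0 = 0" "phi (Suc k) b a v 0 = 0"
  shows "a^2 = 1 \<or> (xv b)^2 + xv a * xv b = 8"
  using phi_braid[of k v 0 a b] assms by (simp add: lin gam_zero_iff)

text \<open>When gam = 0, the braid relation on the pair reads (gam1 + gam2 C_k C_(k+2)) v = 0.
  Applying C_k C_(k+2), whose square is -1, turns this into the scalar equation gam1^2 + gam2^2 =
  0.\<close>

lemma phi_braid_jordan:
  assumes k: "1 \<le> k" "Suc k < n" and uv: "u \<in> V" "v \<in> V" "v \<noteq> 0"
    and ab: "a \<noteq> 0" "b \<noteq> 0" "a \<noteq> b" "a * b \<noteq> 1"
    and phi: "phi k a b u 0 = 0" "phi k a b v 0 = 0" "phi (Suc k) b a u v = 0" "phi (Suc k) b a v 0 = 0"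
  shows "a \<noteq> 1 \<or> xv b = -4" and "(xv b)^2 + xv a * xv b = 8 \<Longrightarrow> xv b \<in> {0, 4, -4}"
proof -
  let ?z = "c k (c (Suc (Suc k)) v)"
  have 1: "gam1 a b *s v + gam2 a b *s ?z = 0" if "gam a b = 0"
    using phi_braid[of k u v a b] assms that by simp
  have 2: "(gam1 a b)^2 + (gam2 a b)^2 = 0" if "gam a b = 0"
  proof -
    have "c k (c (Suc (Suc k)) (gam1 a b *s v + gam2 a b *s ?z)) = 0" by (simp add: 1[OF that] lin)
    then have "gam1 a b *s ?z - gam2 a b *s v = 0" using k uv by (simp add: lin c_c_sq)
    then have "gam1 a b *s (gam1 a b *s v + gam2 a b *s ?z)
        - gam2 a b *s (gam1 a b *s ?z - gam2 a b *s v) = 0"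
      using 1[OF that] by simp
    then have "((gam1 a b)^2 + (gam2 a b)^2) *s v = 0"
      by (simp add: lin algebra_simps power2_eq_square)
    then show ?thesis using uv by simp
  qed
  show "a \<noteq> 1 \<or> xv b = -4"
    using 2 gam_zero_iff[OF ab] gam12_one[of b] ab by auto
  show "xv b \<in> {0, 4, -4}" if y: "(xv b)^2 + xv a * xv b = 8"
    using 2 gam_zero_iff[OF ab] gam2_zero[OF ab y] gam1_zero[OF ab y] y by auto
qed

end


section \<open>Contents at a root of unity\<close>

lemma primitive_root_powi_eq_1_iff:
  fixes q :: "'a::field"
  assumes "primitive_root_of_unity h q"
  shows "q powi j = 1 \<longleftrightarrow> int h dvd j"
proof -
  have h: "h > 0" "q ^ h = 1" and min: "\<And>k. \<lbrakk>0 < k; k < h\<rbrakk> \<Longrightarrow> q ^ k \<noteq> 1"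
    using assms by (auto simp: primitive_root_of_unity_def)
  have q: "q \<noteq> 0" using h by (metis power_0_left not_gr_zero zero_neq_one)
  define r where "r = nat (j mod int h)"
  have "q powi j = q powi (int h * (j div int h) + int r)"
    using h by (simp add: r_def)
  also have "\<dots> = (q powi int h) powi (j div int h) * q ^ r"
    using q by (simp add: power_int_add power_int_mult)
  also have "\<dots> = q ^ r" using h by simp
  finally have "q powi j = q ^ r" .
  moreover have "q ^ r = 1 \<longleftrightarrow> r = 0"
  proof -
    have "r < h" using h by (simp add: r_def nat_less_iff)
    then show ?thesis using min[of r] by auto
  qed
  moreover have "r = 0 \<longleftrightarrow> int h dvd j" using h by (auto simp: r_def dvd_eq_mod_eq_0 intro: order.antisym)
  ultimately show ?thesis by simp
qed

locale root_of_unity =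
  fixes h :: nat and q :: "'a::field"
  assumes odd_h: "odd h" and h_ge_3: "3 \<le> h" and prim: "primitive_root_of_unity h q"
    and two_neq_0': "(2 :: 'a) \<noteq> 0"
begin

lemma q_neq_0: "q \<noteq> 0"
  using prim unfolding primitive_root_of_unity_def by (metis power_0_left not_gr_zero zero_neq_one)

lemma powi_eq_1_iff: "q powi j = 1 \<longleftrightarrow> int h dvd j"
  by (rule primitive_root_powi_eq_1_iff[OF prim])

lemma h_dvd_double: "int h dvd 2 * j \<longleftrightarrow> int h dvd j"
  using odd_h by (intro coprime_dvd_mult_right_iff) simp

text \<open>Doubling the exponent of a power equal to -1 gives a multiple of h; as h is odd, the
  exponent itself is already one.\<close>

lemma powi_neq_minus_1: "q powi j \<noteq> - 1"
proof
  assume 1: "q powi j = - 1"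
  have "q powi (2 * j) = (q powi j)^2"
    by (metis mult.commute power_int_mult power_int_of_nat of_nat_numeral)
  then have "int h dvd j" using 1 powi_eq_1_iff[of "2 * j"] by (simp add: h_dvd_double)
  then show False using 1 powi_eq_1_iff[of j] two_neq_0'
    by (metis add.right_inverse one_add_one)
qed

lemma eps_neq_0': "eps q \<noteq> 0"
proof
  assume "eps q = 0"
  then have "q powi 2 = 1" using q_neq_0 by (simp add: eps_def power2_eq_square field_simps)
  then have "int h dvd 2" by (simp only: powi_eq_1_iff)
  then show False using h_ge_3 zdvd_imp_le by fastforce
qed

definition sq :: 'a where "sq = q + inverse q"

lemma sq_neq_0: "sq \<noteq> 0"
proof
  assume "sq = 0"
  then have "q powi 2 = - 1" using q_neq_0
    by (simp add: sq_def power2_eq_square field_simps eq_neg_iff_add_eq_0)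
  then show False using powi_neq_minus_1 by blast
qed

text \<open>The eigenvalue of \<open>L + L\<^sup>-\<^sup>1\<close> on a box of content \<open>j\<close>.\<close>

definition cont :: "int \<Rightarrow> 'a" where
  "cont j = 2 * (q powi (2 * j + 1) + inverse (q powi (2 * j + 1))) / sq"

lemma xv_eq_iff':
  fixes a b :: 'a
  assumes "a \<noteq> 0" "b \<noteq> 0"
  shows "a + inverse a = b + inverse b \<longleftrightarrow> a = b \<or> a * b = 1"
proof -
  have "(a - b) * (a * b - 1) = a * b * ((a + inverse a) - (b + inverse b))"
    using assms by (simp add: field_simps)
  then show ?thesis using assms by (metis eq_iff_diff_eq_0 mult_eq_0_iff)
qed

text \<open>The second alternative is the reflection i -> -1 - i, which inverts q^(2i+1). The factor
  2 in the exponents drops out because h is odd.\<close>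

lemma cont_eq_iff: "cont i = cont j \<longleftrightarrow> int h dvd i - j \<or> int h dvd i + j + 1"
proof -
  let ?z = "q powi (2 * i + 1)" and ?w = "q powi (2 * j + 1)"
  have nz: "?z \<noteq> 0" "?w \<noteq> 0" using q_neq_0 by simp_all
  have "2 * x / sq = 2 * y / sq \<longleftrightarrow> x = y" for x y
    using sq_neq_0 two_neq_0' by simp
  then have "cont i = cont j \<longleftrightarrow> ?z + inverse ?z = ?w + inverse ?w"
    unfolding cont_def .
  also have "\<dots> \<longleftrightarrow> ?z = ?w \<or> ?z * ?w = 1" by (rule xv_eq_iff'[OF nz])
  also have "?z = ?w \<longleftrightarrow> q powi (2 * (i - j)) = 1"
    using nz q_neq_0 by (simp add: power_int_diff power_int_add right_diff_distrib field_simps)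
  also have "?z * ?w = q powi (2 * (i + j + 1))"
    using q_neq_0 by (simp flip: power_int_add add: algebra_simps)
  finally show ?thesis by (simp only: powi_eq_1_iff h_dvd_double)
qed

lemma cont_0: "cont 0 = 2"
  using sq_neq_0 by (simp add: cont_def del: distrib_left_numeral flip: sq_def)

lemma cont_eq_2_iff: "cont i = 2 \<longleftrightarrow> int h dvd i \<or> int h dvd i + 1"
  using cont_eq_iff[of i 0] by (simp add: cont_0)

text \<open>The value -2 would require q^(2i+1) to be -q or its inverse, making -1 a power of q. So
  L = -1 never occurs on a box.\<close>

lemma cont_neq_minus_2: "cont i \<noteq> - 2"
proof
  assume 1: "cont i = - 2"
  let ?z = "q powi (2 * i + 1)"
  have nz: "?z \<noteq> 0" "- q \<noteq> 0" using q_neq_0 by simp_all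
  have "2 * (?z + inverse ?z) = 2 * (- q + inverse (- q))"
    using 1 sq_neq_0 q_neq_0 by (simp add: cont_def divide_simps sq_def) (simp add: algebra_simps)?
  then have "?z + inverse ?z = - q + inverse (- q)"
    using two_neq_0' by (metis mult_cancel_left)
  then have "?z = - q \<or> ?z * - q = 1" using xv_eq_iff'[OF nz] by blast
  then have "q powi (2 * i) = - 1 \<or> q powi (2 * i + 2) = - 1"
  proof
    assume "?z = - q"
    then have "q powi (2 * i) * q = - 1 * q" using q_neq_0 by (simp add: power_int_add)
    then show ?thesis using q_neq_0 by (metis mult_right_cancel)
  next
    assume "?z * - q = 1"
    moreover have "q powi (2 * i + 2) = ?z * q"
      using q_neq_0 power_int_add[of q "2 * i + 1" 1] by (simp add: add.commute)
    ultimately show ?thesis by (metis minus_minus mult_minus_right)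
  qed
  then show False using powi_neq_minus_1 by blast
qed

lemma cont_shift:
  assumes "z = q powi (2 * i + 1)"
  shows "cont i = 2 * (z + inverse z) / sq" "cont (i + 1) = 2 * (z * q^2 + inverse (z * q^2)) / sq"
    "cont (i - 1) = 2 * (z / q^2 + q^2 / z) / sq"
proof -
  have 1: "2 * (i + 1) + 1 = (2 * i + 1) + 2" "2 * (i - 1) + 1 = (2 * i + 1) - 2" by simp_all
  have "q powi ((2 * i + 1) + 2) = z * q powi 2" "q powi ((2 * i + 1) - 2) = z / q powi 2"
    unfolding assms using q_neq_0 by (simp_all only: power_int_add power_int_diff simp_thms)
  then have "q powi (2 * (i + 1) + 1) = z * q^2" "q powi (2 * (i - 1) + 1) = z / q^2"
    unfolding 1 by simp_all
  then show "cont i = 2 * (z + inverse z) / sq" "cont (i + 1) = 2 * (z * q^2 + inverse (z * q^2)) / sq"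
    "cont (i - 1) = 2 * (z / q^2 + q^2 / z) / sq"
    using q_neq_0 by (simp_all add: cont_def assms)
qed

text \<open>Sum and product identify the neighbours of cont i as the two roots y of (cont i - y)^2 =
  eps^2 (cont i y - 4), the equation obtained from kap = 0.\<close>

lemma cont_sum: "cont (i + 1) + cont (i - 1) = (2 + (eps q)^2) * cont i"
  and cont_prod: "cont (i + 1) * cont (i - 1) = (cont i)^2 + 4 * (eps q)^2"
proof -
  define z where "z = q powi (2 * i + 1)"
  have z: "z \<noteq> 0" using q_neq_0 by (simp add: z_def)
  have e: "2 + (eps q)^2 = q^2 + inverse (q^2)" using q_neq_0
    by (simp add: eps_def power2_eq_square field_simps)
  have "(z * q^2 + inverse (z * q^2)) + (z / q^2 + q^2 / z) = (q^2 + inverse (q^2)) * (z + inverse z)"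
    using z q_neq_0 by (simp add: field_simps)
  then show "cont (i + 1) + cont (i - 1) = (2 + (eps q)^2) * cont i"
    unfolding cont_shift[OF z_def] e
    by (metis (no_types, lifting) add_divide_distrib distrib_left mult.left_commute times_divide_eq_right)
  have es: "eps q * sq = q^2 - inverse (q^2)"
    using q_neq_0 by (simp add: sq_def eps_def power2_eq_square field_simps)
  have "(z * q^2 + inverse (z * q^2)) * (z / q^2 + q^2 / z) = (z + inverse z)^2 + (eps q * sq)^2"
    unfolding es using z q_neq_0 by (simp add: field_simps power2_eq_square)
  moreover have "2 * P / sq * (2 * Q / sq) = (2 * R / sq)^2 + 4 * (eps q)^2"
    if "P * Q = R^2 + (eps q * sq)^2" for P Q R
  proof -
    have "2 * P / sq * (2 * Q / sq) = 4 * (P * Q) / sq^2" by (simp add: power2_eq_square)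
    then show ?thesis using sq_neq_0 unfolding that
      by (simp add: power_divide power_mult_distrib add_divide_distrib)
  qed
  ultimately show "cont (i + 1) * cont (i - 1) = (cont i)^2 + 4 * (eps q)^2"
    unfolding cont_shift[OF z_def] by blast
qed

lemma adjacent_cases:
  assumes "(cont i - y)^2 = (eps q)^2 * (cont i * y - 4)"
  shows "y = cont (i + 1) \<or> y = cont (i - 1)"
proof -
  have "(y - cont (i + 1)) * (y - cont (i - 1)) = y^2 - (cont (i + 1) + cont (i - 1)) * y + cont (i + 1) * cont (i - 1)"
    by (simp add: algebra_simps power2_eq_square)
  also have "\<dots> = 0"
    unfolding cont_sum cont_prod using assms by (simp add: algebra_simps power2_eq_square)
  finally show ?thesis by auto
qed

lemma not_h_dvd_2: "\<not> int h dvd 2"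
  using h_ge_3 zdvd_imp_le by fastforce

text \<open>Inserting the value 8 into the neighbour equation lets a factor x - y cancel and leaves
  2x = (2 + eps^2) y, the sum of both neighbours of y. So x is a double root and the two neighbours
  coincide.\<close>

lemma double_neighbour:
  assumes x: "x = cont (i + 1) \<or> x = cont (i - 1)" and "x \<noteq> cont i" and y: "(cont i)^2 + x * cont i = 8"
  shows "int h dvd 2 * i + 1"
proof -
  define y where "y = cont i"
  have "(x - cont (i + 1)) * (x - cont (i - 1)) = 0" using x by auto
  then have "x^2 - (cont (i + 1) + cont (i - 1)) * x + cont (i + 1) * cont (i - 1) = 0"
    by (simp add: algebra_simps power2_eq_square)
  then have "x^2 - (2 + (eps q)^2) * y * x + y^2 + 4 * (eps q)^2 = 0"
    unfolding cont_sum cont_prod y_def by (simp add: add.assoc)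
  then have "(x - y)^2 = (eps q)^2 * (x * y - 4)" by (simp add: algebra_simps power2_eq_square)
  then have "2 * (x - y)^2 = (eps q)^2 * (2 * x * y - 8)" by (simp only:) (simp add: algebra_simps)
  then have "2 * (x - y)^2 = (eps q)^2 * (2 * x * y - (y^2 + x * y))"
    unfolding y[folded y_def] .
  then have "(x - y) * (2 * (x - y) - (eps q)^2 * y) = 0"
    by (simp add: algebra_simps power2_eq_square)
  then have "2 * (x - y) - (eps q)^2 * y = 0" using assms(2) by (simp add: y_def)
  then have "2 * x = (2 + (eps q)^2) * y" by (simp add: algebra_simps)
  then have "x + x = cont (i + 1) + cont (i - 1)" by (simp add: cont_sum y_def)
  then have "cont (i + 1) = cont (i - 1)" using x by auto
  then have "int h dvd 2 \<or> int h dvd i + 1 + (i - 1) + 1" by (auto simp: cont_eq_iff)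
  then show ?thesis using not_h_dvd_2 by (auto simp: algebra_simps)
qed

text \<open>The value -4 means q^4 + q^2 + 1 = 0, hence q^6 = 1, and an odd h then divides 3. It is
  the value that \<open>phi_braid_jordan\<close> leaves open for a = 1.\<close>

lemma cont_1_neq: "h > 3 \<Longrightarrow> cont 1 \<noteq> - 4"
proof
  assume h: "h > 3" and 1: "cont 1 = - 4"
  have "cont 1 = 2 * (q^2 - 1 + inverse (q^2))"
  proof -
    have "q * q^2 + inverse (q * q^2) = (q^2 - 1 + inverse (q^2)) * sq"
      using q_neq_0 by (simp add: sq_def field_simps power2_eq_square)
    then show ?thesis using cont_shift(2)[of q 0] sq_neq_0 by simp
  qed
  then have "2 * (q^2 + 1 + inverse (q^2)) = 0" using 1 by (simp add: algebra_simps)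
  then have "q^2 + 1 + inverse (q^2) = 0" using two_neq_0' by (metis mult_eq_0_iff)
  then have "(q^2 - 1) * q^2 * (q^2 + 1 + inverse (q^2)) = 0" by simp
  then have "q ^ 6 = 1" using q_neq_0 by (simp add: field_simps eval_nat_numeral)
  then have "q powi 6 = 1" by simp
  then have "int h dvd 2 * 3" by (simp only: powi_eq_1_iff) simp
  then have "int h dvd 3" by (simp only: h_dvd_double)
  then show False using h zdvd_imp_le by fastforce
qed

text \<open>Here q^(2i+1) = 1, so cont i = 4 / (q + 1/q). The values 4 and -4 would force q^3 = -1
  and q^3 = 1 respectively.\<close>

lemma cont_middle:
  assumes "int h dvd 2 * i + 1" "h > 3"
  shows "cont i \<notin> {0, 4, -4}"
proof -
  have "q powi (2 * i + 1) = 1" using assms by (simp add: powi_eq_1_iff)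
  then have c: "cont i * sq = 4" using sq_neq_0 by (simp add: cont_def)
  have "cont i \<noteq> 0" using c two_neq_0' by (metis mult_eq_0_iff mult_2 numeral_Bit0 add_0 mult_2_right)
  moreover have False if "cont i = 4"
  proof -
    have "(2 * 2) * sq = (2 * 2) * 1" using c that by simp
    then have "sq = 1" using two_neq_0' by (metis mult_cancel_left mult_eq_0_iff)
    then have "q^2 - q + 1 = 0" using q_neq_0 by (simp add: sq_def field_simps power2_eq_square)
    then have "(q + 1) * (q^2 - q + 1) = 0" by simp
    then have "q powi 3 = - 1" by (simp add: algebra_simps eval_nat_numeral eq_neg_iff_add_eq_0)
    then show False using powi_neq_minus_1 by blast
  qed
  moreover have False if "cont i = - 4"
  proof -
    have "(2 * 2) * sq = (2 * 2) * (- 1)" using c that by (simp add: minus_equation_iff)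
    then have "sq = - 1" using two_neq_0' by (metis mult_cancel_left mult_eq_0_iff)
    then have "q^2 + q + 1 = 0"
      using q_neq_0 by (simp add: sq_def field_simps power2_eq_square eq_neg_iff_add_eq_0)
    then have "(q - 1) * (q^2 + q + 1) = 0" by simp
    then have "q powi 3 = 1" by (simp add: algebra_simps eval_nat_numeral)
    then have "int h dvd 3" by (simp only: powi_eq_1_iff)
    then show False using assms zdvd_imp_le by fastforce
  qed
  ultimately show ?thesis by auto
qed

end


section \<open>Eigenvectors and complements\<close>

locale endomorphism = vector_space scale
  for scale :: "'a::field \<Rightarrow> 'w::ab_group_add \<Rightarrow> 'w" (infixr "*s" 75) +
  fixes f :: "'w \<Rightarrow> 'w"
  assumes f_add: "f (v + w) = f v + f w" and f_scale: "f (a *s w) = a *s f w"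
begin

lemma f_zero: "f 0 = 0"
  using f_scale[of 0 0] by simp

lemma f_diff: "f (v - w) = f v - f w"
  using f_add[of v "(-1) *s w"] f_scale[of "-1" w] by simp

text \<open>p(f) w by Horner's scheme.\<close>

definition peval :: "'a poly \<Rightarrow> 'w \<Rightarrow> 'w" where
  "peval p w = fold_coeffs (\<lambda>a v. a *s w + f v) p 0"

lemma peval_0 [simp]: "peval 0 w = 0"
  by (simp add: peval_def)

lemma peval_pCons [simp]: "peval (pCons a p) w = a *s w + f (peval p w)"
  by (cases "p = 0 \<and> a = 0") (auto simp: peval_def f_zero)

lemma peval_add: "peval (p + r) w = peval p w + peval r w"
  by (induction p arbitrary: r)
    (simp, case_tac r, simp add: f_add scale_left_distrib algebra_simps)

lemma peval_smult: "peval (Polynomial.smult a p) w = a *s peval p w"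
  by (induction p) (simp_all add: f_scale scale_right_distrib)

lemma peval_mult: "peval (p * r) w = peval p (peval r w)"
  by (induction p) (simp_all add: peval_add peval_smult)

lemma peval_sum: "peval (\<Sum>i\<in>I. g i) w = (\<Sum>i\<in>I. peval (g i) w)"
  by (induction I rule: infinite_finite_induct) (simp_all add: peval_add)

lemma peval_monom: "peval (monom a i) w = a *s (f ^^ i) w"
  by (induction i) (simp_all add: monom_Suc monom_0 f_scale f_zero)

lemma f_pow_mem: "\<lbrakk>\<And>w. w \<in> V \<Longrightarrow> f w \<in> V; w \<in> V\<rbrakk> \<Longrightarrow> (f ^^ i) w \<in> V"
  by (induction i) simp_all

text \<open>The vectors f^i u for i <= card B are too many to be independent. Coinciding powers are
  treated apart, since they collapse in the set to which the dependence argument is applied.\<close>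

lemma annihilating_poly:
  assumes V: "finite B" "V \<subseteq> span B" "\<And>w. w \<in> V \<Longrightarrow> f w \<in> V" and u: "u \<in> V"
  shows "\<exists>p. p \<noteq> 0 \<and> peval p u = 0"
proof (cases "inj_on (\<lambda>i. (f ^^ i) u) {..card B}")
  case False
  then obtain i j where ij: "i < j" "(f ^^ i) u = (f ^^ j) u"
    unfolding inj_on_def by (metis linorder_neqE_nat)
  then have "monom 1 j - monom (1 :: 'a) i \<noteq> 0" by (auto simp: poly_eq_iff)
  moreover have "peval (monom 1 j + Polynomial.smult (- 1) (monom 1 i)) u = 0"
    using ij by (simp only: peval_add peval_smult peval_monom) simp
  ultimately show ?thesis by (metis smult_1_left smult_minus_left diff_conv_add_uminus)
next
  case True
  let ?g = "\<lambda>i. (f ^^ i) u"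
  let ?S = "?g ` {..card B}"
  have "?S \<subseteq> span B" using f_pow_mem[of V u] V u by blast
  moreover have "card ?S = Suc (card B)" using True by (simp add: card_image)
  ultimately have "dependent ?S" using independent_span_bound[OF V(1), of ?S] by fastforce
  then obtain c where c: "\<exists>v\<in>?S. c v \<noteq> 0" "(\<Sum>v\<in>?S. c v *s v) = 0"
    by (auto simp: dependent_finite)
  define p where "p = (\<Sum>i\<le>card B. monom (c (?g i)) i)"
  have "peval p u = (\<Sum>i\<le>card B. c (?g i) *s ?g i)" by (simp add: p_def peval_sum peval_monom)
  also have "\<dots> = (\<Sum>v\<in>?S. c v *s v)" using True by (simp add: sum.reindex)
  finally have "peval p u = 0" using c by simp
  obtain i where i: "i \<le> card B" "c (?g i) \<noteq> 0" using c by auto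
  have "coeff p i = (\<Sum>j\<le>card B. if j = i then c (?g j) else 0)"
    by (simp add: p_def coeff_sum)
  also have "\<dots> = c (?g i)" using i by simp
  finally have "p \<noteq> 0" using i by auto
  then show ?thesis using \<open>peval p u = 0\<close> by blast
qed

lemma peval_linear_factor: "peval [:- b, 1:] w = f w - b *s w"
  by (simp add: f_zero)

end

locale endomorphism_acf = endomorphism scale f
  for scale :: "'a::alg_closed_field \<Rightarrow> 'w::ab_group_add \<Rightarrow> 'w" (infixr "*s" 75) and f
begin

lemma linear_factors:
  assumes "finite B" "V \<subseteq> span B" "\<And>w. w \<in> V \<Longrightarrow> f w \<in> V" "u \<in> V"
  shows "\<exists>bs. foldr (\<lambda>b w. f w - b *s w) bs u = 0"
proof -
  obtain p where p: "p \<noteq> 0" "peval p u = 0" using annihilating_poly[OF assms] by blast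
  obtain A where "p = Polynomial.smult (lead_coeff p) (\<Prod>x\<in>#A. [:- x, 1:])"
    using alg_closed_imp_factorization[OF p(1)] by auto
  moreover obtain bs where "mset bs = A" using ex_mset by blast
  ultimately have "p = Polynomial.smult (lead_coeff p) (\<Prod>x\<leftarrow>bs. [:- x, 1:])"
    by (metis mset_map prod_mset_prod_list)
  then have "lead_coeff p *s peval (\<Prod>x\<leftarrow>bs. [:- x, 1:]) u = 0"
    using p(2) by (metis peval_smult)
  then have "peval (\<Prod>x\<leftarrow>bs. [:- x, 1:]) u = 0" using p(1) by simp
  moreover have "peval (\<Prod>x\<leftarrow>bs. [:- x, 1:]) u = foldr (\<lambda>b w. f w - b *s w) bs u"
    by (induction bs) (simp_all only: list.map prod_list.Nil prod_list.Cons peval_mult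
        peval_linear_factor foldr.simps comp_apply id_apply one_pCons peval_pCons peval_0, simp_all add: f_zero)
  ultimately show ?thesis by auto
qed

lemma eigenvector_exists:
  assumes V: "finite B" "V \<subseteq> span B" "\<And>w. w \<in> V \<Longrightarrow> f w \<in> V" "subspace V"
    and u: "u \<in> V" "u \<noteq> 0"
  shows "\<exists>w\<in>V. \<exists>b. w \<noteq> 0 \<and> f w = b *s w"
proof -
  obtain bs where "foldr (\<lambda>b w. f w - b *s w) bs u = 0"
    using linear_factors[OF V(1-3) u(1)] by blast
  moreover have "foldr (\<lambda>b w. f w - b *s w) bs u \<in> V" for bs
    by (induction bs) (use u V in \<open>auto intro: subspace_diff subspace_scale\<close>)
  ultimately show ?thesis
  proof (induction bs)
    case Nil
    then show ?case using u by simp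
  next
    case (Cons b bs)
    then show ?case by (cases "foldr (\<lambda>b w. f w - b *s w) bs u = 0") auto
  qed
qed

text \<open>An eigenvector with eigenvalue other than b is the image under f - b of a multiple of
  itself; eigenvectors for b are collected in w0.\<close>

lemma span_eigenvectors_shift:
  assumes V: "subspace V" and w: "w \<in> span {w \<in> V. \<exists>a. f w = a *s w}"
  shows "\<exists>u1 \<in> span {w \<in> V. \<exists>a. f w = a *s w}. \<exists>w0 \<in> V. f w0 = b *s w0 \<and> w = f u1 - b *s u1 + w0"
  using w
proof (induction rule: span_induct_alt)
  case base
  show ?case using subspace_0[OF V] by (intro bexI[of _ 0]) (auto simp: f_zero span_zero)
next
  case (step k x y)
  then obtain u1 w0 a where IH: "u1 \<in> span {w \<in> V. \<exists>a. f w = a *s w}" "w0 \<in> V" "f w0 = b *s w0"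
    "y = f u1 - b *s u1 + w0" and x: "x \<in> V" "f x = a *s x" by blast
  show ?case
  proof (cases "a = b")
    case True
    have "k *s x + y = f u1 - b *s u1 + (k *s x + w0)" by (simp add: IH)
    moreover have "f (k *s x + w0) = b *s (k *s x + w0)"
      by (simp add: f_add f_scale IH x True scale_right_distrib mult.commute)
    moreover have "k *s x + w0 \<in> V" using x IH V by (simp add: subspace_add subspace_scale)
    ultimately show ?thesis using IH by blast
  next
    case False
    define u2 where "u2 = (k / (a - b)) *s x + u1"
    have "k *s x = (k / (a - b)) *s (a *s x - b *s x)"
      using False by (simp flip: scale_left_diff_distrib)
    then have "k *s x + y = f u2 - b *s u2 + w0"
      by (simp add: u2_def f_add f_scale IH x algebra_simps)
    moreover have "u2 \<in> span {w \<in> V. \<exists>a. f w = a *s w}"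
      unfolding u2_def using x by (intro span_add span_scale IH(1) span_base) auto
    ultimately show ?thesis using IH by blast
  qed
qed

text \<open>The innermost factor is split off, so (f - b) u lies in the span by induction.
  Subtracting the u1 of the previous lemma leaves a vector that f - b maps into the b-eigenspace;
  without Jordan blocks it is an eigenvector.\<close>

lemma span_eigenvectors:
  assumes V: "finite B" "V \<subseteq> span B" "\<And>w. w \<in> V \<Longrightarrow> f w \<in> V" "subspace V"
    and nj: "\<And>w b. \<lbrakk>w \<in> V; f (f w - b *s w) = b *s (f w - b *s w)\<rbrakk> \<Longrightarrow> f w = b *s w"
    and u: "u \<in> V"
  shows "u \<in> span {w \<in> V. \<exists>a. f w = a *s w}"
proof -
  obtain bs where "foldr (\<lambda>b w. f w - b *s w) bs u = 0"
    using linear_factors[OF V(1-3) u] by blast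
  then show ?thesis using u
  proof (induction bs arbitrary: u rule: rev_induct)
    case Nil
    then show ?case by (simp add: span_zero)
  next
    case (snoc b bs)
    have "f u - b *s u \<in> span {w \<in> V. \<exists>a. f w = a *s w}"
      using snoc V by (auto intro: subspace_diff subspace_scale)
    then obtain u1 w0 where u1: "u1 \<in> span {w \<in> V. \<exists>a. f w = a *s w}" "w0 \<in> V" "f w0 = b *s w0"
      "f u - b *s u = f u1 - b *s u1 + w0" using span_eigenvectors_shift[OF V(4)] by blast
    have "span {w \<in> V. \<exists>a. f w = a *s w} \<subseteq> V" using V(4) by (intro span_minimal) auto
    then have u': "u - u1 \<in> V" using u1 snoc.prems V(4) by (blast intro: subspace_diff)
    have w0: "f (u - u1) - b *s (u - u1) = w0"
      using u1(4) by (simp add: f_diff algebra_simps)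
    have "f (u - u1) = b *s (u - u1)" using nj[OF u', of b] unfolding w0 by (simp add: u1)
    then have "u - u1 \<in> span {w \<in> V. \<exists>a. f w = a *s w}" using u' by (intro span_base) auto
    then show ?case using u1(1) span_add by fastforce
  qed
qed

end

text \<open>A basis of W is extended by vectors of E. With eigenvectors as E, the complement is
  automatically invariant.\<close>

lemma (in vector_space) complement_spanned_by:
  assumes V: "subspace V" and E: "E \<subseteq> V" "V \<subseteq> span E" and W: "subspace W" "W \<subseteq> V"
  shows "\<exists>B \<subseteq> E. W \<inter> span B = {0} \<and> (\<forall>v\<in>V. \<exists>w\<in>W. \<exists>u\<in>span B. v = w + u)"
proof -
  obtain A where A: "A \<subseteq> W" "independent A" "W \<subseteq> span A"
    by (rule maximal_independent_subset)
  have spanA: "span A = W" using A W by (intro equalityI span_minimal) auto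
  obtain B where B: "A \<subseteq> B" "B \<subseteq> A \<union> E" "independent B" "A \<union> E \<subseteq> span B"
    using maximal_independent_subset_extend[of A "A \<union> E"] A by auto
  have "span E \<subseteq> span B" using B(4) by (intro span_minimal) auto
  then have VB: "V \<subseteq> span B" using E by auto
  have BA: "B = A \<union> (B - A)" using B by auto
  have "W \<inter> span (B - A) \<subseteq> {0}"
  proof
    fix w assume "w \<in> W \<inter> span (B - A)"
    then have w: "w \<in> span A" "w \<in> span (B - A)" using spanA by auto
    have "representation B w = representation A w" "representation B w = representation (B - A) w"
      using w B by (auto intro!: representation_extend)
    moreover have "representation A w b = 0" if "b \<notin> A" for b
      using representation_ne_zero that by metis
    moreover have "representation (B - A) w b = 0" if "b \<in> A" for b
      using representation_ne_zero that by (metis DiffD2)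
    ultimately have 0: "representation B w b = 0" for b by metis
    have "w \<in> span B" using w(1) B(1) span_mono by blast
    from sum_nonzero_representation_eq[OF B(3) this] show "w \<in> {0}" by (simp add: 0)
  qed
  moreover have "\<exists>w\<in>W. \<exists>u\<in>span (B - A). v = w + u" if "v \<in> V" for v
  proof -
    have "v \<in> {x + y |x y. x \<in> span A \<and> y \<in> span (B - A)}"
      using VB that BA span_Un[of A "B - A"] by (metis subsetD)
    then show ?thesis using spanA by blast
  qed
  ultimately show ?thesis using B W by (intro exI[of _ "B - A"]) (auto simp: subspace_0 span_zero)
qed

lemma (in vector_space) complement_exists:
  assumes "subspace V" "subspace W" "W \<subseteq> V"
  shows "\<exists>U. subspace U \<and> U \<subseteq> V \<and> W \<inter> U = {0} \<and> (\<forall>v\<in>V. \<exists>w\<in>W. \<exists>u\<in>U. v = w + u)"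
proof -
  obtain B where B: "B \<subseteq> V" "W \<inter> span B = {0}" "\<forall>v\<in>V. \<exists>w\<in>W. \<exists>u\<in>span B. v = w + u"
    using complement_spanned_by[OF assms(1) order_refl span_superset assms(2,3)] by blast
  moreover have "span B \<subseteq> V" using B(1) assms(1) by (rule span_minimal)
  ultimately show ?thesis using subspace_span[of B] by blast
qed


section \<open>Shifted tableaux\<close>

text \<open>A strict partition is encoded by the set \<open>S\<close> of its nonzero parts, and a standard shifted tableau
  by the list of contents of its boxes, last box first. A box of content \<open>c\<close> extends a row of
  length \<open>c\<close>.\<close>

definition addable :: "nat set \<Rightarrow> nat \<Rightarrow> bool" where
  "addable S c \<longleftrightarrow> (c = 0 \<or> c \<in> S) \<and> Suc c \<notin> S"

definition add_box :: "nat set \<Rightarrow> nat \<Rightarrow> nat set" where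
  "add_box S c = insert (Suc c) (S - {c})"

inductive tab :: "nat list \<Rightarrow> nat set \<Rightarrow> bool" where
  tab_Nil: "tab [] {}"
| tab_Cons: "\<lbrakk>tab cs S; addable S c\<rbrakk> \<Longrightarrow> tab (c # cs) (add_box S c)"

inductive_cases tab_NilE: "tab [] S"
inductive_cases tab_ConsE: "tab (c # cs) S"

lemma tab_props: "tab cs S \<Longrightarrow> finite S \<and> 0 \<notin> S \<and> \<Sum>S = length cs"
proof (induction rule: tab.induct)
  case (tab_Cons cs S c)
  then have "\<Sum>(S - {c}) + c = \<Sum>S"
    by (cases "c \<in> S") (auto simp: addable_def sum.remove[of S c "\<lambda>x. x"])
  then show ?case using tab_Cons by (auto simp: add_box_def addable_def)
qed simp

lemma tab_unique: "\<lbrakk>tab cs S; tab cs S'\<rbrakk> \<Longrightarrow> S = S'"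
proof (induction arbitrary: S' rule: tab.induct)
  case tab_Nil
  then show ?case by (auto elim: tab_NilE)
next
  case (tab_Cons cs S c)
  from tab_Cons.prems obtain S1 where "S' = add_box S1 c" "tab cs S1" by (rule tab_ConsE)
  then show ?case using tab_Cons.IH by simp
qed

lemma sum_ge_two:
  fixes S :: "nat set"
  assumes "finite S" "a = 0 \<or> a \<in> S" "b = 0 \<or> b \<in> S" "a \<noteq> b"
  shows "a + b \<le> \<Sum>S"
proof -
  have "\<Sum>({a, b} \<inter> S) \<le> \<Sum>S" using assms(1) by (intro sum_mono2) auto
  moreover have "\<Sum>({a, b} \<inter> S) = a + b"
    using assms(2-4) by (cases "a \<in> S"; cases "b \<in> S") simp_all
  ultimately show ?thesis by simp
qed

text \<open>Different row lengths occupy disjoint sets of boxes; 0 stands for the empty row at which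
  a new row starts. This bound turns m < h into separation of contents.\<close>

lemma tab_sum_le: "\<lbrakk>tab cs S; a = 0 \<or> a \<in> S; b = 0 \<or> b \<in> S; a \<noteq> b\<rbrakk> \<Longrightarrow> a + b \<le> length cs"
  using sum_ge_two[of S a b] tab_props by metis

lemma tab_le: "\<lbrakk>tab cs S; a \<in> S\<rbrakk> \<Longrightarrow> a \<le> length cs"
  using tab_sum_le[of cs S a 0] by (cases "a = 0") auto

lemma addable_add_box: "\<lbrakk>addable S c; addable S d; c \<noteq> d\<rbrakk> \<Longrightarrow> addable (add_box S c) d"
  by (auto simp: addable_def add_box_def)

text \<open>The row of length c + 1 can still be shortened in the final shape, so the box of content
  a does not rest on the box of content c and the two may be added in the other order.\<close>

lemma tab_swap:
  assumes "addable S2 c" "addable (add_box S2 c) a" "c \<notin> add_box (add_box S2 c) a"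
    "Suc c \<in> add_box (add_box S2 c) a" "a \<noteq> c"
  shows "addable S2 a" "addable (add_box S2 a) c" "add_box (add_box S2 a) c = add_box (add_box S2 c) a"
    "a \<noteq> Suc c" "c \<noteq> Suc a"
proof -
  show 1: "c \<noteq> Suc a" using assms by (auto simp: addable_def add_box_def)
  show 2: "a \<noteq> Suc c" using assms by (auto simp: addable_def add_box_def)
  show "addable S2 a" "addable (add_box S2 a) c" "add_box (add_box S2 a) c = add_box (add_box S2 c) a"
    using assms 1 2 by (auto simp: addable_def add_box_def)
qed

context root_of_unity
begin

lemma h_dvd_small: "\<lbrakk>int h dvd j; 0 < j\<rbrakk> \<Longrightarrow> int h \<le> j"
  by (rule zdvd_imp_le)

text \<open>Neither a - b nor a + b + 1 is large enough to be a nonzero multiple of h.\<close>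

lemma cont_inj_small: "\<lbrakk>cont (int a) = cont (int b); a + b + 1 < h\<rbrakk> \<Longrightarrow> a = b"
proof (rule ccontr)
  assume 1: "cont (int a) = cont (int b)" "a + b + 1 < h" "a \<noteq> b"
  then consider "int h dvd int a - int b" | "int h dvd int a + int b + 1" using cont_eq_iff by blast
  then show False
  proof cases
    case 1
    then have "int h dvd int a - int b" "int h dvd int b - int a" by (simp_all add: dvd_diff_commute)
    then show False using h_dvd_small[of "int a - int b"] h_dvd_small[of "int b - int a"]
        \<open>a \<noteq> b\<close> \<open>a + b + 1 < h\<close> by linarith
  next
    case 2
    then show False using h_dvd_small[OF 2] 1 by linarith
  qed
qed

text \<open>Two addable boxes of one shape have contents whose sum is at most the number of boxes,
  so \<open>cont\<close> tells them apart. Hence the eigenvalues determine the tableau.\<close>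

lemma tab_cont_inj:
  "\<lbrakk>tab cs S; tab cs' S'; length cs < h; map (cont \<circ> int) cs = map (cont \<circ> int) cs'\<rbrakk> \<Longrightarrow> cs = cs'"
proof (induction arbitrary: cs' S' rule: tab.induct)
  case (tab_Cons cs S c)
  from tab_Cons.prems(3) obtain c' cs1 where cs': "cs' = c' # cs1" by (cases cs') auto
  then obtain S1 where S1: "tab cs1 S1" "addable S1 c'"
    using tab_Cons.prems(1) cs' by (metis tab_ConsE)
  have cs: "cs = cs1" using tab_Cons.IH[OF S1(1)] tab_Cons.prems(2,3) cs' by simp
  then have "S = S1" using tab_unique tab_Cons.hyps(1) S1(1) by blast
  have "c = c'"
  proof (rule ccontr)
    assume "c \<noteq> c'"
    then have "c + c' \<le> length cs"
      using tab_sum_le[OF tab_Cons.hyps(1)] tab_Cons.hyps(2) S1 \<open>S = S1\<close> by (simp add: addable_def)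
    then show False using cont_inj_small[of c c'] tab_Cons.prems(2,3) cs' \<open>c \<noteq> c'\<close> by simp
  qed
  then show ?case by (simp add: cs cs')
qed simp

end


section \<open>Semisimplicity for small rank\<close>

locale hc_split = hc_rep scale n q V t c + root_of_unity h q
  for scale :: "'a::alg_closed_field \<Rightarrow> 'w::ab_group_add \<Rightarrow> 'w" (infixr "*s" 75)
    and n q V t c h +
  assumes fin: "\<exists>B. finite B \<and> V \<subseteq> span B"
begin

definition joint :: "nat \<Rightarrow> 'w \<Rightarrow> bool" where
  "joint m v \<longleftrightarrow> (\<forall>k. 1 \<le> k \<and> k \<le> m \<longrightarrow> (\<exists>a. L k v = a *s v))"

text \<open>As in \<open>tab\<close> the head is the last box. Recording a + 1/a instead of a makes
  the condition invariant under the Clifford generators.\<close>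

primrec wt :: "nat list \<Rightarrow> 'w \<Rightarrow> bool" where
  "wt [] v \<longleftrightarrow> True"
| "wt (d # cs) v \<longleftrightarrow> (\<exists>a. L (Suc (length cs)) v = a *s v \<and> xv a = cont (int d)) \<and> wt cs v"

lemma wt_eig: "\<lbrakk>wt cs v; 1 \<le> j; j \<le> length cs\<rbrakk> \<Longrightarrow> \<exists>a. L j v = a *s v"
  by (induction cs) (auto simp: le_Suc_eq)

lemma wt_transfer:
  "\<lbrakk>wt cs u; \<And>j a. \<lbrakk>1 \<le> j; j \<le> length cs; L j u = a *s u\<rbrakk> \<Longrightarrow>
      \<exists>b. L j v = b *s v \<and> xv a = xv b\<rbrakk> \<Longrightarrow> wt cs v"
proof (induction cs)
  case (Cons d cs)
  then obtain a where a: "L (Suc (length cs)) u = a *s u" "xv a = cont (int d)" by auto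
  then obtain b where "L (Suc (length cs)) v = b *s v" "xv a = xv b"
    using Cons.prems(2)[of "Suc (length cs)" a] by auto
  then show ?case using Cons a by force
qed simp

lemma wt_cont_unique: "\<lbrakk>wt cs v; wt cs' v; v \<noteq> 0; length cs = length cs'\<rbrakk> \<Longrightarrow>
    map (cont \<circ> int) cs = map (cont \<circ> int) cs'"
proof (induction cs arbitrary: cs')
  case (Cons d cs)
  then obtain d' cs1 where cs': "cs' = d' # cs1" by (cases cs') auto
  obtain a where a: "L (Suc (length cs)) v = a *s v" "xv a = cont (int d)" using Cons.prems(1) by auto
  obtain b where b: "L (Suc (length cs)) v = b *s v" "xv b = cont (int d')"
    using Cons.prems(2,4) by (auto simp: cs')
  have "a = b" using a b Cons.prems(3) by simp
  then show ?case using Cons.IH[of cs1] Cons.prems cs' a b by simp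
qed simp

text \<open>If a and b are inverse to each other, \<open>c k\<close> inverts a and leaves b alone,
  which reduces the claim to equal eigenvalues; those would give L_k a Jordan block.\<close>

lemma neighbours_neq:
  assumes k: "1 \<le> k" "k < n" "no_jordan k" and v: "v \<in> V" "v \<noteq> 0"
    and a: "L k v = a *s v" and b: "L (Suc k) v = b *s v"
  shows "xv a \<noteq> xv b"
proof
  assume 1: "xv a = xv b"
  have nz: "a \<noteq> 0" "b \<noteq> 0" using eig_nonzero[of k v a] eig_nonzero[of "Suc k" v b] assms by simp_all
  then consider "a = b" | "a * b = 1" using 1 xv_eq_iff by blast
  then show False
  proof cases
    case 1
    then show False using jordan_of_equal_eigenvalues[OF k(1,2) v a] b k(3) 1 by simp
  next
    case 2
    then have "inverse a = b" using inverse_unique by blast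
    then have "L k (c k v) = b *s c k v" using eig_c_self[of k v a] k v a nz by simp
    moreover have "L (Suc k) (c k v) = b *s c k v" using k v b by (simp add: L_c_below lin)
    moreover have "c k v \<noteq> 0" using c_inj[of k v] k v by auto
    ultimately show False using jordan_of_equal_eigenvalues[OF k(1,2), of "c k v" b] v k(3) by simp
  qed
qed

lemma L_phi:
  assumes "1 \<le> j" "j \<le> n" "1 \<le> k" "k < n" "j \<noteq> k" "j \<noteq> Suc k" "u \<in> V" "v \<in> V"
  shows "L j (phi k a b u v) = phi k a b (L j u) (L j v)"
  using assms by (simp add: phi_def lin_L L_t L_c_other)

lemma phi_scale: "phi k a b (x *s u) (x *s v) = x *s phi k a b u v"
  by (simp add: phi_def lin algebra_simps)

lemma wt_phi:
  assumes "wt cs u" "length cs < k" "k < n" "u \<in> V" "v \<in> V"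
    and "\<And>j a. \<lbrakk>1 \<le> j; j \<le> length cs; L j u = a *s u\<rbrakk> \<Longrightarrow> L j v = a *s v"
  shows "wt cs (phi k a b u v)"
proof (rule wt_transfer[OF assms(1)])
  fix j x assume j: "1 \<le> j" "j \<le> length cs" "L j u = x *s u"
  then have "L j (phi k a b u v) = x *s phi k a b u v"
    using assms(2-5) assms(6)[OF j] by (simp add: L_phi phi_scale)
  then show "\<exists>b'. L j (phi k a b u v) = b' *s phi k a b u v \<and> xv x = xv b'" by blast
qed

lemma wt_phi_0: "\<lbrakk>wt cs u; length cs < k; k < n; u \<in> V\<rbrakk> \<Longrightarrow> wt cs (phi k a b u 0)"
  by (rule wt_phi) (auto simp: L_zero)

text \<open>The two intertwiners together multiply u by kap a b, so this scalar vanishes.\<close>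

lemma phi_zero_adjacent:
  assumes k: "1 \<le> k" "k < n" and u: "u \<in> V" "u \<noteq> 0"
    and a: "L k u = a *s u" and b: "L (Suc k) u = b *s u"
    and xa: "xv a = cont i" "xv b \<noteq> xv a" and phi: "phi k b a (phi k a b u 0) 0 = 0"
  shows "kap a b = 0" "xv b = cont (i + 1) \<or> xv b = cont (i - 1)"
proof -
  have nz: "a \<noteq> 0" "b \<noteq> 0" using eig_nonzero[of k u a] eig_nonzero[of "Suc k" u b] assms by simp_all
  then have ab: "a \<noteq> b" "a * b \<noteq> 1" using xa xv_eq_iff[of a b] by auto
  have "kap a b *s u = 0"
    using phi_phi[OF k u(1) _ ab(1), of 0] phi by (simp add: V_closed)
  then show "kap a b = 0" using u by simp
  from kap_zero[OF nz ab this] show "xv b = cont (i + 1) \<or> xv b = cont (i - 1)"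
    unfolding xa by (rule adjacent_cases)
qed

text \<open>Subspaces of V invariant under the subalgebra of rank M.\<close>

definition stable :: "nat \<Rightarrow> 'w set \<Rightarrow> bool" where
  "stable M Z \<longleftrightarrow> subspace Z \<and> Z \<subseteq> V \<and>
    (\<forall>i z. 1 \<le> i \<and> Suc i \<le> M \<and> z \<in> Z \<longrightarrow> t i z \<in> Z) \<and> (\<forall>i z. 1 \<le> i \<and> i \<le> M \<and> z \<in> Z \<longrightarrow> c i z \<in> Z)"

lemma stable_phi: "\<lbrakk>stable M Z; 1 \<le> k; Suc k \<le> M; u \<in> Z; v \<in> Z\<rbrakk> \<Longrightarrow> phi k a b u v \<in> Z"
  unfolding stable_def phi_def by (auto intro!: subspace_diff subspace_scale)

lemma stable_mono: "\<lbrakk>stable M Z; M' \<le> M\<rbrakk> \<Longrightarrow> stable M' Z"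
  by (auto simp: stable_def)

lemma stable_eigenspace:
  assumes "stable M Z" "M < k" "k \<le> n"
  shows "stable M {z \<in> Z. L k z = a *s z}"
proof -
  have "subspace {z \<in> Z. L k z = a *s z}"
    using assms(1) unfolding stable_def
    by (intro subspaceI) (auto simp: lin_L subspace_0 subspace_add subspace_scale algebra_simps)
  then show ?thesis
    using assms by (auto simp: stable_def L_t L_c_other lin subset_iff)
qed

lemma stable_zero: "stable M {0}"
  using V_closed(1) by (auto simp: stable_def lin)

lemma stable_V: "stable M V"
  using V_subspace by (auto simp: stable_def)

text \<open>Makes a removable box of content r the last one. Tracking membership in Z and avoidance
  of K serves two uses: eigenvectors, with K = {0}, and Jordan pairs, with K the true eigenspace. By
  induction r becomes the last box but one; the last two boxes are then exchanged by an intertwiner,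
  which is invertible because their contents are not neighbours.\<close>

lemma move:
  assumes "tab cs S" "wt cs u" "u \<in> Z" "u \<notin> K" "stable (length cs) Z" "stable (length cs) K"
    "length cs \<le> h - 2" "length cs \<le> n" "Suc r \<in> S" "r \<notin> S"
  shows "\<exists>cs' S' u'. tab cs' S' \<and> addable S' r \<and> add_box S' r = S \<and> Suc (length cs') = length cs \<and>
    wt (r # cs') u' \<and> u' \<in> Z \<and> u' \<notin> K"
  using assms
proof (induction arbitrary: u Z K rule: tab.induct)
  case (tab_Cons cs1 S1 a)
  show ?case
  proof (cases "a = r")
    case True
    then show ?thesis using tab_Cons by (metis length_Cons)
  next
    case False
    define m where "m = length cs1"
    have ZV: "Z \<subseteq> V" "K \<subseteq> V" using tab_Cons.prems(4,5) by (auto simp: stable_def)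
    have S1: "Suc r \<in> S1" "r \<notin> S1"
      using tab_Cons.prems(8,9) False by (auto simp: add_box_def)
    obtain \<beta> where \<beta>: "L (Suc m) u = \<beta> *s u" "xv \<beta> = cont (int a)"
      using tab_Cons.prems(1) by (auto simp: m_def)
    \<comment> \<open>Working inside this eigenspace keeps the content of the last box while the
      induction rearranges the first m boxes.\<close>
    define Z' where "Z' = {z \<in> Z. L (Suc m) z = \<beta> *s z}"
    have "stable m Z'" unfolding Z'_def
      using tab_Cons.prems(4,7) by (intro stable_eigenspace) (auto simp: m_def intro: stable_mono)
    moreover have "stable m K" using tab_Cons.prems(5) by (auto simp: m_def intro: stable_mono)
    moreover have "wt cs1 u" "u \<in> Z'" using tab_Cons.prems \<beta> by (auto simp: Z'_def)
    ultimately have "\<exists>cs' S' u'. tab cs' S' \<and> addable S' r \<and> add_box S' r = S1 \<and>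
        Suc (length cs') = m \<and> wt (r # cs') u' \<and> u' \<in> Z' \<and> u' \<notin> K"
      unfolding m_def using tab_Cons.prems(3,6,7) S1 by (intro tab_Cons.IH[of u Z' K]) simp_all
    then obtain cs2 S2 u1 where u1: "tab cs2 S2" "addable S2 r" "add_box S2 r = S1"
      "Suc (length cs2) = m" "wt (r # cs2) u1" "u1 \<in> Z'" "u1 \<notin> K" by blast
    have sw: "addable S2 a" "addable (add_box S2 a) r" "add_box (add_box S2 a) r = add_box S1 a"
      "a \<noteq> Suc r" "r \<noteq> Suc a"
      using tab_swap[OF u1(2), of a] tab_Cons.hyps tab_Cons.prems(8,9) u1(3) False by auto
    have u1': "u1 \<in> V" "L (Suc m) u1 = \<beta> *s u1" "u1 \<in> Z" using u1(6) ZV by (auto simp: Z'_def)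
    have "u1 \<noteq> 0" using u1(7) tab_Cons.prems(5) by (auto simp: stable_def subspace_0)
    obtain \<alpha> where \<alpha>: "L m u1 = \<alpha> *s u1" "xv \<alpha> = cont (int r)" using u1(4,5) by auto
    have mn: "1 \<le> m" "m < n" using u1(4) tab_Cons.prems(7) by (auto simp: m_def)
    \<comment> \<open>Rows of lengths a + 1 and r + 1 both occur in the final shape. The bound h - 2
      leaves room to separate a also from the neighbours of r.\<close>
    have ar: "a + r + 4 \<le> h"
    proof -
      have "Suc a \<in> add_box S1 a" "Suc r \<in> add_box S1 a" "Suc a \<noteq> Suc r"
        using tab_Cons.prems(8) False by (auto simp: add_box_def)
      then have "Suc a + Suc r \<le> length (a # cs1)"
        using tab_sum_le[OF tab.tab_Cons[OF tab_Cons.hyps]] by blast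
      then show ?thesis using tab_Cons.prems(6) by simp
    qed
    have far: "cont (int a) \<noteq> cont (int r)" "cont (int a) \<noteq> cont (int r + 1)" "cont (int a) \<noteq> cont (int r - 1)"
    proof -
      show "cont (int a) \<noteq> cont (int r)" using cont_inj_small[of a r] ar False by auto
      show "cont (int a) \<noteq> cont (int r + 1)" using cont_inj_small[of a "Suc r"] ar sw by (auto simp: add.commute)
      \<comment> \<open>For r = 0 the lower neighbour is -1, which has the same value as content 0,
        so this case is argued by divisibility directly.\<close>
      show "cont (int a) \<noteq> cont (int r - 1)"
      proof
        assume *: "cont (int a) = cont (int r - 1)"
        have "a \<noteq> r - 1 \<or> r = 0" using sw by auto
        then show False using cont_inj_small[of a "r - 1"] * ar False cont_eq_iff[of "int a" "int r - 1"]
          h_dvd_small[of "int a"] h_dvd_small[of "int a + 1"]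
          by (cases r) (auto simp: of_nat_diff)
      qed
    qed
    have nz: "\<alpha> \<noteq> 0" "\<beta> \<noteq> 0"
      using eig_nonzero[of m u1 \<alpha>] eig_nonzero[of "Suc m" u1 \<beta>] u1' \<alpha> \<open>u1 \<noteq> 0\<close> mn by auto
    have ab: "\<alpha> \<noteq> \<beta>" "\<alpha> * \<beta> \<noteq> 1" using far(1) \<alpha>(2) \<beta>(2) nz xv_eq_iff by metis+
    define w where "w = phi m \<alpha> \<beta> u1 0"
    have w: "w \<in> Z" unfolding w_def using tab_Cons.prems(4) mn u1'
      by (intro stable_phi[of "Suc m"]) (auto simp: m_def stable_def subspace_0)
    have kap: "kap \<alpha> \<beta> \<noteq> 0"
      using kap_zero[OF nz ab] adjacent_cases[of "int r" "xv \<beta>"] far \<alpha>(2) \<beta>(2) by auto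
    \<comment> \<open>The opposite intertwiner maps w to a nonzero multiple of u1, which is not in
      K.\<close>
    have "w \<notin> K"
    proof
      assume "w \<in> K"
      then have "phi m \<beta> \<alpha> w 0 \<in> K" using tab_Cons.prems(5) mn
        by (intro stable_phi[of "Suc m"]) (auto simp: m_def stable_def subspace_0)
      moreover have "phi m \<beta> \<alpha> w 0 = kap \<alpha> \<beta> *s u1"
        using phi_phi[OF mn u1'(1) _ ab(1), of 0] by (simp add: w_def)
      ultimately have "kap \<alpha> \<beta> *s u1 \<in> K" by simp
      moreover have "subspace K" using tab_Cons.prems(5) by (simp add: stable_def)
      ultimately have "inverse (kap \<alpha> \<beta>) *s kap \<alpha> \<beta> *s u1 \<in> K"
        by (rule subspace_scale[rotated])
      then show False using u1(7) kap by simp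
    qed
    moreover have "L m w = \<beta> *s w" "L (Suc m) w = \<alpha> *s w"
      using phi_intertwines[OF mn u1'(1) _ \<alpha>(1), of 0 \<beta>] u1' nz ab by (simp_all add: w_def L_zero)
    moreover have "wt cs2 w" unfolding w_def
      using u1 u1' mn by (intro wt_phi_0) auto
    ultimately have "wt (r # a # cs2) w" using \<alpha> \<beta> u1(4) by auto
    moreover have "tab (a # cs2) (add_box S2 a)" using u1(1) sw(1) by (rule tab.tab_Cons)
    ultimately show ?thesis using sw w \<open>w \<notin> K\<close> u1(4)
      by (intro exI[of _ "a # cs2"] exI[of _ "add_box S2 a"] exI[of _ w]) (auto simp: m_def)
  qed
qed simp

end

section \<open>Joint eigenvectors and the exclusion of zigzags\<close>

context hc_split
begin

lemma endo_L: "endomorphism_acf scale (L k)"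
  by unfold_locales (simp_all add: lin_L)

text \<open>The eigenvectors of the top operator span Z, so not all of them lie in K; the argument
  is repeated inside the eigenspace of one that does not.\<close>

lemma joint_eigenvector_outside:
  assumes Z: "subspace Z" "Z \<subseteq> V" "\<And>k z. \<lbrakk>1 \<le> k; k \<le> m; z \<in> Z\<rbrakk> \<Longrightarrow> L k z \<in> Z"
    and K: "subspace K" and m: "m \<le> n" and nj: "\<And>k. \<lbrakk>1 \<le> k; k \<le> m\<rbrakk> \<Longrightarrow> no_jordan k"
    and u: "u \<in> Z" "u \<notin> K"
  shows "\<exists>u'\<in>Z. u' \<notin> K \<and> joint m u'"
  using Z m nj u
proof (induction m arbitrary: u Z)
  case 0
  then show ?case by (auto simp: joint_def)
next
  case (Suc m)
  interpret f: endomorphism_acf scale "L (Suc m)" by (rule endo_L)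
  let ?E = "{w \<in> Z. \<exists>a. L (Suc m) w = a *s w}"
  obtain B where B: "finite B" "V \<subseteq> span B" using fin by blast
  have "u \<in> span ?E"
  proof (rule f.span_eigenvectors[OF B(1) _ _ Suc.prems(1) _ Suc.prems(6)])
    show "Z \<subseteq> span B" using B(2) Suc.prems(2) by blast
    show "L (Suc m) w \<in> Z" if "w \<in> Z" for w using Suc.prems(3)[of "Suc m"] that by simp
    show "L (Suc m) w = b *s w"
      if "w \<in> Z" "L (Suc m) (L (Suc m) w - b *s w) = b *s (L (Suc m) w - b *s w)" for w b
      using Suc.prems(5)[of "Suc m"] Suc.prems(2) that by (auto simp: no_jordan_def)
  qed
  then have "\<not> ?E \<subseteq> K" using span_minimal[OF _ K] Suc.prems(7) by blast
  then obtain w a where w: "w \<in> Z" "L (Suc m) w = a *s w" "w \<notin> K" by blast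
  define Z' where "Z' = {z \<in> Z. L (Suc m) z = a *s z}"
  have "\<exists>u'\<in>Z'. u' \<notin> K \<and> joint m u'"
  proof (rule Suc.IH)
    show "subspace Z'" unfolding Z'_def using Suc.prems(1)
      by (intro subspaceI) (auto simp: lin_L subspace_0 subspace_add subspace_scale algebra_simps)
    show "L k z \<in> Z'" if "1 \<le> k" "k \<le> m" "z \<in> Z'" for k z
      using that Suc.prems(2) Suc.prems(3)[of k] Suc.prems(4)
      by (auto simp: Z'_def L_L[of k "Suc m"] lin_L)
    show "no_jordan k" if "1 \<le> k" "k \<le> m" for k using Suc.prems(5) that by simp
  qed (use Suc.prems(2,4) w in \<open>auto simp: Z'_def\<close>)
  then show ?case by (auto simp: Z'_def joint_def le_Suc_eq)
qed

text \<open>Avoiding only 0 takes no diagonalizability, so this reaches L_h as well.\<close>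

lemma joint_eigenvector_exists:
  assumes Z: "subspace Z" "Z \<subseteq> V" "\<And>k z. \<lbrakk>1 \<le> k; k \<le> m; z \<in> Z\<rbrakk> \<Longrightarrow> L k z \<in> Z"
    and m: "m \<le> n" and u: "u \<in> Z" "u \<noteq> 0"
  shows "\<exists>u'\<in>Z. u' \<noteq> 0 \<and> joint m u'"
  using Z m u
proof (induction m arbitrary: u Z)
  case 0
  then show ?case by (auto simp: joint_def)
next
  case (Suc m)
  interpret f: endomorphism_acf scale "L (Suc m)" by (rule endo_L)
  obtain B where B: "finite B" "V \<subseteq> span B" using fin by blast
  have "\<exists>w\<in>Z. \<exists>b. w \<noteq> 0 \<and> L (Suc m) w = b *s w"
    using Suc.prems(3)[of "Suc m"] Suc.prems B
    by (intro f.eigenvector_exists[of B Z u]) auto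
  then obtain w a where w: "w \<in> Z" "L (Suc m) w = a *s w" "w \<noteq> 0" by blast
  define Z' where "Z' = {z \<in> Z. L (Suc m) z = a *s z}"
  have "\<exists>u'\<in>Z'. u' \<noteq> 0 \<and> joint m u'"
  proof (rule Suc.IH)
    show "subspace Z'" unfolding Z'_def using Suc.prems(1)
      by (intro subspaceI) (auto simp: lin_L subspace_0 subspace_add subspace_scale algebra_simps)
    show "L k z \<in> Z'" if "1 \<le> k" "k \<le> m" "z \<in> Z'" for k z
      using that Suc.prems(2) Suc.prems(3)[of k] Suc.prems(4)
      by (auto simp: Z'_def L_L[of k "Suc m"] lin_L)
  qed (use Suc.prems(2,4) w in \<open>auto simp: Z'_def\<close>)
  then show ?case by (auto simp: Z'_def joint_def le_Suc_eq)
qed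

text \<open>The statement carried by the induction on m < h.\<close>

definition split :: "nat \<Rightarrow> bool" where
  "split m \<longleftrightarrow> (\<forall>k. 1 \<le> k \<and> k \<le> m \<longrightarrow> no_jordan k) \<and>
    (\<forall>v\<in>V. v \<noteq> 0 \<longrightarrow> joint m v \<longrightarrow> (\<exists>cs S. length cs = m \<and> tab cs S \<and> wt cs v))"

lemma split_no_jordan: "\<lbrakk>split m; 1 \<le> k; k \<le> m\<rbrakk> \<Longrightarrow> no_jordan k"
  by (simp add: split_def)

text \<open>The first m - 1 eigenvalues determine their tableau, so the tableau that
  \<open>split m\<close> assigns to v extends the given one by one box.\<close>

lemma next_content:
  assumes m: "split m" "m = Suc (length cs)" "m < h"
    and v: "v \<in> V" "v \<noteq> 0" "wt cs v" "tab cs S" and b: "L m v = b *s v"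
  shows "\<exists>d. addable S d \<and> xv b = cont (int d)"
proof -
  have "joint m v"
    unfolding joint_def
  proof (intro allI impI)
    fix k assume "1 \<le> k \<and> k \<le> m"
    then show "\<exists>a. L k v = a *s v" using b wt_eig[OF v(3), of k] m by (cases "k = m") auto
  qed
  then obtain cs1 S1 where cs1: "length cs1 = m" "tab cs1 S1" "wt cs1 v"
    using m(1) v by (auto simp: split_def)
  then obtain d cs2 where d: "cs1 = d # cs2" using m by (cases cs1) auto
  obtain S2 where S2: "tab cs2 S2" "addable S2 d" using cs1(2) unfolding d by (auto elim: tab_ConsE)
  have len: "length cs2 = length cs" using cs1 d m by simp
  have "map (cont \<circ> int) cs2 = map (cont \<circ> int) cs"
    using cs1(3) v len by (intro wt_cont_unique) (auto simp: d)
  then have "cs2 = cs" using tab_cont_inj[OF S2(1) v(4)] m len by simp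
  then have "S2 = S" using tab_unique S2(1) v(4) by blast
  moreover obtain a where "L m v = a *s v" "xv a = cont (int d)"
    using cs1(3) d m len by auto
  ultimately show ?thesis using S2(2) b v(2) by auto
qed

lemma stable_c: "\<lbrakk>stable M Z; 1 \<le> i; i \<le> M; z \<in> Z\<rbrakk> \<Longrightarrow> c i z \<in> Z"
  by (auto simp: stable_def)

text \<open>\<open>move\<close> fixes the last eigenvalue only up to inversion. \<open>c m\<close>
  exchanges the two choices and, being an involution that preserves Z and K, keeps the vector in Z
  and out of K.\<close>

lemma move_normalized:
  assumes mv: "tab cs S" "wt cs u" "u \<in> Z" "u \<notin> K" "stable (length cs) Z" "stable (length cs) K"
    "length cs \<le> h - 2" "length cs \<le> n" "Suc r \<in> S" "r \<notin> S" and b: "b \<noteq> 0" "xv b = cont (int r)"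
  shows "\<exists>cs' S' u'. tab cs' S' \<and> addable S' r \<and> add_box S' r = S \<and> Suc (length cs') = length cs \<and>
    wt (r # cs') u' \<and> L (length cs) u' = b *s u' \<and> u' \<in> Z \<and> u' \<notin> K"
proof -
  obtain cs' S' u' where u': "tab cs' S'" "addable S' r" "add_box S' r = S" "Suc (length cs') = length cs"
    "wt (r # cs') u'" "u' \<in> Z" "u' \<notin> K"
    using move[OF mv] by blast
  define m where "m = length cs"
  obtain a where a: "L m u' = a *s u'" "xv a = cont (int r)" using u' by (auto simp: m_def)
  have uV: "u' \<in> V" "u' \<noteq> 0" using u'(6,7) mv(5,6) by (auto simp: stable_def subspace_0)
  have m: "1 \<le> m" "m \<le> n" using u'(4) mv(8) by (auto simp: m_def)
  have a0: "a \<noteq> 0" using eig_nonzero[OF m uV a(1)] .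
  show ?thesis
  proof (cases "a = b")
    case True
    then show ?thesis using u' a(1) by (auto simp: m_def simp del: wt.simps)
  next
    case False
    then have "a * b = 1" using xv_eq_iff[OF a0 b(1)] a b by simp
    then have ib: "inverse a = b" by (rule inverse_unique)
    have Lc: "L m (c m u') = b *s c m u'" using eig_c_self[OF m uV(1) a(1) a0] ib by simp
    have "wt cs' (c m u')"
    proof (rule wt_transfer)
      show "wt cs' u'" using u' by simp
      fix j x assume j: "1 \<le> j" "j \<le> length cs'" "L j u' = x *s u'"
      then have "L j (c m u') = x *s c m u'" using u'(4) uV m by (simp add: L_c_above m_def lin)
      then show "\<exists>b. L j (c m u') = b *s c m u' \<and> xv x = xv b" by blast
    qed
    then have "wt (r # cs') (c m u')" using Lc b u'(4) by (auto simp: m_def)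
    moreover have "c m u' \<in> Z" using stable_c[OF mv(5), of m] u' m by (simp add: m_def)
    moreover have "c m u' \<notin> K"
    proof
      assume "c m u' \<in> K"
      then have "c m (c m u') \<in> K" using stable_c[OF mv(6), of m] m by (simp add: m_def)
      then show False using u'(7) c_sq[OF m uV(1)] by simp
    qed
    ultimately show ?thesis using u'(1-4) Lc by (auto simp: m_def simp del: wt.simps)
  qed
qed

lemma cont_eq_2_small: "\<lbrakk>cont (int r) = 2; r + 1 < h\<rbrakk> \<Longrightarrow> r = 0"
  using cont_eq_2_iff[of "int r"] h_dvd_small[of "int r"] h_dvd_small[of "int r + 1"] by auto

lemma xv_square_one: "\<lbrakk>a^2 = 1; xv a = cont i\<rbrakk> \<Longrightarrow> a = 1 \<and> cont i = 2"
  using cont_neq_minus_2[of i] by (auto simp: power2_eq_1_iff)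

text \<open>Moving r to the end of cs gives eigenvalues b, a, b in three consecutive places. A
  nonzero intertwiner image would have b in two adjacent places, against
  \<open>neighbours_neq\<close>; so both intertwiners vanish, and the braid relation leaves b^2 = 1
  or a double neighbour.\<close>

lemma no_zigzag:
  assumes m: "split m" "m = Suc (length cs)" "m + 2 \<le> h" "m < n"
    and v: "v \<in> V" "v \<noteq> 0" "wt cs v" "tab cs S"
    and a: "L m v = a *s v" "xv a = cont (int d)" and b: "L (Suc m) v = b *s v" "xv b = cont (int r)"
    and r: "Suc r \<in> S" "r \<notin> S" "r = Suc d \<or> d = Suc r"
  shows "r = 0 \<or> int h dvd 2 * int d + 1"
proof -
  define M where "M = length cs"
  define Z where "Z = {z \<in> {z \<in> V. L m z = a *s z}. L (Suc m) z = b *s z}"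
  have nz: "a \<noteq> 0" "b \<noteq> 0" using eig_nonzero[of m v a] eig_nonzero[of "Suc m" v b] v a b m by auto
  have "stable M Z" unfolding Z_def using m
    by (intro stable_eigenspace stable_V) (auto simp: M_def)
  then have "\<exists>cs' S' u'. tab cs' S' \<and> addable S' r \<and> add_box S' r = S \<and> Suc (length cs') = length cs \<and>
    wt (r # cs') u' \<and> L (length cs) u' = b *s u' \<and> u' \<in> Z \<and> u' \<notin> {0}"
    using m v a b nz r unfolding M_def
    by (intro move_normalized[where u = v]) (auto simp: Z_def stable_zero)
  then obtain cs' S' u where u: "tab cs' S'" "addable S' r" "add_box S' r = S" "Suc (length cs') = M"
    "wt (r # cs') u" "L M u = b *s u" "u \<in> V" "L m u = a *s u" "L (Suc m) u = b *s u" "u \<noteq> 0"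
    by (auto simp: Z_def M_def simp del: wt.simps)
  have M: "1 \<le> M" "m = Suc M" using u m by (auto simp: M_def)
  have xab: "xv a \<noteq> xv b" using neighbours_neq[of m u a b] u m split_no_jordan M by auto
  then have ab: "b \<noteq> a" "b * a \<noteq> 1" using xv_eq_iff[of b a] nz by auto
  have 1: "phi M b a u 0 = 0"
  proof (rule ccontr)
    let ?w = "phi M b a u 0"
    assume "?w \<noteq> 0"
    moreover have "L (Suc M) ?w = b *s ?w"
      using phi_intertwines(2)[of M u 0 b a] u M m nz ab by (simp add: L_zero)
    moreover have "L (Suc m) ?w = b *s ?w"
      using u m M by (simp add: L_phi L_zero phi_scale[where v = 0, simplified])
    ultimately show False using neighbours_neq[of m ?w b b] u m M split_no_jordan by auto
  qed
  have 2: "phi (Suc M) a b u 0 = 0"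
  proof (rule ccontr)
    let ?w = "phi m a b u 0"
    assume "phi (Suc M) a b u 0 \<noteq> 0"
    moreover have "L m ?w = b *s ?w"
      using phi_intertwines(1)[of m u 0 a b] u M m nz ab by (simp add: L_zero mult.commute)
    moreover have "L M ?w = b *s ?w"
      using u m M by (simp add: L_phi L_zero phi_scale[where v = 0, simplified])
    ultimately show False using neighbours_neq[of M ?w b b] u m M split_no_jordan by auto
  qed
  have "b^2 = 1 \<or> (xv a)^2 + xv b * xv a = 8"
    using phi_braid_true[of M u b a] 1 2 u m M nz ab by auto
  then show ?thesis
  proof
    assume "b^2 = 1"
    then have "cont (int r) = 2" using xv_square_one b by blast
    moreover have "r + 1 < h" using tab_le[OF v(4) r(1)] m by simp
    ultimately show ?thesis using cont_eq_2_small by blast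
  next
    assume "(xv a)^2 + xv b * xv a = 8"
    then have "int h dvd 2 * int d + 1" using double_neighbour[of "xv b" "int d"] a b r(3) xab by (auto simp: add.commute)
    then show ?thesis ..
  qed
qed

end

section \<open>The inductive step\<close>

context hc_split
begin

lemma split_1: "1 \<le> n \<Longrightarrow> split 1"
proof -
  have "tab [0] (add_box {} 0)" by (rule tab.intros tab_Nil)+ (simp add: addable_def)
  moreover have "wt [0] v" for v
    by (simp add: L_1 cont_0 exI[of _ 1])
  moreover have "no_jordan (Suc 0)"
    unfolding no_jordan_def
  proof (intro ballI allI impI)
    fix u a assume "L (Suc 0) (L (Suc 0) u - a *s u) = a *s (L (Suc 0) u - a *s u)"
    then have "1 *s (u - a *s u) = a *s (u - a *s u)" by (simp only: L_1 scale_one)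
    then have "1 = a \<or> u - a *s u = 0" by (simp only: scale_cancel_right)
    then show "L (Suc 0) u = a *s u" by (auto simp: L_1)
  qed
  ultimately show ?thesis unfolding split_def by (force simp: le_Suc_eq)
qed

text \<open>If the last two boxes can be exchanged, the new content was addable before d was.
  Otherwise it is a neighbour of d, and the corresponding box is addable unless its absence creates
  a zigzag.\<close>

lemma split_step_eigenvector:
  assumes m: "split m" "1 \<le> m" "m + 2 \<le> h" "m < n"
    and v: "v \<in> V" "v \<noteq> 0" "wt (d # cs) v" "length (d # cs) = m" "tab cs S" "addable S d"
    and b: "L (Suc m) v = b *s v"
  shows "\<exists>r. addable (add_box S d) r \<and> xv b = cont (int r)"
proof -
  have m': "m = Suc (length cs)" using v(4) by simp
  obtain a where a: "L m v = a *s v" "xv a = cont (int d)" using v(3) m' by auto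
  have nz: "a \<noteq> 0" "b \<noteq> 0" using eig_nonzero[of m v a] eig_nonzero[of "Suc m" v b] v a b m by auto
  have xab: "xv a \<noteq> xv b" using neighbours_neq[of m v a b] v a b m split_no_jordan by auto
  then have ab: "a \<noteq> b" "a * b \<noteq> 1" using xv_eq_iff[OF nz] by auto
  have tabd: "tab (d # cs) (add_box S d)" using v by (intro tab.tab_Cons)
  show ?thesis
  proof (cases "phi m a b v 0 = 0")
    case False
    let ?w = "phi m a b v 0"
    have "L m ?w = b *s ?w"
      using phi_intertwines(1)[of m v 0 a b] v m nz ab a b by (simp add: L_zero)
    moreover have "wt cs ?w" using v m m' by (intro wt_phi_0) auto
    ultimately obtain r where r: "addable S r" "xv b = cont (int r)"
      using next_content[of m cs ?w S b] m m' v False by auto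
    moreover have "r \<noteq> d" using r a xab by auto
    ultimately show ?thesis using addable_add_box[OF v(6)] by auto
  next
    case True
    then have "xv b = cont (int d + 1) \<or> xv b = cont (int d - 1)"
      using phi_zero_adjacent[of m v a b "int d"] m v a b xab by auto
    then consider "xv b = cont (int (Suc d))" | "xv b = cont (int (d - 1))" "d \<noteq> 0"
    proof (elim disjE)
      assume 1: "xv b = cont (int d - 1)"
      \<comment> \<open>For d = 0 the lower neighbour has the value of d itself, which contradicts
        \<open>xab\<close>.\<close>
      have "cont (- 1) = cont 0" using cont_eq_iff[of "-1" 0] by simp
      then have "d \<noteq> 0" using 1 xab a by (intro notI) simp
      then show thesis using that 1 by (simp add: of_nat_diff)
    qed (simp add: that add.commute)
    then show ?thesis
    proof cases
      case 1
      \<comment> \<open>A row of length d + 2 would supply an earlier box of content d + 1, hence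
        the zigzag d + 1, d, d + 1.\<close>
      have "Suc (Suc d) \<notin> add_box S d"
      proof
        assume 2: "Suc (Suc d) \<in> add_box S d"
        then have "Suc (Suc d) \<in> S" "Suc d \<notin> S" using v(6) by (auto simp: add_box_def addable_def)
        then have "Suc d = 0 \<or> int h dvd 2 * int d + 1"
          using no_zigzag[of m cs v S a d b "Suc d"] m m' v a b 1 by auto
        moreover have "Suc d + Suc (Suc d) \<le> length (d # cs)"
          using tab_sum_le[OF tabd, of "Suc d" "Suc (Suc d)"] 2 by (auto simp: add_box_def)
        ultimately show False using h_dvd_small[of "2 * int d + 1"] m v(4) by simp
      qed
      then show ?thesis using 1 by (intro exI[of _ "Suc d"]) (auto simp: addable_def add_box_def)
    next
      case 2
      show ?thesis
      proof (cases "d = 1 \<or> d - 1 \<in> S")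
        case True
        then show ?thesis using 2 v(6)
          by (intro exI[of _ "d - 1"]) (auto simp: addable_def add_box_def)
      next
        case False
        then have "Suc (d - 1) \<in> S" "d - 1 \<notin> S" "d = Suc (d - 1)" using 2 v(6) by (auto simp: addable_def)
        then have mid: "int h dvd 2 * int d + 1"
          using no_zigzag[of m cs v S a d b "d - 1"] m m' v a b 2 False by auto
        \<comment> \<open>Both neighbours of the middle content have one value, so the eigenvalue
          can be read as content d + 1, where a box can be added.\<close>
        then have "cont (int d - 1) = cont (int d + 1)" using cont_eq_iff[of "int d - 1" "int d + 1"] by auto
        then have "xv b = cont (int (Suc d))" using 2 by (simp add: of_nat_diff add.commute)
        moreover have "Suc (Suc d) \<notin> add_box S d"
        proof
          assume 3: "Suc (Suc d) \<in> add_box S d"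
          have "Suc d + Suc (Suc d) \<le> length (d # cs)"
            using tab_sum_le[OF tabd, of "Suc d" "Suc (Suc d)"] 3 by (auto simp: add_box_def)
          then show False using h_dvd_small[OF mid] m v(4) by simp
        qed
        ultimately show ?thesis by (intro exI[of _ "Suc d"]) (auto simp: addable_def add_box_def)
      qed
    qed
  qed
qed

text \<open>If v were not killed, \<open>phi\<close> would carry the Jordan pair of L_(m+1) to one
  of L_m. With v killed, the image of u is an eigenvector; if nonzero, it would make d and a
  neighbour of d addable to the same shape, which is impossible. So going back and forth on the pair
  gives zero, and \<open>kap\<close> and \<open>kap1\<close> vanish.\<close>

lemma jordan_adjacent:
  assumes m: "split m" "1 \<le> m" "m + 2 \<le> h" "m < n"
    and u: "u \<in> V" "wt (d # cs) u" "length (d # cs) = m" "tab cs S" "addable S d"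
    and v: "v \<in> V" "v \<noteq> 0" "\<And>j x. \<lbrakk>1 \<le> j; j \<le> m; L j u = x *s u\<rbrakk> \<Longrightarrow> L j v = x *s v"
    and b: "L (Suc m) u = b *s u + v" "L (Suc m) v = b *s v"
    and a: "L m u = a *s u" "xv a = cont (int d)"
  shows "phi m a b v 0 = 0" "phi m a b u v = 0" "xv b \<noteq> xv a"
    "xv b = cont (int d + 1) \<or> xv b = cont (int d - 1)" "b^2 = 1 \<or> (xv a)^2 + xv a * xv b = 8"
proof -
  have m': "m = Suc (length cs)" using u(3) by simp
  have av: "L m v = a *s v" using v(3)[of m a] m a by simp
  have nz: "a \<noteq> 0" "b \<noteq> 0" using eig_nonzero[of m v a] eig_nonzero[of "Suc m" v b] v av b m by auto
  show xab: "xv b \<noteq> xv a" using neighbours_neq[of m v a b] v av b m split_no_jordan by auto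
  then have ab: "a \<noteq> b" "a * b \<noteq> 1" using xv_eq_iff[OF nz] by auto
  have i: "L m (phi m a b u v) = b *s phi m a b u v + phi m a b v 0"
    "L m (phi m a b v 0) = b *s phi m a b v 0"
    using phi_intertwines(1)[of m u v a b] phi_intertwines(1)[of m v 0 a b] u v m nz ab a av b
    by (simp_all add: L_zero)
  show 0: "phi m a b v 0 = 0"
    using no_jordanD[OF split_no_jordan[OF m(1,2) order_refl] _ i] u v by simp
  show adj: "xv b = cont (int d + 1) \<or> xv b = cont (int d - 1)"
    using phi_zero_adjacent[of m v a b "int d"] m v a av b xab 0 by auto
  show 1: "phi m a b u v = 0"
  proof (rule ccontr)
    let ?w = "phi m a b u v"
    assume w: "?w \<noteq> 0"
    have "wt cs u" using u(2) by simp
    then have "wt cs ?w" using u(1) v m m' by (intro wt_phi) auto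
    moreover have "L m ?w = b *s ?w" using i 0 by simp
    ultimately obtain r where r: "addable S r" "xv b = cont (int r)"
      using next_content[of m cs ?w S b] m m' u v w by auto
    have rd: "r \<noteq> d" using r a xab by auto
    then have sum: "r + d + 3 \<le> h" using tab_sum_le[OF u(4), of r d] r u(5) m m' by (auto simp: addable_def)
    from adj show False
    proof
      assume "xv b = cont (int d + 1)"
      then have "r = Suc d" using cont_inj_small[of r "Suc d"] r sum by (simp add: add.commute)
      then show False using r u(5) by (auto simp: addable_def)
    next
      assume 2: "xv b = cont (int d - 1)"
      have "cont (- 1) = cont 0" using cont_eq_iff[of "-1" 0] by simp
      then have "d \<noteq> 0" using 2 xab a by (intro notI) simp
      then have "r = d - 1" using cont_inj_small[of r "d - 1"] r 2 sum by (simp add: of_nat_diff)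
      then show False using r u(5) \<open>d \<noteq> 0\<close> by (auto simp: addable_def)
    qed
  qed
  have kap: "kap a b = 0"
    using phi_zero_adjacent(1)[of m v a b "int d"] m v a av b xab 0 by auto
  have "kap1 a b *s v = 0"
    using phi_phi[of m u v a b] m u v ab 0 1 kap by simp
  then have "kap1 a b = 0" using v by simp
  then show "b^2 = 1 \<or> (xv a)^2 + xv a * xv b = 8" using kap1_zero[OF nz ab] by blast
qed

text \<open>A nonzero image would place content r + 1 on the shape S, where r is addable and
  therefore r + 1 is not.\<close>

lemma phi_zero_of_not_addable:
  assumes m: "split M" "M = Suc (length cs)" "M + 3 \<le> h" "Suc M \<le> n"
    and w: "w \<in> V" "wt (r # cs) w" "tab cs S" "addable S r"
    and b: "L M w = b *s w" and a: "L (Suc M) w = a *s w" "xv a = cont (int (Suc r))"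
  shows "phi M b a w 0 = 0"
proof (rule ccontr)
  let ?w = "phi M b a w 0"
  assume w0: "?w \<noteq> 0"
  then have wn: "w \<noteq> 0" by auto
  have xb: "xv b = cont (int r)" using w(2) b wn m(2) by auto
  have nz: "a \<noteq> 0" "b \<noteq> 0" using eig_nonzero[of M w b] eig_nonzero[of "Suc M" w a] w a b m wn by auto
  have rM: "r \<le> length cs" using tab_le[OF w(3), of r] w(4) by (auto simp: addable_def)
  have "cont (int r) \<noteq> cont (int (Suc r))"
  proof
    assume "cont (int r) = cont (int (Suc r))"
    then have "int h dvd int r - int (Suc r) \<or> int h dvd int r + int (Suc r) + 1"
      by (simp only: cont_eq_iff)
    then have "int h dvd 1 \<or> int h dvd 2 * (int r + 1)"
      by (auto simp: algebra_simps)
    then have "int h dvd 1 \<or> int h dvd int r + 1" by (simp only: h_dvd_double)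
    then show False using h_dvd_small[of 1] h_dvd_small[of "int r + 1"] rM m h_ge_3 by auto
  qed
  then have ab: "b \<noteq> a" "b * a \<noteq> 1" using xv_eq_iff[of b a] nz a xb by auto
  have "L M ?w = a *s ?w"
    using phi_intertwines(1)[of M w 0 b a] w m nz ab a b by (simp add: L_zero)
  moreover have "wt cs ?w" using w m by (intro wt_phi_0) auto
  ultimately obtain e where e: "addable S e" "xv a = cont (int e)"
    using next_content[of M cs ?w S a] m w w0 by auto
  have "e \<noteq> r" using e a \<open>cont (int r) \<noteq> cont (int (Suc r))\<close> by auto
  then have "e + r \<le> length cs" using tab_sum_le[OF w(3)] e w(4) by (auto simp: addable_def)
  then have "e = Suc r" using cont_inj_small[of e "Suc r"] e a m by simp
  then show False using e w(4) by (auto simp: addable_def)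
qed

text \<open>Z and K are the kernels of the square of L_(m+1) - b and of L_(m+1) - b itself, both
  stable in rank m. In the two surviving cases a vector with contents d - 1, d, d - 1 is reached for
  which the leading braid coefficient is zero, so the contradiction has to come from
  \<open>gam1\<close> and \<open>gam2\<close>.\<close>

lemma split_step_no_jordan:
  assumes m: "\<And>k. \<lbrakk>1 \<le> k; k \<le> m\<rbrakk> \<Longrightarrow> split k" "1 \<le> m" "m + 2 \<le> h" "m < n"
  shows "no_jordan (Suc m)"
proof (rule ccontr)
  let ?L = "L (Suc m)"
  assume "\<not> no_jordan (Suc m)"
  then obtain u0 b where u0: "u0 \<in> V" "?L (?L u0 - b *s u0) = b *s (?L u0 - b *s u0)" "?L u0 \<noteq> b *s u0"
    by (auto simp: no_jordan_def)
  define Z where "Z = {z \<in> V. ?L (?L z - b *s z) = b *s (?L z - b *s z)}"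
  define K where "K = {z \<in> V. ?L z = b *s z}"
  have N_add: "?L (x + y) - b *s (x + y) = (?L x - b *s x) + (?L y - b *s y)"
    and N_scale: "?L (z *s x) - b *s z *s x = z *s (?L x - b *s x)" for x y z
    by (simp_all add: lin_L lin mult.commute)
  have subZ: "subspace Z"
  proof (rule subspaceI)
    fix x y assume "x \<in> Z" "y \<in> Z"
    then show "x + y \<in> Z" unfolding Z_def mem_Collect_eq N_add
      by (simp add: L_add scale_right_distrib)
  next
    fix x z assume "x \<in> Z"
    then show "z *s x \<in> Z" unfolding Z_def mem_Collect_eq N_scale
      by (simp add: L_scale mult.commute)
  qed (simp add: Z_def L_zero)
  have stK: "stable m K" unfolding K_def using m by (intro stable_eigenspace stable_V) auto
  have Z_closed: "f z \<in> Z" if "z \<in> Z" "f z \<in> V"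
    "?L (?L (f z) - b *s f z) = f (?L (?L z - b *s z))"
    "b *s (?L (f z) - b *s f z) = f (b *s (?L z - b *s z))" for f z
    using that unfolding Z_def mem_Collect_eq by metis
  have ZV: "z \<in> V" if "z \<in> Z" for z using that by (simp add: Z_def)
  have stZ: "stable m Z"
    unfolding stable_def
  proof (intro conjI allI impI)
    fix i z assume iz: "1 \<le> i \<and> Suc i \<le> m \<and> z \<in> Z"
    then show "t i z \<in> Z" using m by (intro Z_closed[of z "t i"]) (auto simp: ZV L_t lin lin_L)
  next
    fix i z assume iz: "1 \<le> i \<and> i \<le> m \<and> z \<in> Z"
    then show "c i z \<in> Z" using m by (intro Z_closed[of z "c i"]) (auto simp: ZV L_c_other lin lin_L)
  qed (use subZ in \<open>auto simp: Z_def\<close>)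
  have LZ: "L k z \<in> Z" if "1 \<le> k" "k \<le> m" "z \<in> Z" for k z
    using that m by (intro Z_closed[of z "L k"]) (auto simp: ZV L_L[of k "Suc m"] lin_L lin)
  have spm: "split m" using m by simp
  obtain u where u: "u \<in> Z" "u \<notin> K" "joint m u"
    using joint_eigenvector_outside[OF subZ _ LZ, of m K u0] stK u0 m split_no_jordan[OF spm]
    by (auto simp: Z_def K_def stable_def)
  have jord: "w \<in> V" "w \<noteq> 0" "?L w - b *s w \<in> V" "?L w - b *s w \<noteq> 0" "?L w = b *s w + (?L w - b *s w)"
    "?L (?L w - b *s w) = b *s (?L w - b *s w)"
    "\<And>j x. \<lbrakk>1 \<le> j; j \<le> m; L j w = x *s w\<rbrakk> \<Longrightarrow> L j (?L w - b *s w) = x *s (?L w - b *s w)"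
    if w: "w \<in> Z" "w \<notin> K" for w
  proof -
    show V: "w \<in> V" using w by (simp add: ZV)
    show "w \<noteq> 0" using w by (auto simp: K_def L_zero V_closed)
    show "?L w - b *s w \<in> V" using V by simp
    show "?L w - b *s w \<noteq> 0" using w V by (auto simp: K_def)
    show "?L w = b *s w + (?L w - b *s w)" by simp
    show "?L (?L w - b *s w) = b *s (?L w - b *s w)" using w(1) unfolding Z_def by blast
    fix j x assume j: "1 \<le> j" "j \<le> m" "L j w = x *s w"
    have "L j (?L w) = x *s ?L w" using L_L[of "Suc m" j w] j V m by (simp add: L_scale)
    then show "L j (?L w - b *s w) = x *s (?L w - b *s w)"
      by (simp add: L_diff L_scale j lin mult.commute)
  qed
  obtain cs0 S0 where "length cs0 = m" "tab cs0 S0" "wt cs0 u"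
    using spm jord(1,2)[OF u(1,2)] u(3) by (auto simp: split_def)
  moreover from this obtain d cs where "cs0 = d # cs" using m by (cases cs0) auto
  ultimately obtain S where cs: "tab cs S" "addable S d" "length (d # cs) = m" "wt (d # cs) u"
    by (auto elim: tab_ConsE simp del: wt.simps)
  have m': "m = Suc (length cs)" using cs(3) by simp
  obtain a where a: "L m u = a *s u" "xv a = cont (int d)" using cs(4) m' by auto
  have adj: "xv b \<noteq> xv a" "xv b = cont (int d + 1) \<or> xv b = cont (int d - 1)"
      "b^2 = 1 \<or> (xv a)^2 + xv a * xv b = 8"
    by (rule jordan_adjacent[OF spm m(2-4) jord(1)[OF u(1,2)] cs(4,3,1,2) jord(3,4)[OF u(1,2)] _
        jord(5,6)[OF u(1,2)] a], rule jord(7)[OF u(1,2)], assumption+)+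
  have nz: "a \<noteq> 0" "b \<noteq> 0"
    using eig_nonzero[OF _ _ jord(1,2)[OF u(1,2)] a(1)] eig_nonzero[OF _ _ jord(3,4,6)[OF u(1,2)]] m by auto
  have dm: "d \<le> length cs" using tab_le[OF cs(1), of d] cs(2) by (auto simp: addable_def)
  have d0: "d \<noteq> 0" if "xv b = cont (int d - 1)"
  proof -
    have "cont (- 1) = cont 0" using cont_eq_iff[of "-1" 0] by simp
    then show ?thesis using that adj(1) a(2) by (metis of_nat_0 diff_0)
  qed
  \<comment> \<open>Either b = 1, whose content is 0, so that d = 1; or d is the middle content, and
    both neighbours have one value. In either case the new content may be taken as d - 1, and h = 3
    is impossible because it would leave cs empty and d = 0.\<close>
  have key: "d \<noteq> 0 \<and> d - 1 \<notin> S \<and> xv b = cont (int (d - 1)) \<and>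
      (b = 1 \<and> d = 1 \<or> (xv a)^2 + xv a * xv b = 8 \<and> int h dvd 2 * int d + 1) \<and> h > 3"
    using adj(3)
  proof
    assume b2: "b^2 = 1"
    obtain i where i: "xv b = cont i" using adj(2) by blast
    then have b1: "b = 1" "xv b = 2" using xv_square_one[OF b2 i] by simp_all
    have "xv b \<noteq> cont (int (Suc d))"
      using cont_eq_2_small[of "Suc d"] b1(2) dm m(3) m' by (metis Suc_eq_plus1 Suc_le_mono add_2_eq_Suc' le_SucI nat.distinct(1) not_less_eq_eq le_trans not_less)
    then have d1: "xv b = cont (int d - 1)" using adj(2) by (simp only: of_nat_Suc add.commute) blast
    have "d - 1 = 0" using cont_eq_2_small[of "d - 1"] d1 d0[OF d1] b1(2) dm m(3) m' by (simp add: of_nat_diff)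
    then have "d = 1" using d0[OF d1] by simp
    moreover have "0 \<notin> S" using tab_props[OF cs(1)] by simp
    ultimately show ?thesis using b1(1) d1 dm m(3) m' by simp
  next
    assume 8: "(xv a)^2 + xv a * xv b = 8"
    then have "(cont (int d))^2 + xv b * cont (int d) = 8" unfolding a(2) by (simp only: mult.commute)
    then have mid: "int h dvd 2 * int d + 1"
      using double_neighbour[of "xv b" "int d"] adj(2) adj(1)[unfolded a(2)] by blast
    then have "cont (int d - 1) = cont (int d + 1)" using cont_eq_iff[of "int d - 1" "int d + 1"] by auto
    then have d1: "xv b = cont (int d - 1)" using adj(2) by metis
    have hd: "h \<le> 2 * d + 1" using h_dvd_small[OF mid] by simp
    have "d - 1 \<notin> S"
    proof
      assume "d - 1 \<in> S"
      then have "d - 1 + d \<le> length cs" using tab_sum_le[OF cs(1), of "d - 1" d] cs(2) d0[OF d1]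
        by (auto simp: addable_def)
      then show False using hd m(3) m' d0[OF d1] by simp
    qed
    moreover have "h > 3" using hd m(3) m' dm d0[OF d1] by simp
    ultimately show ?thesis using 8 mid d1 d0[OF d1] by (simp add: of_nat_diff)
  qed
  define r where "r = d - 1"
  have dr: "d = Suc r" using key by (simp add: r_def)
  have rS: "Suc r \<in> S" "r \<notin> S" using key cs(2) dr by (auto simp: addable_def)
  define M where "M = length cs"
  \<comment> \<open>Fixing the eigenvalue a of L_m keeps d in place m while the box of content d - 1
    is moved to place M.\<close>
  define Z' where "Z' = {z \<in> Z. L m z = a *s z}"
  have stab: "stable M Z'" "stable M K"
    unfolding Z'_def using m m' stZ stK
    by (auto simp: M_def intro!: stable_eigenspace intro: stable_mono)
  have "\<exists>cs' S' u'. tab cs' S' \<and> addable S' r \<and> add_box S' r = S \<and> Suc (length cs') = length cs \<and>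
    wt (r # cs') u' \<and> L (length cs) u' = b *s u' \<and> u' \<in> Z' \<and> u' \<notin> K"
    using cs u stab m m' nz rS a key
    by (intro move_normalized[where u = u]) (auto simp: Z'_def M_def r_def)
  then obtain cs1 S1 u1 where u1: "tab cs1 S1" "addable S1 r" "add_box S1 r = S" "Suc (length cs1) = M"
    "wt (r # cs1) u1" "L M u1 = b *s u1" "u1 \<in> Z" "L m u1 = a *s u1" "u1 \<notin> K"
    by (auto simp: M_def Z'_def simp del: wt.simps)
  have M: "1 \<le> M" "m = Suc M" using u1(4) m' by (auto simp: M_def)
  define v1 where "v1 = ?L u1 - b *s u1"
  note j1 = jord[OF u1(7,9), folded v1_def]
  have tab1: "tab (r # cs1) S" using tab.tab_Cons[OF u1(1,2)] u1(3) by simp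
  have wtd: "wt (d # r # cs1) u1" using u1 a M by auto
  have len1: "length (d # r # cs1) = m" using u1(4) M by simp
  have adj1: "phi m a b v1 0 = 0" "phi m a b u1 v1 = 0"
    by (rule jordan_adjacent[OF spm m(2-4) j1(1) wtd len1 tab1 cs(2) j1(3,4) _ j1(5,6) u1(8) a(2)],
        rule j1(7), assumption+)+
  have wtv: "wt (r # cs1) v1"
  proof (rule wt_transfer[OF u1(5)])
    fix j x assume "1 \<le> j" "j \<le> length (r # cs1)" "L j u1 = x *s u1"
    then have "L j v1 = x *s v1" using j1(7)[of j x] u1(4) M by simp
    then show "\<exists>b. L j v1 = b *s v1 \<and> xv x = xv b" by blast
  qed
  have spM: "split M" using m(1)[of M] M by simp
  have aS: "xv a = cont (int (Suc r))" using a(2) dr by simp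
  have p1: "phi M b a u1 0 = 0"
    using phi_zero_of_not_addable[OF spM _ _ _ j1(1) u1(5,1,2,6) _ aS] u1 m M by simp
  have v1e: "L M v1 = b *s v1" "L (Suc M) v1 = a *s v1"
    using j1(7)[of M b] j1(7)[of m a] u1 M by auto
  have p2: "phi M b a v1 0 = 0"
    using phi_zero_of_not_addable[OF spM _ _ _ j1(3) wtv u1(1,2) v1e(1) v1e(2) aS] u1 m M by simp
  have p3: "phi (Suc M) a b v1 0 = 0" "phi (Suc M) a b u1 v1 = 0"
    using adj1 by (simp_all only: M(2))
  have ab: "b \<noteq> a" "b * a \<noteq> 1" using adj(1) xv_eq_iff[OF nz(2,1)] by blast+
  have Mn: "Suc M < n" using m M by simp
  note br = phi_braid_jordan[OF M(1) Mn j1(1,3,4) nz(2,1) ab p1 p2 p3(2,1)]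
  show False
    using key
  proof (elim conjE disjE)
    assume "b = 1" "d = 1" "h > 3"
    then have "cont (int d) = - 4" using br(1) unfolding a(2) by blast
    then show False using cont_1_neq[OF \<open>h > 3\<close>] \<open>d = 1\<close> by simp
  next
    assume mid: "(xv a)^2 + xv a * xv b = 8" "int h dvd 2 * int d + 1" "h > 3"
    from mid(1) have "(xv a)^2 + xv b * xv a = 8" by (simp only: mult.commute)
    from br(2)[OF this] show False using cont_middle[OF mid(2,3)] unfolding a(2) by blast
  qed
qed

lemma split_upto: "\<lbrakk>1 \<le> m; m < h; m \<le> n\<rbrakk> \<Longrightarrow> split m"
proof (induction m rule: less_induct)
  case (less m)
  show ?case
  proof (cases "m = 1")
    case True
    then show ?thesis using split_1 less.prems by simp
  next
    case False
    then obtain k where k: "m = Suc k" "1 \<le> k" using less.prems by (cases m) auto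
    have sp: "split j" if "1 \<le> j" "j \<le> k" for j using less that k by simp
    have spk: "split k" using sp k by simp
    have "\<exists>cs S. length cs = m \<and> tab cs S \<and> wt cs v" if v: "v \<in> V" "v \<noteq> 0" "joint m v" for v
    proof -
      have "joint k v" using v k by (simp add: joint_def)
      then obtain cs0 S0 where cs0: "length cs0 = k" "tab cs0 S0" "wt cs0 v"
        using spk v by (auto simp: split_def)
      then obtain d cs where d: "cs0 = d # cs" using k by (cases cs0) auto
      obtain S where S: "tab cs S" "addable S d" "S0 = add_box S d"
        using cs0(2) unfolding d by (auto elim: tab_ConsE)
      obtain b where b: "L m v = b *s v" using v k by (auto simp: joint_def)
      obtain r where r: "addable S0 r" "xv b = cont (int r)"
        using split_step_eigenvector[OF spk k(2) _ _ v(1,2) _ _ S(1,2)] cs0 less.prems k b S(3)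
        unfolding d by (auto simp del: wt.simps)
      then have "wt (r # cs0) v" using b cs0 k by auto
      moreover have "tab (r # cs0) (add_box S0 r)" using cs0 r by (intro tab.tab_Cons)
      ultimately show ?thesis using cs0 k by (intro exI[of _ "r # cs0"]) auto
    qed
    moreover have "no_jordan m"
      using split_step_no_jordan[of k] sp k less.prems by simp
    ultimately show ?thesis using split_no_jordan[OF spk] k by (auto simp: split_def le_Suc_eq)
  qed
qed

definition joint_span :: "'w set" where
  "joint_span = span {v \<in> V. joint n v}"

text \<open>T_k v is the intertwiner image plus multiples of v and C_k C_(k+1) v, all of which are
  joint eigenvectors. Absence of Jordan blocks is used only for k < n, so n = h is covered.\<close>

lemma joint_span_t:
  assumes h: "n \<le> h" and k: "1 \<le> k" "k < n" and v: "v \<in> V" "joint n v"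
  shows "t k v \<in> joint_span"
proof (cases "v = 0")
  case True
  then show ?thesis by (simp add: joint_span_def lin span_zero)
next
  case False
  have eig: "\<exists>a. L j v = a *s v" if "1 \<le> j" "j \<le> n" for j using v that by (auto simp: joint_def)
  obtain a b where a: "L k v = a *s v" and b: "L (Suc k) v = b *s v"
    using eig[of k] eig[of "Suc k"] k by auto
  have nz: "a \<noteq> 0" "b \<noteq> 0" using eig_nonzero[of k v a] eig_nonzero[of "Suc k" v b] v a b k False by auto
  have "no_jordan k" using split_no_jordan[OF split_upto[of k], of k] k h by simp
  then have "xv a \<noteq> xv b" using neighbours_neq k v False a b by blast
  then have ab: "a \<noteq> b" "a * b \<noteq> 1" using xv_eq_iff[OF nz] by auto
  let ?w = "phi k a b v 0"
  have "joint n ?w"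
    unfolding joint_def
  proof (intro allI impI)
    fix j assume j: "1 \<le> j \<and> j \<le> n"
    then obtain x where x: "L j v = x *s v" using eig by blast
    have "L j ?w = x *s ?w" if "j \<noteq> k" "j \<noteq> Suc k"
      using j that k v by (simp add: L_phi x L_zero phi_scale[where v = 0, simplified])
    moreover have "L k ?w = b *s ?w" "L (Suc k) ?w = a *s ?w"
      using phi_intertwines[of k v 0 a b] v k nz ab a b by (simp_all add: L_zero)
    ultimately show "\<exists>a. L j ?w = a *s ?w" by metis
  qed
  moreover have "joint n (cd k v)"
    unfolding joint_def
  proof (intro allI impI)
    fix j assume j: "1 \<le> j \<and> j \<le> n"
    then obtain x where x: "L j v = x *s v" using eig by blast
    have "L j (cd k v) = x *s cd k v" if "j \<noteq> k" "j \<noteq> Suc k"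
      using j that k v by (simp add: L_c_other x lin)
    moreover have "L k (cd k v) = inverse a *s cd k v"
      using eig_c_self[of k "c (Suc k) v" a] k v a nz by (simp add: L_c_above lin)
    moreover have "L (Suc k) (cd k v) = inverse b *s cd k v"
      using eig_c_self[of "Suc k" v b] k v b nz by (simp add: L_c_below lin)
    ultimately show "\<exists>a. L j (cd k v) = a *s cd k v" by metis
  qed
  moreover have "t k v = ?w + (fA a b *s v + fB a b *s cd k v)"
    by (simp add: phi_def lin)
  ultimately show ?thesis
    unfolding joint_span_def using v
    by (metis (mono_tags, lifting) V_closed(1,7) c_closed mem_Collect_eq phi_closed span_add span_base span_scale)
qed

lemma joint_span_c:
  assumes k: "1 \<le> k" "k \<le> n" and v: "v \<in> V" "joint n v"
  shows "c k v \<in> joint_span"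
proof -
  have "joint n (c k v)"
    unfolding joint_def
  proof (intro allI impI)
    fix j assume j: "1 \<le> j \<and> j \<le> n"
    then obtain x where x: "L j v = x *s v" using v by (auto simp: joint_def)
    show "\<exists>a. L j (c k v) = a *s c k v"
    proof (cases "j = k \<and> v \<noteq> 0")
      case True
      then show ?thesis using eig_c_self[of k v x] eig_nonzero[of k v x] k v x by auto
    next
      case False
      then show ?thesis using j k v by (cases "v = 0") (auto simp: L_c_other x lin L_zero)
    qed
  qed
  then show ?thesis unfolding joint_span_def using v by (intro span_base) simp
qed

end


section \<open>Modules over the Hecke--Clifford superalgebra\<close>

context hc_rep
begin

text \<open>For d <= m this is T_(m-d+1) ... T_m w. These products represent the cosets of the Hecke
  algebra on T_1, ..., T_(m-1) in the one on T_1, ..., T_m.\<close>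

primrec chain :: "nat \<Rightarrow> nat \<Rightarrow> 'w \<Rightarrow> 'w" where
  "chain m 0 w = w"
| "chain m (Suc d) w = t (m - d) (chain m d w)"

lemma chain_lin: "chain m d (v + w) = chain m d v + chain m d w" "chain m d (a *s w) = a *s chain m d w"
  by (induction d) (simp_all add: lin)

lemma chain_closed [simp]: "w \<in> V \<Longrightarrow> chain m d w \<in> V"
  by (induction d) simp_all

lemma t_chain_below: "\<lbrakk>1 \<le> i; i + d < m; m < n; w \<in> V\<rbrakk> \<Longrightarrow> t i (chain m d w) = chain m d (t i w)"
proof (induction d)
  case (Suc d)
  then have "t i (t (m - d) (chain m d w)) = t (m - d) (t i (chain m d w))"
    by (intro t_t') auto
  then show ?case using Suc by simp
qed simp

text \<open>T_i commutes with the left part of the chain until it meets T_(i-1) T_i; there the braid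
  relation releases T_(i-1) to the right.\<close>

lemma t_chain_above:
  "\<lbrakk>m + 1 < d + i; d \<le> m; i \<le> m; m < n; w \<in> V\<rbrakk> \<Longrightarrow> t i (chain m d w) = chain m d (t (i - 1) w)"
proof (induction d rule: less_induct)
  case (less d)
  then obtain d' where d: "d = Suc d'" by (cases d) auto
  show ?case
  proof (cases "m + 1 < d' + i")
    case True
    have "t i (t (m - d') (chain m d' w)) = t (m - d') (t i (chain m d' w))"
      using less.prems d True by (intro t_t') auto
    then show ?thesis using less.IH[of d'] less.prems d True by simp
  next
    case False
    then have i: "i + d' = m + 1" using less.prems d by simp
    then obtain d2 where d2: "d' = Suc d2" using less.prems by (cases d') auto
    define j where "j = m - d'"
    have j: "1 \<le> j" "Suc j < n" "i = Suc j" "m - d2 = Suc j"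
      using less.prems i d d2 by (auto simp: j_def)
    let ?X = "chain m d2 w"
    have "t (Suc j) (t j (t (Suc j) ?X)) = t j (t (Suc j) (t j ?X))"
      using j less.prems by (simp add: braid)
    also have "t j ?X = chain m d2 (t j w)"
      using j less.prems d2 by (intro t_chain_below) (auto simp: j_def)
    finally show ?thesis using j by (simp add: d d2 flip: j_def) (simp add: d2 j_def)
  qed
qed

text \<open>On a chain T_i either commutes, lengthens it, is absorbed by the quadratic relation, or
  passes through as T_(i-1). Clifford generators are handled by induction on the length, since the
  correction terms in their commutation with T_j involve shorter chains.\<close>

lemma span_chain_stable:
  fixes m X
  defines "S \<equiv> \<lambda>d. span (\<Union>d'\<le>d. chain m d' ` X)"
  assumes m: "m < n" and X: "X \<subseteq> V"
    and tX: "\<And>i w. \<lbrakk>1 \<le> i; i < m; w \<in> X\<rbrakk> \<Longrightarrow> t i w \<in> X"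
    and cX: "\<And>i w. \<lbrakk>1 \<le> i; i \<le> Suc m; w \<in> X\<rbrakk> \<Longrightarrow> c i w \<in> X"
  shows "\<lbrakk>1 \<le> i; i \<le> m; w \<in> S m\<rbrakk> \<Longrightarrow> t i w \<in> S m"
    and "\<lbrakk>1 \<le> i; i \<le> Suc m; w \<in> S m\<rbrakk> \<Longrightarrow> c i w \<in> S m"
proof -
  have base: "chain m d' w \<in> S d" if "d' \<le> d" "w \<in> X" for d d' w
    unfolding S_def using that by (intro span_base) auto
  have sub: "subspace (S d)" for d by (simp add: S_def)
  have SV: "S d \<subseteq> V" for d
    unfolding S_def using X V_subspace by (intro span_minimal) auto
  have ext: "f w \<in> S d2" if "w \<in> S d1" "\<And>d' w. \<lbrakk>d' \<le> d1; w \<in> X\<rbrakk> \<Longrightarrow> f (chain m d' w) \<in> S d2"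
    "\<And>x y. f (x + y) = f x + f y" "\<And>a x. f (a *s x) = a *s f x" for f d1 d2 w
    using that(1) unfolding S_def
  proof (induction rule: span_induct_alt)
    case base
    then show ?case using that(4)[of 0 0] by (simp add: span_zero)
  next
    case (step a x y)
    then show ?case using that(2)[unfolded S_def] that(3,4) span_add span_scale by fastforce
  qed
  have mono: "w \<in> S d'" if "w \<in> S d" "d \<le> d'" for w d d'
    using that unfolding S_def by (meson SUP_subset_mono atMost_subset_iff order_refl span_mono subsetD)
  have t_el: "t i (chain m d w) \<in> S (if i + d = m then Suc d else d)"
    if id: "1 \<le> i" "i \<le> m" "d \<le> m" "w \<in> X" for i d w
  proof -
    have wV: "w \<in> V" using X that by blast
    consider "i + d < m" | "i + d = m" | "i + d = m + 1" | "m + 1 < d + i" by linarith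
    then show ?thesis
    proof cases
      case 1
      then show ?thesis using t_chain_below[of i d m w] that m wV base[of d d "t i w"] tX[of i w] by simp
    next
      case 2
      then have "t i (chain m d w) = chain m (Suc d) w" by auto
      then show ?thesis using base[of "Suc d" "Suc d" w] that 2 by (simp del: chain.simps)
    next
      case 3
      then obtain d' where d': "d = Suc d'" "m - d' = i" using id 3 by (cases d) auto
      have "t i (chain m d w) = e *s chain m d w + chain m d' w"
        using d' that m wV by (simp add: t_sq)
      then show ?thesis using base[of d d w] base[of d' d w] that d' 3 sub
        by (simp add: subspace_add subspace_scale del: chain.simps)
    next
      case 4
      then show ?thesis using t_chain_above[of m d i w] that m wV base[of d d "t (i - 1) w"] tX[of "i - 1" w]
        by (simp add: add.commute)
    qed
  qed
  have tS: "t i w \<in> S m" if "1 \<le> i" "i \<le> m" "w \<in> S m" for i w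
    using that(3)
  proof (rule ext)
    show "t i (chain m d w) \<in> S m" if "d \<le> m" "w \<in> X" for d w
      using mono[OF t_el[of i d w], of m] that \<open>1 \<le> i\<close> \<open>i \<le> m\<close> by (auto split: if_splits)
  qed (simp_all add: lin)
  then show "\<lbrakk>1 \<le> i; i \<le> m; w \<in> S m\<rbrakk> \<Longrightarrow> t i w \<in> S m" .
  have c_el: "c i (chain m d w) \<in> S d" if "1 \<le> i" "i \<le> Suc m" "d \<le> m" "w \<in> X" for i d w
    using that
  proof (induction d arbitrary: i)
    case 0
    then show ?case using base[of 0 0 "c i w"] cX by simp
  next
    case (Suc d)
    define j where "j = m - d"
    have j: "1 \<le> j" "j < n" "j \<le> m" "j + d = m" using Suc.prems m by (auto simp: j_def)
    let ?Y = "chain m d w"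
    have Y: "?Y \<in> V" using X Suc.prems by auto
    have IH: "c i ?Y \<in> S d" if "1 \<le> i" "i \<le> Suc m" for i using Suc.IH[of i] that Suc.prems by simp
    have tj: "t j y \<in> S (Suc d)" if "y \<in> S d" for y
      using that
    proof (rule ext)
      show "t j (chain m d' w) \<in> S (Suc d)" if "d' \<le> d" "w \<in> X" for d' w
        using mono[OF t_el[of j d' w], of "Suc d"] that j by (auto split: if_splits)
    qed (simp_all add: lin)
    have up: "y \<in> S (Suc d)" if "y \<in> S d" for y using mono that by (metis le_SucI order_refl)
    consider "i = j" | "i = Suc j" | "i \<noteq> j" "i \<noteq> Suc j" by blast
    then show ?case
    proof cases
      case 1
      have "c j (t j ?Y) = t j (c (Suc j) ?Y) + e *s (c j ?Y - c (Suc j) ?Y)"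
        using j Y by (simp add: t_c_Suc)
      moreover have "t j (c (Suc j) ?Y) \<in> S (Suc d)" using IH[of "Suc j"] j by (intro tj) simp
      moreover have "c j ?Y \<in> S (Suc d)" "c (Suc j) ?Y \<in> S (Suc d)"
        using IH[of j] IH[of "Suc j"] j up by simp_all
      ultimately show ?thesis using sub[of "Suc d"] 1
        by (simp add: subspace_add subspace_diff subspace_scale flip: j_def)
    next
      case 2
      then show ?thesis using t_c[of j ?Y] j Y tj[OF IH[of j]] by (simp flip: j_def)
    next
      case 3
      then show ?thesis using t_c_other[of j i ?Y] j Y tj[OF IH[of i]] Suc.prems m by (simp flip: j_def)
    qed
  qed
  show "\<lbrakk>1 \<le> i; i \<le> Suc m; w \<in> S m\<rbrakk> \<Longrightarrow> c i w \<in> S m"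
    by (rule ext[of w m "c i"]) (auto simp: lin intro: mono[OF c_el])
qed

lemma chain_span_subset: "chain m d ` span B \<subseteq> span (chain m d ` B)"
proof
  fix x assume "x \<in> chain m d ` span B"
  then obtain w where w: "w \<in> span B" "x = chain m d w" by blast
  from w(1) have "chain m d w \<in> span (chain m d ` B)"
  proof (induction rule: span_induct_alt)
    case base
    then show ?case using chain_lin(2)[of m d 0 0] by (simp add: span_zero)
  next
    case (step a x y)
    then have "chain m d x \<in> span (chain m d ` B)" by (intro span_base) blast
    then show ?case using step by (simp add: chain_lin span_add span_scale)
  qed
  then show "x \<in> span (chain m d ` B)" by (simp add: w)
qed

text \<open>Finite dimension of an irreducible module is part of what has to be proved. Passing from
  m to m + 1, the spanning set is doubled by C_(m+1), which squares to 1, and then multiplied by the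
  chains.\<close>

lemma finite_generation:
  assumes v: "v \<in> V" and m: "m \<le> n"
  shows "\<exists>B. finite B \<and> B \<subseteq> V \<and> v \<in> span B \<and>
    (\<forall>i w. 1 \<le> i \<and> i < m \<and> w \<in> span B \<longrightarrow> t i w \<in> span B) \<and>
    (\<forall>i w. 1 \<le> i \<and> i \<le> m \<and> w \<in> span B \<longrightarrow> c i w \<in> span B)"
  using m
proof (induction m)
  case 0
  show ?case using v by (intro exI[of _ "{v}"]) (auto intro: span_base)
next
  case (Suc m)
  then obtain B where B: "finite B" "B \<subseteq> V" "v \<in> span B"
    "\<And>i w. \<lbrakk>1 \<le> i; i < m; w \<in> span B\<rbrakk> \<Longrightarrow> t i w \<in> span B"
    "\<And>i w. \<lbrakk>1 \<le> i; i \<le> m; w \<in> span B\<rbrakk> \<Longrightarrow> c i w \<in> span B" by auto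
  have spV: "span B \<subseteq> V" using B(2) V_subspace by (rule span_minimal)
  define B1 where "B1 = B \<union> c (Suc m) ` B"
  have B1V: "B1 \<subseteq> V" "finite B1" using B by (auto simp: B1_def)
  have B_B1: "span B \<subseteq> span B1" by (intro span_mono) (auto simp: B1_def)
  have sp1V: "span B1 \<subseteq> V" using B1V V_subspace by (intro span_minimal) auto
  have cB: "c (Suc m) w \<in> span B1" if "w \<in> span B" for w
    using that
  proof (induction rule: span_induct_alt)
    case base
    then show ?case by (simp add: lin span_zero)
  next
    case (step a x y)
    then have "c (Suc m) x \<in> span B1" by (intro span_base) (auto simp: B1_def)
    then show ?case using step by (simp add: lin span_add span_scale)
  qed
  have ext: "f w \<in> span B1" if "w \<in> span B1" "\<And>x. x \<in> B1 \<Longrightarrow> f x \<in> span B1"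
    "\<And>x y. f (x + y) = f x + f y" "\<And>a x. f (a *s x) = a *s f x" for f w
    using that(1)
  proof (induction rule: span_induct_alt)
    case base
    then show ?case using that(4)[of 0 0] by (simp add: span_zero)
  next
    case (step a x y)
    then show ?case by (auto simp: that intro!: span_add span_scale)
  qed
  have t1: "t i w \<in> span B1" if i: "1 \<le> i" "i < m" and w: "w \<in> span B1" for i w
    using w
  proof (rule ext)
    fix x assume "x \<in> B1"
    then consider "x \<in> B" | y where "y \<in> B" "x = c (Suc m) y" by (auto simp: B1_def)
    then show "t i x \<in> span B1"
    proof cases
      case 1
      then show ?thesis using B(4)[OF i] B_B1 span_base by blast
    next
      case 2
      have "t i x = c (Suc m) (t i y)" using 2 B(2) i Suc.prems by (auto simp: t_c_other)
      then show ?thesis using cB B(4)[OF i] 2 span_base by metis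
    qed
  qed (simp_all add: lin)
  have c1: "c i w \<in> span B1" if i: "1 \<le> i" "i \<le> Suc m" and w: "w \<in> span B1" for i w
    using w
  proof (rule ext)
    fix x assume "x \<in> B1"
    then consider "x \<in> B" | y where "y \<in> B" "x = c (Suc m) y" by (auto simp: B1_def)
    then show "c i x \<in> span B1"
    proof cases
      case 1
      then show ?thesis using B(5)[of i x] i cB B_B1 span_base le_SucE by blast
    next
      case 2
      show ?thesis
      proof (cases "i = Suc m")
        case True
        have "y \<in> V" using 2 B(2) by blast
        then have "c i x = y" using True 2 Suc.prems by (simp add: c_sq)
        then show ?thesis using 2 B_B1 span_base by blast
      next
        case False
        have "c i x = - c (Suc m) (c i y)" using False 2 B(2) i Suc.prems by (auto intro!: c_c)
        moreover have "c i y \<in> span B" using B(5)[of i y] False i 2 span_base by simp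
        ultimately show ?thesis using cB span_neg by metis
      qed
    qed
  qed (simp_all add: lin)
  define B' where "B' = (\<Union>d\<le>m. chain m d ` B1)"
  have S: "span (\<Union>d\<le>m. chain m d ` span B1) = span B'"
  proof (rule span_eq[THEN iffD2], intro conjI)
    show "(\<Union>d\<le>m. chain m d ` span B1) \<subseteq> span B'"
    proof (rule UN_least)
      fix d assume "d \<in> {..m}"
      then have "span (chain m d ` B1) \<subseteq> span B'" unfolding B'_def by (intro span_mono) auto
      then show "chain m d ` span B1 \<subseteq> span B'" using chain_span_subset by blast
    qed
    show "B' \<subseteq> span (\<Union>d\<le>m. chain m d ` span B1)"
      unfolding B'_def by (rule order_trans[OF _ span_superset]) (use span_superset in blast)
  qed
  have mn: "m < n" using Suc.prems by simp
  have "finite B'" "B' \<subseteq> V" using B1V by (auto simp: B'_def)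
  moreover have "v \<in> span B'"
  proof -
    have "B1 \<subseteq> B'" by (force simp: B'_def)
    then show ?thesis using B(3) B_B1 span_mono by blast
  qed
  moreover have "t i w \<in> span B'" if "1 \<le> i" "i < Suc m" "w \<in> span B'" for i w
    using span_chain_stable(1)[OF mn sp1V t1 c1, of i w] that S by auto
  moreover have "c i w \<in> span B'" if "1 \<le> i" "i \<le> Suc m" "w \<in> span B'" for i w
    using span_chain_stable(2)[OF mn sp1V t1 c1, of i w] that S by auto
  ultimately show ?case by (intro exI[of _ B']) auto
qed

end

section \<open>The quotient algebra and its generators\<close>

lemma relation_ideal_ideal: "ideal (relation_ideal n q) (free_ring n)"
  unfolding relation_ideal_def
  by (intro ring.genideal_ideal free_ring_ring relators_carrier)

lemma proj_hom: "proj n q \<in> ring_hom (free_ring n) (HC n q)"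
  using ideal.rcos_ring_hom[OF relation_ideal_ideal] unfolding HC_def proj_def .

lemma proj_closed: "x \<in> carrier (free_ring n) \<Longrightarrow> proj n q x \<in> carrier (HC n q)"
  using ring_hom_closed[OF proj_hom] .

lemma proj_mult: "\<lbrakk>x \<in> carrier (free_ring n); y \<in> carrier (free_ring n)\<rbrakk> \<Longrightarrow>
    proj n q (x * y) = proj n q x \<otimes>\<^bsub>HC n q\<^esub> proj n q y"
  using ring_hom_mult[OF proj_hom] by (simp add: free_ring_simps)

lemma proj_add: "\<lbrakk>x \<in> carrier (free_ring n); y \<in> carrier (free_ring n)\<rbrakk> \<Longrightarrow>
    proj n q (x + y) = proj n q x \<oplus>\<^bsub>HC n q\<^esub> proj n q y"
  using ring_hom_add[OF proj_hom] by (simp add: free_ring_simps)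

lemma proj_one: "proj n q 1 = \<one>\<^bsub>HC n q\<^esub>"
  using ring_hom_one[OF proj_hom] by (simp add: free_ring_simps)

lemma HC_carrierE:
  assumes "a \<in> carrier (HC n q)"
  obtains x where "x \<in> carrier (free_ring n)" "a = proj n q x"
  using assms by (auto simp: HC_def proj_def FactRing_def A_RCOSETS_defs a_r_coset_def)

lemma proj_eqI:
  assumes x: "x \<in> carrier (free_ring n)" and y: "y \<in> carrier (free_ring n)" and xy: "x - y \<in> relation_ideal n q"
  shows "proj n q x = proj n q y"
proof -
  interpret ideal "relation_ideal n q" "free_ring n" by (rule relation_ideal_ideal)
  have "x = (x - y) \<oplus>\<^bsub>free_ring n\<^esub> y" by (simp add: free_ring_simps)
  then have "x \<in> relation_ideal n q +>\<^bsub>free_ring n\<^esub> y"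
    using xy unfolding a_r_coset_def' by blast
  then show ?thesis
    unfolding proj_def using y a_repr_independence a_subgroup by (metis is_additive_subgroup)
qed

lemma relator_mem: "r \<in> relators n q \<Longrightarrow> r \<in> relation_ideal n q"
  unfolding relation_ideal_def
  using ring.genideal_self[OF free_ring_ring relators_carrier] by blast

lemma single_Cons: "Poly_Mapping.single (Word (g # ws)) a = var g * Poly_Mapping.single (Word ws) a"
  by (simp add: var_def mult_single plus_word_def)

lemma single_Nil: "Poly_Mapping.single (Word []) a = const a"
  by (simp add: const_def zero_word_def)

lemma update_eq_add:
  fixes f :: "'b \<Rightarrow>\<^sub>0 'a::comm_monoid_add"
  assumes "k \<notin> Poly_Mapping.keys f"
  shows "Poly_Mapping.update k a f = f + Poly_Mapping.single k a"
  using assms by (intro poly_mapping_eqI) (auto simp: lookup_update lookup_add lookup_single in_keys_iff when_def)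

lemma free_alg_induct [consumes 1, case_names zero single add]:
  fixes f :: "'a::field free_alg"
  assumes f: "f \<in> carrier (free_ring n)" and "P 0"
    and single: "\<And>ws a. set ws \<subseteq> gens n \<Longrightarrow> P (Poly_Mapping.single (Word ws) a)"
    and add: "\<And>x y. \<lbrakk>x \<in> carrier (free_ring n); y \<in> carrier (free_ring n); P x; P y\<rbrakk> \<Longrightarrow> P (x + y)"
  shows "P f"
  using f
proof (induction f rule: update_induct)
  case const
  show ?case by fact
next
  case (update f w b)
  have eq: "Poly_Mapping.update w b f = f + Poly_Mapping.single w b" using update.hyps(1) by (rule update_eq_add)
  have k: "Poly_Mapping.keys (Poly_Mapping.update w b f) = insert w (Poly_Mapping.keys f)"
    using update.hyps by (auto simp: in_keys_iff lookup_update split: if_splits)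
  have "f \<in> carrier (free_ring n)" using update.prems by (auto simp: free_ring_carrier_iff k)
  moreover have w: "set (letters w) \<subseteq> gens n" using update.prems by (auto simp: free_ring_carrier_iff k)
  moreover have "Poly_Mapping.single w b \<in> carrier (free_ring n)" using w by (auto simp: free_ring_carrier_iff)
  ultimately show ?case
    unfolding eq using update.IH single[of "letters w" b] add by simp
qed

lemma single_carrier: "set ws \<subseteq> gens n \<Longrightarrow> Poly_Mapping.single (Word ws) a \<in> carrier (free_ring n)"
  by (auto simp: free_ring_carrier_iff)

lemma parity_Cons: "parity (Word (g # ws)) = (case g of T i \<Rightarrow> 0 | C i \<Rightarrow> 1) + parity (Word ws)"
  by (cases g) (simp_all add: parity_def)

lemma parity_Nil: "parity (Word []) = 0"
  by (simp add: parity_def)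

lemma HC_part_var: "T i \<in> gens n \<Longrightarrow> HC_T n q i \<in> HC_part n q 0"
    "C i \<in> gens n \<Longrightarrow> HC_C n q i \<in> HC_part n q 1"
  unfolding HC_part_def
  by (intro imageI CollectI conjI free_ring_var; simp add: var_def parity_Cons parity_Nil)+

lemma HC_part_const: "HC_const n q a \<in> HC_part n q 0"
  unfolding HC_part_def
  by (intro imageI CollectI conjI free_ring_const) (simp add: const_def zero_word_def parity_Nil)

lemma T_gens: "T i \<in> gens n \<longleftrightarrow> 1 \<le> i \<and> i < n" and C_gens: "C i \<in> gens n \<longleftrightarrow> 1 \<le> i \<and> i \<le> n"
  by (auto simp: gens_def)

lemma const_mult: "const a * const b = const (a * b)" and const_add: "const a + const b = const (a + b)"
  and const_1: "const 1 = 1"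
  by (simp_all add: const_def mult_single single_add)

lemma const_commute: "x \<in> carrier (free_ring n) \<Longrightarrow> const a * x = x * const a"
proof (induction rule: free_alg_induct)
  case (single ws b)
  then show ?case by (simp add: const_def mult_single mult.commute)
qed (simp_all add: distrib_left distrib_right)

locale HC_left_module =
  fixes n :: nat and q :: "'a::field" and M :: "('a, 'v) HC_mod"
  assumes lm: "left_module (HC n q) M"
begin

interpretation left_module "HC n q" M by (rule lm)

definition act :: "'a free_alg \<Rightarrow> 'v \<Rightarrow> 'v" where
  "act x m = proj n q x \<odot>\<^bsub>M\<^esub> m"

lemma act_closed: "\<lbrakk>x \<in> carrier (free_ring n); m \<in> carrier M\<rbrakk> \<Longrightarrow> act x m \<in> carrier M"
  by (simp add: act_def smult_closed proj_closed)

lemma act_l_add: "\<lbrakk>x \<in> carrier (free_ring n); y \<in> carrier (free_ring n); m \<in> carrier M\<rbrakk> \<Longrightarrow>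
    act (x + y) m = act x m \<oplus>\<^bsub>M\<^esub> act y m"
  by (simp add: act_def proj_add smult_l_distr proj_closed)

lemma act_r_add: "\<lbrakk>x \<in> carrier (free_ring n); m \<in> carrier M; m' \<in> carrier M\<rbrakk> \<Longrightarrow>
    act x (m \<oplus>\<^bsub>M\<^esub> m') = act x m \<oplus>\<^bsub>M\<^esub> act x m'"
  by (simp add: act_def smult_r_distr proj_closed)

lemma act_mult: "\<lbrakk>x \<in> carrier (free_ring n); y \<in> carrier (free_ring n); m \<in> carrier M\<rbrakk> \<Longrightarrow>
    act (x * y) m = act x (act y m)"
  by (simp add: act_def proj_mult smult_assoc proj_closed)

lemma act_one: "m \<in> carrier M \<Longrightarrow> act 1 m = m"
  by (simp add: act_def proj_one smult_one)

lemma act_rel: "\<lbrakk>x - y \<in> relation_ideal n q; x \<in> carrier (free_ring n); y \<in> carrier (free_ring n)\<rbrakk> \<Longrightarrow>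
    act x m = act y m"
  using proj_eqI by (metis act_def)

lemma act_zero_right: "x \<in> carrier (free_ring n) \<Longrightarrow> act x \<zero>\<^bsub>M\<^esub> = \<zero>\<^bsub>M\<^esub>"
  using act_r_add[of x "\<zero>\<^bsub>M\<^esub>" "\<zero>\<^bsub>M\<^esub>"] act_closed[of x "\<zero>\<^bsub>M\<^esub>"] M.add.l_cancel_one by simp

lemma act_zero_left: "m \<in> carrier M \<Longrightarrow> act 0 m = \<zero>\<^bsub>M\<^esub>"
  using act_l_add[of 0 0 m] act_closed[of 0 m] M.add.l_cancel_one free_ring_zero by fastforce

lemma closed_under_act:
  assumes N: "N \<subseteq> carrier M" "\<zero>\<^bsub>M\<^esub> \<in> N" "\<And>x y. \<lbrakk>x \<in> N; y \<in> N\<rbrakk> \<Longrightarrow> x \<oplus>\<^bsub>M\<^esub> y \<in> N"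
    and cN: "\<And>a x. x \<in> N \<Longrightarrow> act (const a) x \<in> N"
    and vN: "\<And>g x. \<lbrakk>g \<in> gens n; x \<in> N\<rbrakk> \<Longrightarrow> act (var g) x \<in> N"
    and x: "x \<in> carrier (free_ring n)" and m: "m \<in> N"
  shows "act x m \<in> N"
  using x
proof (induction rule: free_alg_induct)
  case zero
  then show ?case using act_zero_left m N by auto
next
  case (single ws a)
  then show ?case
  proof (induction ws)
    case Nil
    then show ?case using cN m by (simp add: single_Nil)
  next
    case (Cons g ws)
    then show ?case using vN[of g "act (Poly_Mapping.single (Word ws) a) m"] N m
      by (simp add: single_Cons act_mult free_ring_var single_carrier subset_iff)
  qed
next
  case (add x y)
  then show ?case using N m by (auto simp: act_l_add)
qed

end

section \<open>Transport between modules and subspaces\<close>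

lemma (in vector_space) finite_basis:
  assumes "finite B" "V \<subseteq> span B"
  shows "\<exists>B'. finite B' \<and> B' \<subseteq> V \<and> independent B' \<and> V \<subseteq> span B'"
  using maximal_independent_subset[of V] independent_span_bound[OF assms(1)] assms(2)
  by (metis order_trans)

text \<open>A module carrier is a bare set in the type 'v. The map \<psi> identifies it with a
  subspace V of a type that is a vector space, where linear algebra is available.\<close>

locale hc_transport = hc_rep scale n q V t c + HC_left_module n q M
  for scale :: "'a::field \<Rightarrow> 'w::ab_group_add \<Rightarrow> 'w" (infixr "*s" 75)
    and n q V t c and M :: "('a, 'v) HC_mod" +
  fixes \<psi> :: "'w \<Rightarrow> 'v"
  assumes psi_bij: "bij_betw \<psi> V (carrier M)"
    and psi_add: "\<lbrakk>v \<in> V; w \<in> V\<rbrakk> \<Longrightarrow> \<psi> (v + w) = \<psi> v \<oplus>\<^bsub>M\<^esub> \<psi> w"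
    and psi_scale: "v \<in> V \<Longrightarrow> \<psi> (a *s v) = act (const a) (\<psi> v)"
    and psi_t: "\<lbrakk>1 \<le> i; i < n; v \<in> V\<rbrakk> \<Longrightarrow> \<psi> (t i v) = act (var (T i)) (\<psi> v)"
    and psi_c: "\<lbrakk>1 \<le> i; i \<le> n; v \<in> V\<rbrakk> \<Longrightarrow> \<psi> (c i v) = act (var (C i)) (\<psi> v)"
begin

sublocale lmod: left_module "HC n q" M by (rule lm)

lemma psi_mem: "v \<in> V \<Longrightarrow> \<psi> v \<in> carrier M"
  using psi_bij by (auto simp: bij_betw_def)

lemma psi_inj: "\<lbrakk>v \<in> V; w \<in> V\<rbrakk> \<Longrightarrow> \<psi> v = \<psi> w \<longleftrightarrow> v = w"
  using psi_bij by (auto simp: bij_betw_def inj_on_def)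

lemma psi_surj: "m \<in> carrier M \<Longrightarrow> \<exists>v\<in>V. m = \<psi> v"
  using psi_bij by (auto simp: bij_betw_def)

lemma psi_zero: "\<psi> 0 = \<zero>\<^bsub>M\<^esub>"
proof -
  have "\<psi> 0 \<oplus>\<^bsub>M\<^esub> \<psi> 0 = \<psi> 0" using psi_add[of 0 0] V_closed(1) by simp
  then show ?thesis using psi_mem[OF V_closed(1)] lmod.M.add.l_cancel_one by simp
qed

lemma psi_neg: "v \<in> V \<Longrightarrow> \<psi> (- v) = \<ominus>\<^bsub>M\<^esub> \<psi> v"
  using psi_add[of "- v" v] psi_zero psi_mem lmod.M.minus_equality[of "\<psi> (- v)" "\<psi> v"] by simp

lemma JM_carrier: "k \<le> n \<Longrightarrow> JM n q k \<in> carrier (HC n q)"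
proof (induction k)
  case (Suc k)
  show ?case
  proof (cases k)
    case (Suc j)
    then show ?thesis using Suc.IH Suc.prems
      by (auto intro!: ring.ring_simprules(1,5)[OF HC_ring] proj_closed free_ring_var free_ring_const simp: T_gens C_gens)
  qed (simp add: HC_ring ring.ring_simprules)
qed (simp add: HC_ring ring.ring_simprules)

lemma psi_L: "\<lbrakk>1 \<le> k; k \<le> n; v \<in> V\<rbrakk> \<Longrightarrow> \<psi> (L k v) = JM n q k \<odot>\<^bsub>M\<^esub> \<psi> v"
proof (induction k arbitrary: v)
  case (Suc k)
  interpret R: ring "HC n q" by (rule HC_ring)
  show ?case
  proof (cases k)
    case 0
    then show ?thesis using Suc psi_mem by (simp add: L_1 lmod.smult_one)
  next
    case (Suc k')
    have k: "1 \<le> k" "k < n" using Suc Suc.prems by simp_all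
    let ?x = "L k (t k v)"
    have cl: "HC_T n q k \<in> carrier (HC n q)" "HC_C n q k \<in> carrier (HC n q)"
      "HC_C n q (Suc k) \<in> carrier (HC n q)" "HC_const n q (eps q) \<in> carrier (HC n q)"
      using k by (auto intro!: proj_closed free_ring_var free_ring_const simp: T_gens C_gens)
    have x: "?x \<in> V" "\<psi> ?x = JM n q k \<odot>\<^bsub>M\<^esub> (HC_T n q k \<odot>\<^bsub>M\<^esub> \<psi> v)"
      using Suc.IH[of "t k v"] k Suc.prems psi_t[of k v] by (simp_all add: act_def)
    have "\<psi> (L (Suc k) v) = HC_T n q k \<odot>\<^bsub>M\<^esub> \<psi> ?x \<oplus>\<^bsub>M\<^esub>
        HC_const n q (eps q) \<odot>\<^bsub>M\<^esub> (HC_C n q k \<odot>\<^bsub>M\<^esub> (HC_C n q (Suc k) \<odot>\<^bsub>M\<^esub> \<psi> ?x))"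
      using k x by (simp add: L_Suc psi_add psi_scale psi_t psi_c act_def)
    then show ?thesis
      using cl x k Suc Suc.prems psi_mem[of v] psi_mem[of ?x] JM_carrier[of k]
      by (simp add: lmod.smult_assoc lmod.smult_l_distr lmod.smult_closed)
  qed
qed simp

lemma lin_subspace_image:
  assumes U: "subspace U" "U \<subseteq> V"
  shows "lin_subspace n q M (\<psi> ` U)"
  unfolding lin_subspace_def
proof (intro conjI allI ballI)
  show "subgroup (\<psi> ` U) (add_monoid M)"
  proof (rule group.subgroupI[OF lmod.M.a_group])
    show "inv\<^bsub>add_monoid M\<^esub> a \<in> \<psi> ` U" if a: "a \<in> \<psi> ` U" for a
    proof -
      obtain u where u: "u \<in> U" "a = \<psi> u" using a by blast
      then have "\<psi> (- u) = \<ominus>\<^bsub>M\<^esub> a" using U psi_neg by auto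
      then show ?thesis using u U subspace_neg by (metis a_inv_def imageI)
    qed
    show "a \<otimes>\<^bsub>add_monoid M\<^esub> b \<in> \<psi> ` U" if ab: "a \<in> \<psi> ` U" "b \<in> \<psi> ` U" for a b
    proof -
      obtain u v where "u \<in> U" "a = \<psi> u" "v \<in> U" "b = \<psi> v" using ab by blast
      moreover from this have "u \<in> V" "v \<in> V" using U by blast+
      ultimately have "\<psi> (u + v) = a \<oplus>\<^bsub>M\<^esub> b" "u + v \<in> U" using U psi_add subspace_add by simp_all
      then show ?thesis using imageI[of "u + v" U \<psi>] by simp
    qed
  qed (use U psi_mem subspace_0 in auto)
  fix a x assume "x \<in> \<psi> ` U"
  then obtain u where u: "u \<in> U" "x = \<psi> u" by blast
  then have "HC_const n q a \<odot>\<^bsub>M\<^esub> x = \<psi> (a *s u)" using U psi_scale by (auto simp: act_def)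
  then show "HC_const n q a \<odot>\<^bsub>M\<^esub> x \<in> \<psi> ` U" using u U subspace_scale by auto
qed

lemma lin_subspaceE:
  assumes W: "lin_subspace n q M W"
  obtains U where "subspace U" "U \<subseteq> V" "W = \<psi> ` U"
proof
  interpret W: subgroup W "add_monoid M" using W by (simp add: lin_subspace_def)
  let ?U = "{v \<in> V. \<psi> v \<in> W}"
  show "subspace ?U"
  proof (rule subspaceI)
    show "0 \<in> ?U" using W.one_closed psi_zero by (simp add: V_closed(1))
    show "x + y \<in> ?U" if "x \<in> ?U" "y \<in> ?U" for x y
      using W.m_closed that psi_add by simp
    show "a *s x \<in> ?U" if "x \<in> ?U" for a x
      using W that psi_scale by (simp add: lin_subspace_def act_def)
  qed
  show "W = \<psi> ` ?U" using W.subset psi_surj by (auto simp: image_iff)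
qed simp

lemma direct_sum_image:
  assumes "U \<subseteq> V" "U' \<subseteq> V"
  shows "direct_sum_of M (\<psi> ` U) (\<psi> ` U') \<longleftrightarrow> U \<inter> U' = {0} \<and> (\<forall>v\<in>V. \<exists>u\<in>U. \<exists>u'\<in>U'. v = u + u')"
proof -
  have "\<psi> ` U \<inter> \<psi> ` U' = \<psi> ` (U \<inter> U')" using psi_bij assms
    by (auto simp: bij_betw_def inj_on_def) (metis Int_iff imageI subset_iff)
  moreover have "\<psi> ` (U \<inter> U') = \<psi> ` {0} \<longleftrightarrow> U \<inter> U' = {0}"
    using psi_bij assms V_closed(1) by (intro inj_on_image_eq_iff[of _ V]) (auto simp: bij_betw_def)
  ultimately have 1: "\<psi> ` U \<inter> \<psi> ` U' = {\<zero>\<^bsub>M\<^esub>} \<longleftrightarrow> U \<inter> U' = {0}"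
    by (simp add: psi_zero)
  have "\<psi> ` U <+>\<^bsub>M\<^esub> \<psi> ` U' = (\<Union>u\<in>U. \<Union>u'\<in>U'. {\<psi> u \<oplus>\<^bsub>M\<^esub> \<psi> u'})"
    by (simp add: set_add_def')
  also have "\<dots> = (\<Union>u\<in>U. \<Union>u'\<in>U'. {\<psi> (u + u')})"
    using assms psi_add by (intro SUP_cong refl) (auto simp: subset_iff)
  also have "\<dots> = \<psi> ` {u + u' | u u'. u \<in> U \<and> u' \<in> U'}" by blast
  finally have "\<psi> ` U <+>\<^bsub>M\<^esub> \<psi> ` U' = \<psi> ` {u + u' | u u'. u \<in> U \<and> u' \<in> U'}" .
  moreover have "{u + u' | u u'. u \<in> U \<and> u' \<in> U'} \<subseteq> V" using assms V_closed(2) by blast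
  moreover have "carrier M = \<psi> ` V" using psi_bij by (simp add: bij_betw_def)
  ultimately have "\<psi> ` U <+>\<^bsub>M\<^esub> \<psi> ` U' = carrier M \<longleftrightarrow> {u + u' | u u'. u \<in> U \<and> u' \<in> U'} = V"
    using psi_bij by (metis (no_types, lifting) bij_betw_def inj_on_image_eq_iff order_refl)
  also have "\<dots> \<longleftrightarrow> V \<subseteq> {u + u' | u u'. u \<in> U \<and> u' \<in> U'}"
    using \<open>{u + u' | u u'. u \<in> U \<and> u' \<in> U'} \<subseteq> V\<close> by blast
  also have "\<dots> \<longleftrightarrow> (\<forall>v\<in>V. \<exists>u\<in>U. \<exists>u'\<in>U'. v = u + u')" by blast
  finally show ?thesis unfolding direct_sum_of_def 1 by blast
qed

lemma JM_invariant_image: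
  assumes "U \<subseteq> V" "1 \<le> k" "k \<le> n"
  shows "(\<forall>x\<in>\<psi> ` U. JM n q k \<odot>\<^bsub>M\<^esub> x \<in> \<psi> ` U) \<longleftrightarrow> (\<forall>u\<in>U. L k u \<in> U)"
proof -
  have "JM n q k \<odot>\<^bsub>M\<^esub> \<psi> u \<in> \<psi> ` U \<longleftrightarrow> L k u \<in> U" if "u \<in> U" for u
  proof -
    have "u \<in> V" using that assms(1) by blast
    then have "JM n q k \<odot>\<^bsub>M\<^esub> \<psi> u = \<psi> (L k u)" "L k u \<in> V" using psi_L[OF assms(2,3)] by simp_all
    then show ?thesis
      using inj_on_image_mem_iff[of \<psi> V "L k u" U] psi_bij assms(1) by (simp add: bij_betw_def)
  qed
  then show ?thesis by blast
qed

lemma acts_semisimply_iff: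
  assumes k: "1 \<le> k" "k \<le> n"
  shows "acts_semisimply n q M (JM n q k) \<longleftrightarrow>
    (\<forall>U. subspace U \<and> U \<subseteq> V \<and> (\<forall>u\<in>U. L k u \<in> U) \<longrightarrow>
      (\<exists>U'. subspace U' \<and> U' \<subseteq> V \<and> (\<forall>u\<in>U'. L k u \<in> U') \<and> U \<inter> U' = {0} \<and>
        (\<forall>v\<in>V. \<exists>u\<in>U. \<exists>u'\<in>U'. v = u + u')))"
    (is "?L \<longleftrightarrow> ?R")
proof
  assume L: ?L
  show ?R
  proof (intro allI impI)
    fix U assume U: "subspace U \<and> U \<subseteq> V \<and> (\<forall>u\<in>U. L k u \<in> U)"
    then have "lin_subspace n q M (\<psi> ` U) \<and> (\<forall>x\<in>\<psi> ` U. JM n q k \<odot>\<^bsub>M\<^esub> x \<in> \<psi> ` U)"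
      using lin_subspace_image[of U] JM_invariant_image[OF _ k, of U] by simp
    from L[unfolded acts_semisimply_def, rule_format, OF this]
    obtain W' where W': "lin_subspace n q M W'" "\<forall>x\<in>W'. JM n q k \<odot>\<^bsub>M\<^esub> x \<in> W'" "direct_sum_of M (\<psi> ` U) W'"
      by auto
    obtain U' where U': "subspace U'" "U' \<subseteq> V" "W' = \<psi> ` U'" using lin_subspaceE[OF W'(1)] .
    moreover have "\<forall>u\<in>U'. L k u \<in> U'" using JM_invariant_image[OF U'(2) k] W'(2) U'(3) by simp
    moreover have "U \<inter> U' = {0} \<and> (\<forall>v\<in>V. \<exists>u\<in>U. \<exists>u'\<in>U'. v = u + u')"
      using direct_sum_image[of U U'] W'(3) U U' by simp
    ultimately show "\<exists>U'. subspace U' \<and> U' \<subseteq> V \<and> (\<forall>u\<in>U'. L k u \<in> U') \<and> U \<inter> U' = {0} \<and>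
        (\<forall>v\<in>V. \<exists>u\<in>U. \<exists>u'\<in>U'. v = u + u')"
      by blast
  qed
next
  assume R: ?R
  show ?L
    unfolding acts_semisimply_def
  proof (intro allI impI)
    fix W assume W: "lin_subspace n q M W \<and> (\<forall>x\<in>W. JM n q k \<odot>\<^bsub>M\<^esub> x \<in> W)"
    obtain U where U: "subspace U" "U \<subseteq> V" "W = \<psi> ` U" using lin_subspaceE W by blast
    have "subspace U \<and> U \<subseteq> V \<and> (\<forall>u\<in>U. L k u \<in> U)"
      using JM_invariant_image[OF U(2) k] W U by simp
    from R[rule_format, OF this] obtain U' where U': "subspace U'" "U' \<subseteq> V" "\<forall>u\<in>U'. L k u \<in> U'"
      "U \<inter> U' = {0} \<and> (\<forall>v\<in>V. \<exists>u\<in>U. \<exists>u'\<in>U'. v = u + u')"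
      by auto
    moreover have "direct_sum_of M W (\<psi> ` U')" using direct_sum_image[of U U'] U U' by simp
    moreover have "\<forall>x\<in>\<psi> ` U'. JM n q k \<odot>\<^bsub>M\<^esub> x \<in> \<psi> ` U'"
      using JM_invariant_image[OF U'(2) k] U'(3) by simp
    ultimately show "\<exists>W'. lin_subspace n q M W' \<and> (\<forall>x\<in>W'. JM n q k \<odot>\<^bsub>M\<^esub> x \<in> W') \<and> direct_sum_of M W W'"
      using lin_subspace_image[of U'] by (intro exI[of _ "\<psi> ` U'"]) simp
  qed
qed

text \<open>Every invariant subspace has a complement spanned by eigenvectors, and such a complement
  is invariant.\<close>

lemma acts_semisimplyI:
  assumes k: "1 \<le> k" "k \<le> n" and sp: "V \<subseteq> span {v \<in> V. \<exists>a. L k v = a *s v}"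
  shows "acts_semisimply n q M (JM n q k)"
  unfolding acts_semisimply_iff[OF k]
proof (intro allI impI)
  let ?E = "{v \<in> V. \<exists>a. L k v = a *s v}"
  fix U assume U: "subspace U \<and> U \<subseteq> V \<and> (\<forall>u\<in>U. L k u \<in> U)"
  then obtain B where B: "B \<subseteq> ?E" "U \<inter> span B = {0}" "\<forall>v\<in>V. \<exists>w\<in>U. \<exists>u\<in>span B. v = w + u"
    using complement_spanned_by[OF V_subspace _ sp, of U] by blast
  have "L k u \<in> span B" if "u \<in> span B" for u
    using that
  proof (induction rule: span_induct_alt)
    case base
    then show ?case by (simp add: L_zero span_zero)
  next
    case (step a x y)
    then obtain b where "L k x = b *s x" using B by blast
    then show ?case using step by (simp add: lin_L span_add span_scale span_base)
  qed
  moreover have "span B \<subseteq> V" using B(1) V_subspace by (intro span_minimal) auto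
  ultimately show "\<exists>U'. subspace U' \<and> U' \<subseteq> V \<and> (\<forall>u\<in>U'. L k u \<in> U') \<and> U \<inter> U' = {0} \<and>
        (\<forall>v\<in>V. \<exists>u\<in>U. \<exists>u'\<in>U'. v = u + u')"
    using B by (intro exI[of _ "span B"]) auto
qed

lemma finite_dimI:
  assumes "finite B" "V \<subseteq> span B"
  shows "finite_dim n q M"
proof -
  obtain B' where B': "finite B'" "B' \<subseteq> V" "V \<subseteq> span B'" using finite_basis[OF assms] by blast
  have "W = carrier M" if W: "lin_subspace n q M W" "\<psi> ` B' \<subseteq> W" for W
  proof -
    obtain U where U: "subspace U" "U \<subseteq> V" "W = \<psi> ` U" using lin_subspaceE[OF W(1)] .
    have "B' \<subseteq> U"
    proof
      fix x assume x: "x \<in> B'"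
      then obtain u where "u \<in> U" "\<psi> x = \<psi> u" using W(2) U(3) by blast
      then show "x \<in> U" using psi_inj x B'(2) U(2) by blast
    qed
    then have "V \<subseteq> U" using B'(3) span_minimal[OF _ U(1)] by blast
    then show ?thesis using U psi_bij by (auto simp: bij_betw_def)
  qed
  then show ?thesis using B' psi_mem unfolding finite_dim_def
    by (intro exI[of _ "\<psi> ` B'"]) auto
qed

lemma submodule_image:
  assumes U: "subspace U" "U \<subseteq> V"
    and tU: "\<And>i u. \<lbrakk>1 \<le> i; i < n; u \<in> U\<rbrakk> \<Longrightarrow> t i u \<in> U"
    and cU: "\<And>i u. \<lbrakk>1 \<le> i; i \<le> n; u \<in> U\<rbrakk> \<Longrightarrow> c i u \<in> U"
  shows "submodule (\<psi> ` U) (HC n q) M"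
proof (intro submodule.intro submodule_axioms.intro)
  show sg: "subgroup (\<psi> ` U) (add_monoid M)" using lin_subspace_image[OF U] by (simp add: lin_subspace_def)
  fix a x assume a: "a \<in> carrier (HC n q)" and x: "x \<in> \<psi> ` U"
  obtain y where y: "y \<in> carrier (free_ring n)" "a = proj n q y" using a by (rule HC_carrierE)
  have "act y x \<in> \<psi> ` U"
  proof (rule closed_under_act[OF _ _ _ _ _ y(1) x])
    show "\<psi> ` U \<subseteq> carrier M" using U psi_mem by auto
    show "\<zero>\<^bsub>M\<^esub> \<in> \<psi> ` U" using psi_zero U subspace_0 by (metis imageI)
    show "x \<oplus>\<^bsub>M\<^esub> y \<in> \<psi> ` U" if "x \<in> \<psi> ` U" "y \<in> \<psi> ` U" for x y
      using subgroup.m_closed[OF sg] that by simp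
    show "act (const b) x \<in> \<psi> ` U" if "x \<in> \<psi> ` U" for b x
      using lin_subspace_image[OF U] that by (auto simp: lin_subspace_def act_def)
    show "act (var g) x \<in> \<psi> ` U" if g: "g \<in> gens n" and x: "x \<in> \<psi> ` U" for g x
    proof -
      obtain u where u: "u \<in> U" "x = \<psi> u" using x by blast
      show ?thesis
      proof (cases g)
        case (T i)
        then have "act (var g) x = \<psi> (t i u)" using g u U psi_t by (auto simp: T_gens)
        then show ?thesis using T g tU u by (auto simp: T_gens)
      next
        case (C i)
        then have "act (var g) x = \<psi> (c i u)" using g u U psi_c by (auto simp: C_gens)
        then show ?thesis using C g cU u by (auto simp: C_gens)
      qed
    qed
  qed
  then show "a \<odot>\<^bsub>M\<^esub> x \<in> \<psi> ` U" by (simp add: act_def y)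
qed

end

text \<open>Serves to extend operators given on V to linear maps on the whole type, as
  \<open>hc_rep\<close> demands.\<close>

lemma (in vector_space) linear_projection_exists:
  assumes V: "subspace V"
  shows "\<exists>\<pi>. (\<forall>x y. \<pi> (x + y) = \<pi> x + \<pi> y) \<and> (\<forall>a x. \<pi> (scale a x) = scale a (\<pi> x)) \<and>
    (\<forall>x. \<pi> x \<in> V) \<and> (\<forall>x\<in>V. \<pi> x = x)"
proof -
  obtain U where U: "subspace U" "V \<inter> U = {0}" "\<And>x. \<exists>v\<in>V. \<exists>u\<in>U. x = v + u"
    using complement_exists[OF subspace_UNIV V] by auto
  define \<pi> where "\<pi> x = (SOME v. v \<in> V \<and> x - v \<in> U)" for x
  have \<pi>: "\<pi> x \<in> V \<and> x - \<pi> x \<in> U" for x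
    unfolding \<pi>_def
  proof (rule someI_ex)
    obtain v u where "v \<in> V" "u \<in> U" "x = v + u" using U(3) by blast
    then show "\<exists>v. v \<in> V \<and> x - v \<in> U" by (intro exI[of _ v]) simp
  qed
  have unique: "\<pi> x = v" if v: "v \<in> V" "x - v \<in> U" for x v
  proof -
    have "\<pi> x - v \<in> V" using \<pi> v V subspace_diff by blast
    moreover have "(x - v) - (x - \<pi> x) \<in> U" using \<pi> v U(1) subspace_diff by blast
    ultimately have "\<pi> x - v \<in> V \<inter> U" by simp
    then show ?thesis using U(2) by simp
  qed
  have "\<pi> (x + y) = \<pi> x + \<pi> y" for x y
  proof (rule unique)
    have "(x - \<pi> x) + (y - \<pi> y) \<in> U" using \<pi> U(1) subspace_add by blast
    then show "x + y - (\<pi> x + \<pi> y) \<in> U" by (simp add: algebra_simps)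
  qed (use \<pi> V subspace_add in blast)
  moreover have "\<pi> (scale a x) = scale a (\<pi> x)" for a x
  proof (rule unique)
    have "scale a (x - \<pi> x) \<in> U" using \<pi> U(1) subspace_scale by blast
    then show "scale a x - scale a (\<pi> x) \<in> U" by (simp add: scale_right_diff_distrib)
  qed (use \<pi> V subspace_scale in blast)
  moreover have "\<pi> x = x" if "x \<in> V" for x using unique[OF that] U(1) subspace_0 by simp
  ultimately show ?thesis using \<pi> by blast
qed

lemma relators_mem:
  fixes q :: "'a::field"
  shows "\<lbrakk>1 \<le> i; i < n\<rbrakk> \<Longrightarrow> var (T i) * var (T i) - (const (eps q) * var (T i) + 1) \<in> relators n q"
    and "\<lbrakk>1 \<le> i; i < n; 1 \<le> j; j < n; Suc i < j\<rbrakk> \<Longrightarrow>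
      var (T i) * var (T j) - var (T j) * var (T i) \<in> relators n q"
    and "\<lbrakk>1 \<le> i; Suc i < n\<rbrakk> \<Longrightarrow> var (T i) * var (T (Suc i)) * var (T i) -
      var (T (Suc i)) * var (T i) * var (T (Suc i)) \<in> relators n q"
    and "\<lbrakk>1 \<le> i; i \<le> n\<rbrakk> \<Longrightarrow> var (C i) * var (C i) - 1 \<in> relators n q"
    and "\<lbrakk>1 \<le> i; i \<le> n; 1 \<le> j; j \<le> n; i \<noteq> j\<rbrakk> \<Longrightarrow>
      var (C i) * var (C j) - (- (var (C j) * var (C i))) \<in> relators n q"
    and "\<lbrakk>1 \<le> i; i < n\<rbrakk> \<Longrightarrow> var (T i) * var (C i) - var (C (Suc i)) * var (T i) \<in> relators n q"
    and "\<lbrakk>1 \<le> i; i < n\<rbrakk> \<Longrightarrow> var (T i) * var (C (Suc i)) -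
      (var (C i) * var (T i) - const (eps q) * (var (C i) - var (C (Suc i)))) \<in> relators n q"
    and "\<lbrakk>1 \<le> i; i < n; 1 \<le> j; j \<le> n; j \<noteq> i; j \<noteq> Suc i\<rbrakk> \<Longrightarrow>
      var (T i) * var (C j) - var (C j) * var (T i) \<in> relators n q"
  unfolding relators_def Let_def Un_iff mem_Collect_eq Suc_eq_plus1
  subgoal by (intro disjI1 exI[of _ i] conjI refl) auto
  subgoal by (rule disjI1, rule disjI1, rule disjI1, rule disjI1, rule disjI1, rule disjI1, rule disjI2, intro exI[of _ i] exI[of _ j] conjI refl) auto
  subgoal by (rule disjI1, rule disjI1, rule disjI1, rule disjI1, rule disjI1, rule disjI2, intro exI[of _ i] conjI refl) auto
  subgoal by (rule disjI1, rule disjI1, rule disjI1, rule disjI1, rule disjI2, intro exI[of _ i] conjI refl) auto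
  subgoal by (rule disjI1, rule disjI1, rule disjI1, rule disjI2, intro exI[of _ i] exI[of _ j] conjI refl) auto
  subgoal by (rule disjI1, rule disjI1, rule disjI2, intro exI[of _ i] conjI refl) auto
  subgoal by (rule disjI1, rule disjI2, intro exI[of _ i] conjI refl) auto
  subgoal by (rule disjI2, intro exI[of _ i] exI[of _ j] conjI refl) auto
  done

text \<open>Outside the index range the operators are set to the identity, because
  \<open>hc_rep\<close> asks for linearity and closure at every index.\<close>

lemma hc_rep_of_representation:
  fixes scale :: "'a::field \<Rightarrow> 'w::ab_group_add \<Rightarrow> 'w" (infixr "*s" 75) and op and n :: nat and q
  defines "R \<equiv> carrier (free_ring n) :: 'a free_alg set"
  assumes vs: "vector_space scale" and V: "module.subspace scale V"
    and two: "(2 :: 'a) \<noteq> 0" and eps: "eps q \<noteq> 0"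
    and op_lin: "\<And>x v w. x \<in> R \<Longrightarrow> op x (v + w) = op x v + op x w"
      "\<And>x a v. x \<in> R \<Longrightarrow> op x (a *s v) = a *s op x v"
    and op_closed: "\<And>x v. \<lbrakk>x \<in> R; v \<in> V\<rbrakk> \<Longrightarrow> op x v \<in> V"
    and op_add: "\<And>x y v. \<lbrakk>x \<in> R; y \<in> R; v \<in> V\<rbrakk> \<Longrightarrow> op (x + y) v = op x v + op y v"
    and op_mult: "\<And>x y v. \<lbrakk>x \<in> R; y \<in> R; v \<in> V\<rbrakk> \<Longrightarrow> op (x * y) v = op x (op y v)"
    and op_const: "\<And>a v. v \<in> V \<Longrightarrow> op (const a) v = a *s v"
    and op_rel: "\<And>x y v. \<lbrakk>x - y \<in> relators n q; x \<in> R; y \<in> R; v \<in> V\<rbrakk> \<Longrightarrow> op x v = op y v"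
  shows "hc_rep scale n q V (\<lambda>i. if 1 \<le> i \<and> i < n then op (var (T i)) else id)
    (\<lambda>i. if 1 \<le> i \<and> i \<le> n then op (var (C i)) else id)"
proof -
  interpret vector_space scale by (rule vs)
  have T: "1 \<le> i \<Longrightarrow> i < n \<Longrightarrow> var (T i) \<in> R" and C: "1 \<le> i \<Longrightarrow> i \<le> n \<Longrightarrow> var (C i) \<in> R" for i
    by (auto simp: R_def T_gens C_gens intro!: free_ring_var)
  have R_cl: "x \<in> R \<Longrightarrow> - x \<in> R" "x \<in> R \<Longrightarrow> y \<in> R \<Longrightarrow> x + y \<in> R" "x \<in> R \<Longrightarrow> y \<in> R \<Longrightarrow> x - y \<in> R"
    "x \<in> R \<Longrightarrow> y \<in> R \<Longrightarrow> x * y \<in> R" for x y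
    by (simp_all add: R_def free_ring_uminus free_ring_add free_ring_diff free_ring_mult)
  have R1: "(1 :: 'a free_alg) \<in> R" and Rc: "const a \<in> R" for a :: 'a
    by (simp_all add: R_def free_ring_one free_ring_const)
  have op_1: "op 1 v = v" if "v \<in> V" for v using op_const[OF that, of 1] by (simp add: const_1)
  have op_neg: "op (- x) v = - op x v" if "x \<in> R" "v \<in> V" for x v
  proof -
    have "const (- 1) + 1 = (0 :: 'a free_alg)"
      using const_add[of "-1" "1 :: 'a"] by (simp add: const_1) (simp add: const_def)
    then have "const (- 1) = (- 1 :: 'a free_alg)" by (simp add: eq_neg_iff_add_eq_0)
    then have "- x = const (- 1) * x" by simp
    then show ?thesis using that op_mult[of "const (- 1)" x v] op_const[of "op x v" "- 1"] op_closed[of x v] Rc by simp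
  qed
  have op_diff: "op (x - y) v = op x v - op y v" if "x \<in> R" "y \<in> R" "v \<in> V" for x y v
    using op_add[of x "- y" v] op_neg[of y v] that R_cl(1) by simp
  note ops = op_add op_mult op_const op_1 op_neg op_diff op_closed op_lin
  show ?thesis
  proof unfold_locales
    fix i j w
    show "1 \<le> i \<Longrightarrow> i < n \<Longrightarrow> w \<in> V \<Longrightarrow>
      (if 1 \<le> i \<and> i < n then op (var (T i)) else id) ((if 1 \<le> i \<and> i < n then op (var (T i)) else id) w)
      = eps q *s (if 1 \<le> i \<and> i < n then op (var (T i)) else id) w + w"
      using op_rel[OF relators_mem(1)[of i n q], of w] T[of i] by (simp add: ops R_cl R1 Rc)
    show "1 \<le> i \<Longrightarrow> Suc i < j \<Longrightarrow> j < n \<Longrightarrow> w \<in> V \<Longrightarrow>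
      (if 1 \<le> i \<and> i < n then op (var (T i)) else id) ((if 1 \<le> j \<and> j < n then op (var (T j)) else id) w)
      = (if 1 \<le> j \<and> j < n then op (var (T j)) else id) ((if 1 \<le> i \<and> i < n then op (var (T i)) else id) w)"
      using op_rel[OF relators_mem(2)[of i n j q], of w] T[of i] T[of j] by (simp add: ops R_cl R1 Rc)
    show "1 \<le> i \<Longrightarrow> Suc i < n \<Longrightarrow> w \<in> V \<Longrightarrow>
      (if 1 \<le> i \<and> i < n then op (var (T i)) else id)
        ((if 1 \<le> Suc i \<and> Suc i < n then op (var (T (Suc i))) else id)
          ((if 1 \<le> i \<and> i < n then op (var (T i)) else id) w))
      = (if 1 \<le> Suc i \<and> Suc i < n then op (var (T (Suc i))) else id)
        ((if 1 \<le> i \<and> i < n then op (var (T i)) else id)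
          ((if 1 \<le> Suc i \<and> Suc i < n then op (var (T (Suc i))) else id) w))"
      using op_rel[OF relators_mem(3)[of i n q], of w] T[of i] T[of "Suc i"] by (simp add: ops R_cl R1 Rc)
    show "1 \<le> i \<Longrightarrow> i \<le> n \<Longrightarrow> w \<in> V \<Longrightarrow>
      (if 1 \<le> i \<and> i \<le> n then op (var (C i)) else id) ((if 1 \<le> i \<and> i \<le> n then op (var (C i)) else id) w) = w"
      using op_rel[OF relators_mem(4)[of i n q], of w] C[of i] by (simp add: ops R_cl R1 Rc)
    show "1 \<le> i \<Longrightarrow> i \<le> n \<Longrightarrow> 1 \<le> j \<Longrightarrow> j \<le> n \<Longrightarrow> i \<noteq> j \<Longrightarrow> w \<in> V \<Longrightarrow>
      (if 1 \<le> i \<and> i \<le> n then op (var (C i)) else id) ((if 1 \<le> j \<and> j \<le> n then op (var (C j)) else id) w)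
      = - (if 1 \<le> j \<and> j \<le> n then op (var (C j)) else id) ((if 1 \<le> i \<and> i \<le> n then op (var (C i)) else id) w)"
      using op_rel[OF relators_mem(5)[of i n j q], of w] C[of i] C[of j] by (simp add: ops R_cl R1 Rc)
    show "1 \<le> i \<Longrightarrow> i < n \<Longrightarrow> w \<in> V \<Longrightarrow>
      (if 1 \<le> i \<and> i < n then op (var (T i)) else id) ((if 1 \<le> i \<and> i \<le> n then op (var (C i)) else id) w)
      = (if 1 \<le> Suc i \<and> Suc i \<le> n then op (var (C (Suc i))) else id)
        ((if 1 \<le> i \<and> i < n then op (var (T i)) else id) w)"
      using op_rel[OF relators_mem(6)[of i n q], of w] T[of i] C[of i] C[of "Suc i"] by (simp add: ops R_cl R1 Rc)
    show "1 \<le> i \<Longrightarrow> i < n \<Longrightarrow> w \<in> V \<Longrightarrow>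
      (if 1 \<le> i \<and> i < n then op (var (T i)) else id) ((if 1 \<le> Suc i \<and> Suc i \<le> n then op (var (C (Suc i))) else id) w)
      = (if 1 \<le> i \<and> i \<le> n then op (var (C i)) else id) ((if 1 \<le> i \<and> i < n then op (var (T i)) else id) w)
        - eps q *s ((if 1 \<le> i \<and> i \<le> n then op (var (C i)) else id) w -
          (if 1 \<le> Suc i \<and> Suc i \<le> n then op (var (C (Suc i))) else id) w)"
      using op_rel[OF relators_mem(7)[of i n q], of w] T[of i] C[of i] C[of "Suc i"]
      by (simp add: ops R_cl R1 Rc V subspace_diff)
    show "1 \<le> i \<Longrightarrow> i < n \<Longrightarrow> 1 \<le> j \<Longrightarrow> j \<le> n \<Longrightarrow> j \<noteq> i \<Longrightarrow> j \<noteq> Suc i \<Longrightarrow> w \<in> V \<Longrightarrow>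
      (if 1 \<le> i \<and> i < n then op (var (T i)) else id) ((if 1 \<le> j \<and> j \<le> n then op (var (C j)) else id) w)
      = (if 1 \<le> j \<and> j \<le> n then op (var (C j)) else id) ((if 1 \<le> i \<and> i < n then op (var (T i)) else id) w)"
      using op_rel[OF relators_mem(8)[of i n j q], of w] T[of i] C[of j] by (simp add: ops R_cl R1 Rc)
  qed (use V two eps T C in \<open>simp_all add: ops\<close>)
qed

section \<open>Irreducible modules as subspaces of the free algebra\<close>

lemma free_alg_vector_space: "vector_space (\<lambda>a (x :: 'a::field free_alg). const a * x)"
  by unfold_locales (simp_all add: distrib_left distrib_right const_add[symmetric] const_mult[symmetric]
      const_1 mult.assoc)

lemma free_alg_homogeneous_parts:
  assumes "x \<in> carrier (free_ring n)"
  shows "\<exists>x0 x1. x0 \<in> carrier (free_ring n) \<and> x1 \<in> carrier (free_ring n) \<and> x = x0 + x1 \<and>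
    proj n q x0 \<in> HC_part n q 0 \<and> proj n q x1 \<in> HC_part n q 1"
proof -
  have "\<exists>x0 x1. x0 \<in> carrier (free_ring n) \<and> x1 \<in> carrier (free_ring n) \<and> x = x0 + x1 \<and>
    (\<forall>w\<in>Poly_Mapping.keys x0. parity w = 0) \<and> (\<forall>w\<in>Poly_Mapping.keys x1. parity w = 1)"
    using assms
  proof (induction rule: free_alg_induct)
    case zero
    show ?case by (intro exI[of _ 0]) (simp add: free_ring_zero)
  next
    case (single ws a)
    show ?case
    proof (cases "parity (Word ws) = 0")
      case True
      then show ?thesis using single
        by (intro exI[of _ "Poly_Mapping.single (Word ws) a"] exI[of _ 0])
          (auto simp: free_ring_zero single_carrier split: if_splits)
    next
      case False
      then have "parity (Word ws) = 1" by (metis bit_not_zero_iff)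
      then show ?thesis using single
        by (intro exI[of _ 0] exI[of _ "Poly_Mapping.single (Word ws) a"])
          (auto simp: free_ring_zero single_carrier split: if_splits)
    qed
  next
    case (add x y)
    then obtain x0 x1 y0 y1 where
      "x0 \<in> carrier (free_ring n)" "x1 \<in> carrier (free_ring n)" "x = x0 + x1"
      "\<forall>w\<in>Poly_Mapping.keys x0. parity w = 0" "\<forall>w\<in>Poly_Mapping.keys x1. parity w = 1"
      "y0 \<in> carrier (free_ring n)" "y1 \<in> carrier (free_ring n)" "y = y0 + y1"
      "\<forall>w\<in>Poly_Mapping.keys y0. parity w = 0" "\<forall>w\<in>Poly_Mapping.keys y1. parity w = 1" by blast
    then show ?case
      using Poly_Mapping.keys_add[of x0 y0] Poly_Mapping.keys_add[of x1 y1]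
      by (intro exI[of _ "x0 + y0"] exI[of _ "x1 + y1"]) (auto simp: free_ring_add algebra_simps)
  qed
  then obtain x0 x1 where x: "x0 \<in> carrier (free_ring n)" "x1 \<in> carrier (free_ring n)" "x = x0 + x1"
    "\<forall>w\<in>Poly_Mapping.keys x0. parity w = 0" "\<forall>w\<in>Poly_Mapping.keys x1. parity w = 1" by blast
  then have "proj n q x0 \<in> HC_part n q 0" "proj n q x1 \<in> HC_part n q 1"
    unfolding HC_part_def by blast+
  then show ?thesis using x by blast
qed

locale irreducible_module =
  fixes n :: nat and q :: "'a::field" and M :: "('a, 'v) HC_mod"
  assumes irr: "irreducible_HC_module n q M"
begin

lemma HC_mod: "HC_module n q M"
  using irr by (simp add: irreducible_HC_module_def)

sublocale HC_left_module n q M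
  using HC_mod by (intro HC_left_module.intro) (simp add: HC_module_def)

interpretation lmod: left_module "HC n q" M by (rule lm)

lemma part_subgroup: "subgroup (part M r) (add_monoid M)"
  using HC_mod by (simp add: HC_module_def)

lemma part_carrier: "x \<in> part M r \<Longrightarrow> x \<in> carrier M"
  using subgroup.mem_carrier[OF part_subgroup] by simp

lemma part_add: "\<lbrakk>x \<in> part M r; y \<in> part M r\<rbrakk> \<Longrightarrow> x \<oplus>\<^bsub>M\<^esub> y \<in> part M r"
  using subgroup.m_closed[OF part_subgroup] by simp

lemma part_zero: "\<zero>\<^bsub>M\<^esub> \<in> part M r"
  using subgroup.one_closed[OF part_subgroup] by simp

lemma part_act: "\<lbrakk>proj n q x \<in> HC_part n q p; m \<in> part M r\<rbrakk> \<Longrightarrow> act x m \<in> part M (p + r)"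
  using HC_mod by (simp add: HC_module_def act_def)

lemma part_sum: "m \<in> carrier M \<Longrightarrow> \<exists>m0\<in>part M 0. \<exists>m1\<in>part M 1. m = m0 \<oplus>\<^bsub>M\<^esub> m1"
  using HC_mod by (auto simp: HC_module_def direct_sum_of_def set_add_def' set_eq_iff)

lemma part_inter: "\<lbrakk>m \<in> part M 0; m \<in> part M 1\<rbrakk> \<Longrightarrow> m = \<zero>\<^bsub>M\<^esub>"
  using HC_mod by (auto simp: HC_module_def direct_sum_of_def)

lemma irreducibleD:
  assumes N: "submodule N (HC n q) M"
    and gr: "\<And>x. x \<in> N \<Longrightarrow> \<exists>x0\<in>N \<inter> part M 0. \<exists>x1\<in>N \<inter> part M 1. x = x0 \<oplus>\<^bsub>M\<^esub> x1"
    and "x \<in> N" "x \<noteq> \<zero>\<^bsub>M\<^esub>"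
  shows "N = carrier M"
proof -
  have "subgroup N (add_monoid M)" using N by (simp add: submodule_def)
  then have "x0 \<oplus>\<^bsub>M\<^esub> x1 \<in> N" if "x0 \<in> N" "x1 \<in> N" for x0 x1
    using subgroup.m_closed that by fastforce
  then have "N = (N \<inter> part M 0) <+>\<^bsub>M\<^esub> (N \<inter> part M 1)"
    using gr by (fastforce simp: set_add_def')
  then have "graded_submodule n q M N" using N by (simp add: graded_submodule_def)
  then show ?thesis using irr assms(3,4) by (auto simp: irreducible_HC_module_def)
qed

lemma homogeneous_vector: "\<exists>p m. m \<in> part M p \<and> m \<noteq> \<zero>\<^bsub>M\<^esub>"
proof -
  have "carrier M \<noteq> {\<zero>\<^bsub>M\<^esub>}" using irr by (simp add: irreducible_HC_module_def)
  then obtain m where m: "m \<in> carrier M" "m \<noteq> \<zero>\<^bsub>M\<^esub>" using lmod.M.zero_closed by blast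
  then obtain m0 m1 where "m0 \<in> part M 0" "m1 \<in> part M 1" "m = m0 \<oplus>\<^bsub>M\<^esub> m1" using part_sum by blast
  then show ?thesis using m lmod.M.zero_closed lmod.M.l_zero by metis
qed

text \<open>Homogeneity of m0 makes the orbit graded: the even and odd parts of x send m0 to the two
  homogeneous parts of x m0.\<close>

lemma cyclic:
  assumes m0: "m0 \<in> part M p" "m0 \<noteq> \<zero>\<^bsub>M\<^esub>"
  shows "{act x m0 | x. x \<in> carrier (free_ring n)} = carrier M"
proof (rule irreducibleD[where x = m0])
  let ?N = "{act x m0 | x. x \<in> carrier (free_ring n)}"
  have mc: "m0 \<in> carrier M" using m0 part_carrier by blast
  show "m0 \<in> ?N" using act_one[OF mc] free_ring_one by (intro CollectI exI[of _ 1]) simp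
  show "m0 \<noteq> \<zero>\<^bsub>M\<^esub>" by fact
  show "submodule ?N (HC n q) M"
  proof (intro submodule.intro submodule_axioms.intro)
    show "subgroup ?N (add_monoid M)"
    proof (rule group.subgroupI[OF lmod.M.a_group])
      show "?N \<noteq> {}" using \<open>m0 \<in> ?N\<close> by blast
      show "?N \<subseteq> carrier (add_monoid M)" using act_closed mc by auto
      show "a \<otimes>\<^bsub>add_monoid M\<^esub> b \<in> ?N" if ab: "a \<in> ?N" "b \<in> ?N" for a b
      proof -
        obtain x y where x: "x \<in> carrier (free_ring n)" "a = act x m0"
          and y: "y \<in> carrier (free_ring n)" "b = act y m0" using ab by blast
        then have "a \<oplus>\<^bsub>M\<^esub> b = act (x + y) m0" using act_l_add mc by simp
        then show ?thesis using x y free_ring_add by (auto intro!: exI[of _ "x + y"])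
      qed
      show "inv\<^bsub>add_monoid M\<^esub> a \<in> ?N" if a: "a \<in> ?N" for a
      proof -
        obtain x where x: "x \<in> carrier (free_ring n)" "a = act x m0" using a by blast
        have "act (- x) m0 \<oplus>\<^bsub>M\<^esub> act x m0 = \<zero>\<^bsub>M\<^esub>"
          using act_l_add[of "- x" x m0, symmetric] x mc act_zero_left free_ring_uminus[OF x(1)] by simp
        then have "\<ominus>\<^bsub>M\<^esub> a = act (- x) m0"
          using lmod.M.minus_equality x mc act_closed free_ring_uminus by metis
        then show ?thesis using x free_ring_uminus by (auto simp: a_inv_def)
      qed
    qed
    fix a x assume a: "a \<in> carrier (HC n q)" and x: "x \<in> ?N"
    obtain y where y: "y \<in> carrier (free_ring n)" "a = proj n q y" using a by (rule HC_carrierE)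
    obtain z where z: "z \<in> carrier (free_ring n)" "x = act z m0" using x by blast
    have "a \<odot>\<^bsub>M\<^esub> x = act (y * z) m0" using y z mc act_mult by (simp add: act_def)
    then show "a \<odot>\<^bsub>M\<^esub> x \<in> ?N" using y z free_ring_mult by auto
  qed
  fix x assume "x \<in> ?N"
  then obtain z where z: "z \<in> carrier (free_ring n)" "x = act z m0" by blast
  then obtain z0 z1 where z01: "z0 \<in> carrier (free_ring n)" "z1 \<in> carrier (free_ring n)" "z = z0 + z1"
    "proj n q z0 \<in> HC_part n q 0" "proj n q z1 \<in> HC_part n q 1"
    using free_alg_homogeneous_parts[of z n q] by blast
  have mem: "act z0 m0 \<in> part M p" "act z1 m0 \<in> part M (1 + p)"
    using part_act[OF z01(4) m0(1)] part_act[OF z01(5) m0(1)] by (simp_all only: add_0_left)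
  have x: "x = act z0 m0 \<oplus>\<^bsub>M\<^esub> act z1 m0" using z z01 act_l_add mc by simp
  show "\<exists>x0\<in>?N \<inter> part M 0. \<exists>x1\<in>?N \<inter> part M 1. x = x0 \<oplus>\<^bsub>M\<^esub> x1"
  proof (cases "p = 0")
    case True
    then show ?thesis using mem x z01
      by (intro bexI[of _ "act z0 m0"] bexI[of _ "act z1 m0"]) auto
  next
    case False
    then have "p = 1" by (metis bit_not_zero_iff)
    moreover have "x = act z1 m0 \<oplus>\<^bsub>M\<^esub> act z0 m0"
      using x lmod.M.a_comm act_closed z01 mc by metis
    ultimately show ?thesis using mem z01
      by (intro bexI[of _ "act z1 m0"] bexI[of _ "act z0 m0"]) auto
  qed
qed

text \<open>M is the quotient of the free algebra by the annihilator J of a homogeneous vector. A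
  linear complement V of J represents this quotient inside a vector space type.\<close>

lemma transport_exists:
  assumes two: "(2 :: 'a) \<noteq> 0" and eps: "eps q \<noteq> 0"
  shows "\<exists>V t c \<psi>. hc_transport (\<lambda>a x. const a * x) n q V t c M (\<psi> :: 'a free_alg \<Rightarrow> 'v)"
proof -
  let ?R = "carrier (free_ring n) :: 'a free_alg set"
  interpret vs: vector_space "\<lambda>a (x :: 'a free_alg). const a * x" by (rule free_alg_vector_space)
  obtain p m0 where m0: "m0 \<in> part M p" "m0 \<noteq> \<zero>\<^bsub>M\<^esub>" using homogeneous_vector by blast
  have mc: "m0 \<in> carrier M" using m0 part_carrier by blast
  define J where "J = {x \<in> ?R. act x m0 = \<zero>\<^bsub>M\<^esub>}"
  have R: "vs.subspace ?R"
    by (intro vs.subspaceI free_ring_zero free_ring_add free_ring_mult free_ring_const)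
  have J: "vs.subspace J"
    unfolding J_def using mc
    by (intro vs.subspaceI) (auto simp: free_ring_zero free_ring_add free_ring_mult free_ring_const
        act_zero_left act_l_add act_mult act_zero_right)
  obtain V where V: "vs.subspace V" "V \<subseteq> ?R" "J \<inter> V = {0}" "\<And>x. x \<in> ?R \<Longrightarrow> \<exists>j\<in>J. \<exists>v\<in>V. x = j + v"
    using vs.complement_exists[OF R J] by (auto simp: J_def)
  define \<psi> where "\<psi> v = act v m0" for v
  have diff: "act x m0 = act y m0 \<longleftrightarrow> x - y \<in> J" if xy: "x \<in> ?R" "y \<in> ?R" for x y
  proof -
    have d: "x - y \<in> ?R" using xy free_ring_diff by blast
    have "act x m0 = act (x - y) m0 \<oplus>\<^bsub>M\<^esub> act y m0" using act_l_add[of "x - y" y m0] d xy mc by simp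
    then show ?thesis using d xy mc act_closed lmod.M.add.r_cancel_one[of "act y m0" "act (x - y) m0"]
      by (auto simp: J_def)
  qed
  have inj: "inj_on \<psi> V"
  proof (rule inj_onI)
    fix x y assume xy: "x \<in> V" "y \<in> V" "\<psi> x = \<psi> y"
    have "x \<in> ?R" "y \<in> ?R" using xy(1,2) V(2) by blast+
    then have "x - y \<in> J" using diff xy(3) by (simp add: \<psi>_def)
    moreover have "x - y \<in> V" using xy(1,2) V(1) vs.subspace_diff by blast
    ultimately have "x - y \<in> J \<inter> V" by blast
    then show "x = y" using V(3) by auto
  qed
  have "carrier M \<subseteq> \<psi> ` V"
  proof
    fix m assume "m \<in> carrier M"
    then obtain x where x: "x \<in> ?R" "m = act x m0" using cyclic[OF m0] by blast
    then obtain j v where jv: "j \<in> J" "v \<in> V" "x = j + v" using V(4) by blast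
    then have "act x m0 = act v m0" using diff[of x v] x V(2) by auto
    then show "m \<in> \<psi> ` V" using x jv by (auto simp: \<psi>_def)
  qed
  moreover have "\<psi> ` V \<subseteq> carrier M" using V(2) mc act_closed by (auto simp: \<psi>_def)
  ultimately have bij: "bij_betw \<psi> V (carrier M)" using inj by (auto simp: bij_betw_def)
  define iv where "iv = inv_into V \<psi>"
  have iv: "iv m \<in> V" "\<psi> (iv m) = m" if "m \<in> carrier M" for m
    using that bij unfolding iv_def by (auto simp: bij_betw_def inv_into_into f_inv_into_f)
  have psi: "\<psi> v \<in> carrier M" if "v \<in> V" for v using bij that by (auto simp: bij_betw_def)
  have iv_eqI: "iv m = v" if "v \<in> V" "\<psi> v = m" for m v
    using that inv_into_f_f[OF inj] by (auto simp: iv_def)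
  have psi_add: "\<psi> (v + w) = \<psi> v \<oplus>\<^bsub>M\<^esub> \<psi> w" if "v \<in> V" "w \<in> V" for v w
    using that V(2) mc by (auto simp: \<psi>_def act_l_add subset_iff)
  have psi_scale: "\<psi> (const a * v) = act (const a) (\<psi> v)" if "v \<in> V" for v a
    using that V(2) mc by (auto simp: \<psi>_def act_mult subset_iff free_ring_const)
  obtain \<pi> where \<pi>: "\<And>x y. \<pi> (x + y) = \<pi> x + \<pi> y" "\<And>a x. \<pi> (const a * x) = const a * \<pi> x"
    "\<And>x. \<pi> x \<in> V" "\<And>x. x \<in> V \<Longrightarrow> \<pi> x = x"
    using vs.linear_projection_exists[OF V(1)] by blast
  \<comment> \<open>The projection \<pi> makes op x linear on the whole free algebra; on V it is the
    action of x read through \<psi>.\<close>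
  define op where "op x v = iv (act x (\<psi> (\<pi> v)))" for x v
  have opV: "op x v \<in> V" and psi_op': "\<psi> (op x v) = act x (\<psi> (\<pi> v))" if "x \<in> ?R" for x v
    using iv[of "act x (\<psi> (\<pi> v))"] act_closed psi \<pi>(3) that by (auto simp: op_def)
  have psi_op: "\<psi> (op x v) = act x (\<psi> v)" if "x \<in> ?R" "v \<in> V" for x v
    using psi_op' that \<pi>(4) by simp
  have psi_eq: "x = y" if "x \<in> V" "y \<in> V" "\<psi> x = \<psi> y" for x y
    using inj_onD[OF inj] that by blast
  have addV: "v + w \<in> V" if "v \<in> V" "w \<in> V" for v w using that V(1) vs.subspace_add by blast
  have scV: "const a * v \<in> V" if "v \<in> V" for a v using that V(1) vs.subspace_scale by blast
  have rep: "hc_rep (\<lambda>a x. const a * x) n q V (\<lambda>i. if 1 \<le> i \<and> i < n then op (var (T i)) else id)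
    (\<lambda>i. if 1 \<le> i \<and> i \<le> n then op (var (C i)) else id)"
  proof (rule hc_rep_of_representation[OF free_alg_vector_space V(1) two eps])
    fix x y :: "'a free_alg" and v w a assume x: "x \<in> ?R"
    show "op x (v + w) = op x v + op x w"
      using x \<pi>(3) psi act_closed
      by (intro psi_eq) (auto simp: opV addV psi_op' psi_add \<pi>(1) act_r_add)
    show "op x (const a * v) = const a * op x v"
    proof (rule psi_eq)
      have "act x (act (const a) (\<psi> (\<pi> v))) = act (const a) (act x (\<psi> (\<pi> v)))"
        using x \<pi>(3) psi act_mult[of x "const a"] act_mult[of "const a" x] const_commute[OF x] free_ring_const
        by metis
      then show "\<psi> (op x (const a * v)) = \<psi> (const a * op x v)"
        using x \<pi>(3) by (simp add: psi_op' psi_scale opV \<pi>(2))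
    qed (use x in \<open>auto simp: opV scV\<close>)
    show "op x v \<in> V" by (rule opV[OF x])
    show "op (x + y) v = op x v + op y v" if "y \<in> ?R" "v \<in> V"
      using x that psi
      by (intro psi_eq) (auto simp: opV addV psi_op psi_add act_l_add free_ring_add)
    show "op (x * y) v = op x (op y v)" if "y \<in> ?R" "v \<in> V"
      using x that psi by (intro psi_eq) (auto simp: opV psi_op act_mult free_ring_mult)
    show "op x v = op y v" if "x - y \<in> relators n q" "y \<in> ?R" "v \<in> V"
      using x that act_rel[OF relator_mem[OF that(1)]] by (intro psi_eq) (auto simp: opV psi_op)
  next
    show "op (const a) v = const a * v" if "v \<in> V" for a v
      using that by (intro psi_eq) (auto simp: opV scV psi_op psi_scale free_ring_const)
  qed
  have "hc_transport (\<lambda>a x. const a * x) n q V (\<lambda>i. if 1 \<le> i \<and> i < n then op (var (T i)) else id)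
    (\<lambda>i. if 1 \<le> i \<and> i \<le> n then op (var (C i)) else id) M \<psi>"
    using rep bij psi_add psi_scale
    by (intro hc_transport.intro hc_transport_axioms.intro HC_left_module_axioms)
      (auto simp: psi_op free_ring_var T_gens C_gens)
  then show ?thesis by blast
qed

end

section \<open>Complete splittability up to rank h\<close>

locale irreducible_transport = irreducible_module n q M + hc_transport scale n q V t c M \<psi>
  for scale :: "'a::alg_closed_field \<Rightarrow> 'w::ab_group_add \<Rightarrow> 'w" (infixr "*s" 75)
    and n q V t c and M :: "('a, 'v) HC_mod" and \<psi>
begin

definition Vp :: "bit \<Rightarrow> 'w set" where
  "Vp p = {v \<in> V. \<psi> v \<in> part M p}"

lemma Vp_V: "v \<in> Vp p \<Longrightarrow> v \<in> V"
  by (simp add: Vp_def)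

lemma Vp_subspace: "subspace (Vp p)"
proof (rule subspaceI)
  show "0 \<in> Vp p" by (simp add: Vp_def V_closed(1) psi_zero part_zero)
  show "x + y \<in> Vp p" if "x \<in> Vp p" "y \<in> Vp p" for x y
    using that by (simp add: Vp_def psi_add part_add)
  show "a *s x \<in> Vp p" if "x \<in> Vp p" for a x
    using that part_act[OF HC_part_const, of "\<psi> x" p a, unfolded add_0_left] by (simp add: Vp_def psi_scale)
qed

lemma Vp_t: "\<lbrakk>1 \<le> i; i < n; v \<in> Vp p\<rbrakk> \<Longrightarrow> t i v \<in> Vp p"
  using part_act[OF HC_part_var(1), of i "\<psi> v" p, unfolded add_0_left] by (simp add: Vp_def psi_t T_gens)

lemma Vp_c: "\<lbrakk>1 \<le> i; i \<le> n; v \<in> Vp p\<rbrakk> \<Longrightarrow> c i v \<in> Vp (1 + p)"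
  using part_act[OF HC_part_var(2), of i "\<psi> v" p] unfolding Vp_def by (simp only: psi_c C_gens mem_Collect_eq c_closed)

lemma Vp_L: "\<lbrakk>1 \<le> k; k \<le> n; v \<in> Vp p\<rbrakk> \<Longrightarrow> L k v \<in> Vp p"
proof (induction k arbitrary: v)
  case (Suc k)
  show ?case
  proof (cases "k = 0")
    case False
    let ?x = "L k (t k v)"
    have x: "?x \<in> Vp p" using Suc False by (intro Suc.IH Vp_t) auto
    have "c k (c (Suc k) ?x) \<in> Vp (1 + (1 + p))"
      using x False Suc.prems by (intro Vp_c) auto
    moreover have "1 + (1 + p) = p" by (cases p) simp_all
    ultimately have "c k (c (Suc k) ?x) \<in> Vp p" by (simp only:)
    then show ?thesis
      using x Vp_t[of k ?x p] False Suc.prems Vp_subspace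
      by (simp add: L_Suc subspace_add subspace_scale)
  qed (use Suc in \<open>simp add: L_1\<close>)
qed simp

lemma Vp_decomp: "v \<in> V \<Longrightarrow> \<exists>v0\<in>Vp 0. \<exists>v1\<in>Vp 1. v = v0 + v1"
proof -
  assume v: "v \<in> V"
  obtain m0 m1 where m: "m0 \<in> part M 0" "m1 \<in> part M 1" "\<psi> v = m0 \<oplus>\<^bsub>M\<^esub> m1"
    using part_sum[OF psi_mem[OF v]] by blast
  obtain v0 v1 where v01: "v0 \<in> V" "m0 = \<psi> v0" "v1 \<in> V" "m1 = \<psi> v1"
    using psi_surj part_carrier m by metis
  then have "\<psi> v = \<psi> (v0 + v1)" using m psi_add by simp
  then have "v = v0 + v1" using psi_inj v v01 by simp
  then show ?thesis using v01 m by (auto simp: Vp_def)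
qed

lemma Vp_unique:
  assumes "x \<in> Vp 0" "y \<in> Vp 1" "x' \<in> Vp 0" "y' \<in> Vp 1" "x + y = x' + y'"
  shows "x = x' \<and> y = y'"
proof -
  have "x - x' = y' - y" using assms(5) by (simp add: algebra_simps)
  moreover have "x - x' \<in> Vp 0" "y' - y \<in> Vp 1" using assms Vp_subspace subspace_diff by blast+
  ultimately have "x - x' \<in> V" "\<psi> (x - x') \<in> part M 0" "\<psi> (x - x') \<in> part M 1"
    by (auto simp: Vp_def)
  then have "\<psi> (x - x') = \<psi> 0" using part_inter psi_zero by simp
  then have "x - x' = 0" using psi_inj \<open>x - x' \<in> V\<close> V_closed(1) by blast
  then show ?thesis using assms(5) by simp
qed

lemma stable_subspace_eq:
  assumes U: "subspace U" "U \<subseteq> V"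
    and tU: "\<And>i u. \<lbrakk>1 \<le> i; i < n; u \<in> U\<rbrakk> \<Longrightarrow> t i u \<in> U"
    and cU: "\<And>i u. \<lbrakk>1 \<le> i; i \<le> n; u \<in> U\<rbrakk> \<Longrightarrow> c i u \<in> U"
    and gr: "\<And>u. u \<in> U \<Longrightarrow> \<exists>u0\<in>U \<inter> Vp 0. \<exists>u1\<in>U \<inter> Vp 1. u = u0 + u1"
    and u: "u \<in> U" "u \<noteq> 0"
  shows "U = V"
proof -
  have "\<psi> ` U = carrier M"
  proof (rule irreducibleD[where x = "\<psi> u"])
    show "submodule (\<psi> ` U) (HC n q) M" using submodule_image[OF U tU cU] .
    show "\<psi> u \<in> \<psi> ` U" using u by blast
    show "\<psi> u \<noteq> \<zero>\<^bsub>M\<^esub>" using psi_inj[of u 0] u U V_closed(1) psi_zero by auto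
    fix x assume "x \<in> \<psi> ` U"
    then obtain w where w: "w \<in> U" "x = \<psi> w" by blast
    then obtain u0 u1 where u01: "u0 \<in> U \<inter> Vp 0" "u1 \<in> U \<inter> Vp 1" "w = u0 + u1" using gr by blast
    then show "\<exists>x0\<in>\<psi> ` U \<inter> part M 0. \<exists>x1\<in>\<psi> ` U \<inter> part M 1. x = x0 \<oplus>\<^bsub>M\<^esub> x1"
      using w psi_add
      by (intro bexI[of _ "\<psi> u0"] bexI[of _ "\<psi> u1"]) (auto simp: Vp_def)
  qed
  then show ?thesis using U(2) psi_bij
    by (metis bij_betw_def inj_on_image_eq_iff order_refl)
qed

lemma span_stable:
  assumes "\<And>x. x \<in> B \<Longrightarrow> f x \<in> span B" "\<And>x y. f (x + y) = f x + f y" "\<And>a x. f (a *s x) = a *s f x"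
    and "w \<in> span B"
  shows "f w \<in> span B"
  using assms(4)
proof (induction rule: span_induct_alt)
  case base
  then show ?case using assms(3)[of 0 0] by (simp add: span_zero)
next
  case (step a x y)
  then show ?case by (simp add: assms span_add span_scale)
qed

lemma V_finite: "\<exists>B. finite B \<and> V \<subseteq> span B"
proof -
  obtain p m0 where m0: "m0 \<in> part M p" "m0 \<noteq> \<zero>\<^bsub>M\<^esub>" using homogeneous_vector by blast
  obtain v0 where v0: "v0 \<in> V" "m0 = \<psi> v0" using psi_surj part_carrier m0 by blast
  obtain B where B: "finite B" "B \<subseteq> V" "v0 \<in> span B"
    "\<And>i w. \<lbrakk>1 \<le> i; i < n; w \<in> span B\<rbrakk> \<Longrightarrow> t i w \<in> span B"
    "\<And>i w. \<lbrakk>1 \<le> i; i \<le> n; w \<in> span B\<rbrakk> \<Longrightarrow> c i w \<in> span B"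
    using finite_generation[OF v0(1) order_refl] by auto
  have sV: "span B \<subseteq> V" using B(2) V_subspace by (rule span_minimal)
  have sub: "submodule (\<psi> ` span B) (HC n q) M"
    using submodule_image[OF subspace_span sV B(4,5)] by blast
  have "carrier M \<subseteq> \<psi> ` span B"
  proof
    fix m assume "m \<in> carrier M"
    then obtain x where x: "x \<in> carrier (free_ring n)" "m = act x m0" using cyclic[OF m0] by blast
    then show "m \<in> \<psi> ` span B"
      using submodule.smult_closed[OF sub proj_closed[OF x(1)], of m0] B(3) v0 by (simp add: act_def)
  qed
  then have "V \<subseteq> span B"
    using psi_inj psi_mem sV by (auto simp: subset_iff image_iff) (metis)
  then show ?thesis using B by blast
qed

lemma completely_splittable_if_le:
  assumes "root_of_unity h q" and nh: "n \<le> h"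
  shows "completely_splittable n q M"
proof -
  interpret root_of_unity h q by (rule assms(1))
  interpret hc_split scale n q V t c h
    by (intro hc_split.intro hc_split_axioms.intro hc_rep_axioms assms(1) V_finite)
  have JV: "joint_span \<subseteq> V"
    unfolding joint_span_def using V_subspace by (intro span_minimal) auto
  obtain v where v: "v \<in> V" "v \<noteq> 0"
  proof -
    obtain p m0 where m0: "m0 \<in> part M p" "m0 \<noteq> \<zero>\<^bsub>M\<^esub>" using homogeneous_vector by blast
    obtain w where w: "w \<in> V" "m0 = \<psi> w" using psi_surj[OF part_carrier[OF m0(1)]] by blast
    then have "w \<noteq> 0" using m0(2) psi_zero by blast
    then show thesis using that w(1) by blast
  qed
  \<comment> \<open>For n = h the absence of Jordan blocks of L_n is not known at this point; one
    joint eigenvector is enough to start.\<close>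
  obtain u where u: "u \<in> V" "u \<noteq> 0" "joint n u"
    using joint_eigenvector_exists[OF V_subspace order_refl L_closed order_refl v] by blast
  have "joint_span = V"
  proof (rule stable_subspace_eq[where u = u])
    show "subspace joint_span" by (simp add: joint_span_def)
    show "u \<in> joint_span" unfolding joint_span_def using u(1,3) by (intro span_base CollectI conjI)
    show "u \<noteq> 0" by (rule u(2))
    show "t i w \<in> joint_span" if "1 \<le> i" "i < n" "w \<in> joint_span" for i w
      using that(3) unfolding joint_span_def
      by (rule span_stable[where f = "t i", rotated -1])
        (use joint_span_t[OF nh that(1,2), unfolded joint_span_def] in \<open>simp_all add: t_add t_scale\<close>)
    show "c i w \<in> joint_span" if "1 \<le> i" "i \<le> n" "w \<in> joint_span" for i w
      using that(3) unfolding joint_span_def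
      by (rule span_stable[where f = "c i", rotated -1])
        (use joint_span_c[OF that(1,2), unfolded joint_span_def] in \<open>simp_all add: c_add c_scale\<close>)
    \<comment> \<open>The L_k are even, so the homogeneous parts of a joint eigenvector satisfy the
      same eigenvalue equations. Hence the span is graded.\<close>
    fix w assume "w \<in> joint_span"
    then show "\<exists>u0\<in>joint_span \<inter> Vp 0. \<exists>u1\<in>joint_span \<inter> Vp 1. w = u0 + u1"
      unfolding joint_span_def
    proof (induction rule: span_induct_alt)
      case base
      show ?case using subspace_0[OF Vp_subspace] by (intro bexI[of _ 0]) (auto simp: span_zero)
    next
      case (step a x y)
      let ?J = "span {v \<in> V. joint n v}"
      obtain y0 y1 where y: "y0 \<in> ?J \<inter> Vp 0" "y1 \<in> ?J \<inter> Vp 1" "y = y0 + y1" using step by blast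
      obtain x0 x1 where x: "x0 \<in> Vp 0" "x1 \<in> Vp 1" "x = x0 + x1" using Vp_decomp step by blast
      have "\<exists>b. L k x0 = b *s x0 \<and> L k x1 = b *s x1" if k: "1 \<le> k" "k \<le> n" for k
      proof -
        obtain b where "L k x = b *s x" using step k by (auto simp: joint_def)
        then have "L k x0 + L k x1 = b *s x0 + b *s x1" by (simp add: x lin_L scale_right_distrib)
        then have "L k x0 = b *s x0 \<and> L k x1 = b *s x1"
          using x k Vp_subspace by (intro Vp_unique Vp_L) (auto intro: subspace_scale)
        then show ?thesis by blast
      qed
      then have "joint n x0" "joint n x1" by (auto simp: joint_def)
      then have "x0 \<in> ?J" "x1 \<in> ?J" using x Vp_V by (auto intro!: span_base)
      then have "a *s x0 + y0 \<in> ?J \<inter> Vp 0" "a *s x1 + y1 \<in> ?J \<inter> Vp 1"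
        using x y Vp_subspace by (auto intro!: span_add span_scale intro: subspace_add subspace_scale)
      moreover have "a *s x + y = (a *s x0 + y0) + (a *s x1 + y1)"
        by (simp add: x y scale_right_distrib algebra_simps)
      ultimately show ?case by blast
    qed
  qed (rule JV)
  then have span: "V \<subseteq> span {v \<in> V. \<exists>a. L k v = a *s v}" if "1 \<le> k" "k \<le> n" for k
    unfolding joint_span_def using that span_mono[of "{v \<in> V. joint n v}" "{v \<in> V. \<exists>a. L k v = a *s v}"]
    by (auto simp: joint_def)
  then have "acts_semisimply n q M (JM n q k)" if "k \<in> {1..n}" for k
    using that acts_semisimplyI by simp
  moreover have "finite_dim n q M" using V_finite finite_dimI by blast
  ultimately show ?thesis using HC_mod by (simp add: completely_splittable_def)
qed

end

lemma irreducible_completely_splittable: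
  fixes q :: "'a::alg_closed_field"
  assumes "root_of_unity h q" "n \<le> h" and irr: "irreducible_HC_module n q M"
  shows "completely_splittable n q M"
proof -
  interpret r: root_of_unity h q by (rule assms(1))
  interpret irreducible_module n q M by unfold_locales (rule irr)
  obtain V t c \<psi> where "hc_transport (\<lambda>a x. const a * x) n q V t c M \<psi>"
    using transport_exists[OF r.two_neq_0' r.eps_neq_0'] by blast
  then interpret tr: hc_transport "\<lambda>a x. const a * x" n q V t c M \<psi> .
  interpret irreducible_transport "\<lambda>a x. const a * x" n q V t c M \<psi> ..
  show ?thesis using completely_splittable_if_le assms by blast
qed


section \<open>Jucys--Murphy operators on the basic spin module\<close>

context hc_rep
begin

text \<open>The sum of eps q^(2i-1) C_i v over i = 1, ..., k, the Clifford combination that occurs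
  in L_(k+1) on the vacuum vector; the index is shifted by one in the recursion.\<close>

primrec wsum :: "nat \<Rightarrow> 'w \<Rightarrow> 'w" where
  "wsum 0 v = 0"
| "wsum (Suc k) v = wsum k v + (e * q ^ (2 * k + 1)) *s c (Suc k) v"

lemma wsum_lin: "wsum k (v + w) = wsum k v + wsum k w" "wsum k (a *s v) = a *s wsum k v"
    "wsum k (- v) = - wsum k v"
  by (induction k) (simp_all add: lin algebra_simps)

lemma wsum_closed [simp]: "v \<in> V \<Longrightarrow> wsum k v \<in> V"
  by (induction k) (simp_all)

lemma c_wsum: "\<lbrakk>k < j; j \<le> n; v \<in> V\<rbrakk> \<Longrightarrow> c j (wsum k v) = - wsum k (c j v)"
  by (induction k) (simp_all add: lin c_c[of j])

lemma t_wsum: "\<lbrakk>k < j; j < n; v \<in> V\<rbrakk> \<Longrightarrow> t j (wsum k v) = wsum k (t j v)"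
  by (induction k) (simp_all add: lin t_c_other)

lemma L_wsum: "\<lbrakk>k < j; j \<le> n; v \<in> V\<rbrakk> \<Longrightarrow> L j (wsum k v) = wsum k (L j v)"
  by (induction k) (simp_all add: lin lin_L L_c_other)

primrec wnorm :: "nat \<Rightarrow> 'a" where
  "wnorm 0 = 0"
| "wnorm (Suc k) = wnorm k + (e * q ^ (2 * k + 1))^2"

lemma wsum_wsum: "\<lbrakk>k \<le> n; v \<in> V\<rbrakk> \<Longrightarrow> wsum k (wsum k v) = wnorm k *s v"
proof (induction k)
  case (Suc k)
  let ?a = "e * q ^ (2 * k + 1)"
  have "c (Suc k) (wsum k v) = - wsum k (c (Suc k) v)" using Suc by (intro c_wsum) auto
  moreover have "c (Suc k) (c (Suc k) v) = v" using Suc by (simp add: c_sq)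
  ultimately have "wsum (Suc k) (wsum (Suc k) v) = wnorm k *s v + (?a * ?a) *s v"
    using Suc by (simp add: wsum_lin lin del: power_Suc)
  then show ?case by (simp add: lin power2_eq_square del: power_Suc)
qed simp

text \<open>\<open>tt\<close> sends C_(k+1) v to C_(k+2) v divided by q, which cancels the factor q
  coming from T_(k+1) v = q v. So the old coefficients persist and one new term appears.\<close>

lemma L_vacuum:
  assumes v: "v \<in> V" and tv: "\<And>i. \<lbrakk>1 \<le> i; i < n\<rbrakk> \<Longrightarrow> t i v = q *s v" and q: "q \<noteq> 0"
  shows "Suc k \<le> n \<Longrightarrow> L (Suc k) v = q ^ (2 * k) *s v + wsum k (c (Suc k) v)"
proof (induction k)
  case (Suc k)
  have k: "1 \<le> Suc k" "Suc k < n" using Suc.prems by simp_all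
  have e: "e = q - inverse q" by (simp add: eps_def)
  have qi: "q * inverse q = 1" using q by simp
  define u where "u = c (Suc (Suc k)) v"
  have u: "u \<in> V" using v by (simp add: u_def)
  have tc: "t (Suc k) (c (Suc k) v) = q *s u"
    using k v by (simp add: t_c tv lin u_def)
  have ccc: "c (Suc k) (c (Suc (Suc k)) (c (Suc k) v)) = - u"
    using k v by (simp add: c_c[of "Suc (Suc k)" "Suc k"] lin c_sq u_def)
  have 1: "tt (Suc k) (c (Suc k) v) = inverse q *s u"
    by (simp add: tc ccc lin e)
  have 2: "tt (Suc k) (wsum k x) = wsum k (tt (Suc k) x)" if "x \<in> V" for x
    using that k by (simp add: t_wsum c_wsum wsum_lin lin)
  have "L (Suc (Suc k)) v = tt (Suc k) (L (Suc k) (q *s v))"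
    using k by (simp add: L_Suc tv del: lin)
  also have "L (Suc k) (q *s v) = q *s (q ^ (2 * k) *s v + wsum k (c (Suc k) v))"
    using Suc by (simp add: L_scale)
  also have "tt (Suc k) (q *s (q ^ (2 * k) *s v + wsum k (c (Suc k) v))) =
      q *s (q ^ (2 * k) *s tt (Suc k) v + tt (Suc k) (wsum k (c (Suc k) v)))"
    by (simp add: lin algebra_simps)
  also have "tt (Suc k) (wsum k (c (Suc k) v)) = inverse q *s wsum k u"
    using 2[of "c (Suc k) v"] v by (simp add: 1 wsum_lin)
  also have "tt (Suc k) v = q *s v + e *s c (Suc k) u" using k by (simp add: tv u_def)
  also have "q *s (q ^ (2 * k) *s (q *s v + e *s c (Suc k) u) + inverse q *s wsum k u)
      = (q * (q ^ (2 * k) * q)) *s v + (e * q ^ (2 * k + 1)) *s c (Suc k) u + (q * inverse q) *s wsum k u"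
    by (simp add: lin mult_ac)
  finally show ?case by (simp add: qi u_def algebra_simps)
qed (use v in \<open>simp add: L_1\<close>)

text \<open>On v the operator L + 1/L is the scalar (q^(4k) + 1 + wnorm k) / q^(2k); hypothesis
  \<open>two\<close> says that it equals 2.\<close>

lemma L_vacuum_quadratic:
  assumes v: "v \<in> V" and tv: "\<And>i. \<lbrakk>1 \<le> i; i < n\<rbrakk> \<Longrightarrow> t i v = q *s v" and q: "q \<noteq> 0"
    and k: "Suc k \<le> n" and two: "q ^ (2 * k) * q ^ (2 * k) + 1 + wnorm k = 2 * q ^ (2 * k)"
  shows "L (Suc k) (L (Suc k) v) = L (Suc k) v + L (Suc k) v - v"
proof -
  define p where "p = q ^ (2 * k)"
  have p: "p \<noteq> 0" using q by (simp add: p_def)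
  define x where "x = c (Suc k) v"
  have x: "x \<in> V" "c (Suc k) x = v" using v k by (auto simp: x_def c_sq)
  have Lv: "L (Suc k) v = p *s v + wsum k x"
    using L_vacuum[OF v tv q k] by (simp add: p_def x_def)
  \<comment> \<open>The action of L on x = C_(k+1) v follows from L C L = C, with no second
    recursion.\<close>
  have "L (Suc k) (c (Suc k) (L (Suc k) v)) = x" using L_c_self[of "Suc k" v] k v by (simp add: x_def)
  moreover have "c (Suc k) (L (Suc k) v) = p *s x - wsum k v"
    using k x by (simp add: Lv lin c_wsum) (simp add: x_def)
  ultimately have "p *s L (Suc k) x = x + wsum k (L (Suc k) v)"
    using k v by (simp add: lin_L L_wsum algebra_simps)
  also have "wsum k (L (Suc k) v) = p *s wsum k v + wnorm k *s x"
    using k x by (simp add: Lv wsum_lin wsum_wsum)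
  finally have pLx: "p *s L (Suc k) x = (1 + wnorm k) *s x + p *s wsum k v" by (simp add: lin)
  have "p *s L (Suc k) (L (Suc k) v) = p *s (p *s L (Suc k) v) + wsum k (p *s L (Suc k) x)"
    using k x unfolding Lv[THEN arg_cong[of _ _ "L (Suc k)"]] by (simp add: lin_L L_wsum wsum_lin lin)
  also have "\<dots> = p *s (p *s L (Suc k) v) + ((1 + wnorm k) *s wsum k x + (p * wnorm k) *s v)"
    using k v unfolding pLx by (simp add: wsum_lin wsum_wsum)
  also have "wsum k x = L (Suc k) v - p *s v" by (simp add: Lv)
  also have "p *s (p *s L (Suc k) v) + ((1 + wnorm k) *s (L (Suc k) v - p *s v) + (p * wnorm k) *s v)
      = (p * p + 1 + wnorm k) *s L (Suc k) v - p *s v"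
    by (simp add: lin algebra_simps)
  also have "p * p + 1 + wnorm k = p * 2" using two by (simp add: p_def mult.commute)
  finally have "p *s L (Suc k) (L (Suc k) v) = p *s (L (Suc k) v + L (Suc k) v - v)"
    by (simp add: scale_numeral lin)
  then show ?thesis using p by simp
qed

lemma wnorm_sum: "wnorm k = (\<Sum>i<k. (e * q ^ (2 * i + 1))^2)"
  by (induction k) simp_all

definition unip :: "nat \<Rightarrow> 'w set" where
  "unip k = {w \<in> V. L k (L k w) = L k w + L k w - w}"

lemma unip_subspace: "subspace (unip k)"
proof (rule subspaceI)
  show "x + y \<in> unip k" if "x \<in> unip k" "y \<in> unip k" for x y
    using that by (simp add: unip_def L_add)
  show "a *s x \<in> unip k" if "x \<in> unip k" for a x
    using that by (simp add: unip_def L_scale lin)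
qed (simp add: unip_def L_zero V_closed(1))

text \<open>The condition says that L_k + 1/L_k acts as 2, and this expression is unchanged when C_k
  inverts L_k.\<close>

lemma unip_c:
  assumes k: "1 \<le> k" "k \<le> n" "1 \<le> j" "j \<le> n" and w: "w \<in> unip k"
  shows "c j w \<in> unip k"
proof (cases "j = k")
  case False
  then show ?thesis using assms by (simp add: unip_def L_c_other lin)
next
  case True
  have wV: "w \<in> V" and LL: "L k (L k w) = L k w + L k w - w" using w by (simp_all add: unip_def)
  have 1: "L k (c k (L k w)) = c k w" using L_c_self k(1,2) wV by blast
  have "L k (c k (L k (L k w))) = c k (L k w)" using L_c_self[of k "L k w"] k(1,2) wV by simp
  then have 2: "L k (c k w) = c k w + c k w - c k (L k w)"
    by (simp add: LL lin lin_L 1 algebra_simps)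
  have "L k (L k (c k w)) = L k (c k w) + L k (c k w) - c k w"
    by (subst 2) (simp add: lin_L 1)
  then show ?thesis using True wV by (simp add: unip_def)
qed

text \<open>For w = T_k v the recursion and the quadratic relation give C_k C_(k+1) w = -w, although
  this product squares to -1. So w = 0, and the quadratic relation returns v = 0.\<close>

lemma not_both_one:
  assumes k: "1 \<le> k" "k < n" and v: "v \<in> V" "v \<noteq> 0"
    and L1: "\<And>w. w \<in> V \<Longrightarrow> L k w = w" "\<And>w. w \<in> V \<Longrightarrow> L (Suc k) w = w"
  shows False
proof -
  define w where "w = t k v"
  have w: "w \<in> V" using v by (simp add: w_def)
  have "t k w + e *s cd k w = v" using L1(2)[OF v(1)] L1(1)[OF w] k by (simp add: L_Suc w_def)
  moreover have "t k w = e *s w + v" using k v by (simp add: w_def t_sq)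
  ultimately have "e *s (w + cd k w) = 0" by (simp add: lin algebra_simps)
  then have "cd k w = - w" using eps_neq_0 by (simp add: eq_neg_iff_add_eq_0 add.commute)
  then have "cd k (cd k w) = w" by (simp add: lin)
  moreover have "cd k (cd k w) = - w" using k w by (simp add: c_c_sq)
  ultimately have "w + w = 0" by (metis add.right_inverse)
  then have "w = 0" by (simp add: double_zero)
  then have "e *s 0 + v = t k 0" using k v t_sq[of k v] by (simp add: w_def)
  then show False using v by (simp add: lin)
qed

end

text \<open>Dividing the left side by q^(2k) gives cont k, the value of box k + 1 in a one-row
  tableau. It is 2 exactly when h divides k or k + 1, whence the two choices. The geometric sum is
  handled after multiplication by q^2 + 1, which is nonzero.\<close>

lemma (in root_of_unity) wnorm_special:
  assumes "k = h - 1 \<or> k = h"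
  shows "q ^ (2 * k) * q ^ (2 * k) + 1 + (\<Sum>i<k. (eps q * q ^ (2 * i + 1))^2) = 2 * q ^ (2 * k)"
proof -
  have 1: "(q^2 + 1) * (\<Sum>i<k. (eps q * q ^ (2 * i + 1))^2) = (q^2 - 1) * (q ^ (4 * k) - 1)"
  proof (induction k)
    case (Suc k)
    have "eps q * q = q^2 - 1" using q_neq_0 by (simp add: eps_def field_simps power2_eq_square)
    then have "(eps q * q ^ (2 * k + 1))^2 = ((q^2 - 1) * q ^ (2 * k))^2" by (simp add: mult.assoc[symmetric])
    then have "(eps q * q ^ (2 * k + 1))^2 = (q^2 - 1)^2 * q ^ (4 * k)"
      by (simp add: power_mult_distrib flip: power_mult)
    then show ?case using Suc by (simp add: distrib_left) (simp add: algebra_simps power2_eq_square eval_nat_numeral)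
  qed simp
  have qh: "q ^ h = 1" using prim by (simp add: primitive_root_of_unity_def)
  have nz: "q^2 + 1 \<noteq> 0"
    using powi_neq_minus_1[of 2] by (simp add: eq_neg_iff_add_eq_0)
  let ?s = "\<Sum>i<k. (eps q * q ^ (2 * i + 1))^2"
  show ?thesis
    using assms
  proof
    assume k: "k = h"
    then have "q ^ (4 * k) = 1" "q ^ (2 * k) = 1" by (metis mult.commute power_mult power_one qh)+
    then show ?thesis using 1 nz by simp
  next
    assume "k = h - 1"
    then have "Suc k = h" using h_ge_3 by simp
    then have qk: "q * q ^ k = 1" using qh by (metis power_Suc)
    define x where "x = q ^ k"
    have x: "q * x = 1" using qk by (simp add: x_def)
    have x2: "q ^ (2 * k) = x^2" "q ^ (4 * k) = x^4" by (simp_all add: x_def mult.commute flip: power_mult)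
    have "(q^2 + 1) * (x^2 * x^2 + 1 + ?s - 2 * x^2) =
        (q^2 + 1) * (x^2 * x^2 + 1 - 2 * x^2) + (q^2 - 1) * (x^4 - 1)"
      using 1 unfolding x2 by (simp add: algebra_simps)
    also have "\<dots> = 2 * ((q * x)^2 * x^2 + 1 - (q * x)^2 - x^2)"
      by (simp add: algebra_simps eval_nat_numeral)
    also have "\<dots> = 0" by (simp add: x)
    finally show ?thesis using nz unfolding x2 by simp
  qed
qed

section \<open>A concrete basic spin module\<close>

definition flip :: "nat \<Rightarrow> (nat \<Rightarrow> bool) \<Rightarrow> nat \<Rightarrow> bool" where
  "flip j \<alpha> = \<alpha>(j := \<not> \<alpha> j)"

definition cnt :: "nat \<Rightarrow> (nat \<Rightarrow> bool) \<Rightarrow> nat" where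
  "cnt j \<alpha> = card {i. i < j \<and> \<alpha> i}"

text \<open>The sign of moving C_j past the factors of smaller index in an increasing Clifford
  monomial.\<close>

definition sg :: "nat \<Rightarrow> (nat \<Rightarrow> bool) \<Rightarrow> 'a::field" where
  "sg j \<alpha> = (if even (cnt j \<alpha>) then 1 else - 1)"

lemma flip_apply [simp]: "flip j \<alpha> i = (if i = j then \<not> \<alpha> i else \<alpha> i)"
  by (simp add: flip_def)

lemma flip_flip [simp]: "flip j (flip j \<alpha>) = \<alpha>"
  by (simp add: fun_eq_iff)

lemma flip_commute: "flip i (flip j \<alpha>) = flip j (flip i \<alpha>)"
  by (auto simp: fun_eq_iff)

lemma cnt_Suc: "cnt (Suc j) \<alpha> = cnt j \<alpha> + of_bool (\<alpha> j)"
proof -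
  have "{i. i < Suc j \<and> \<alpha> i} = (if \<alpha> j then insert j {i. i < j \<and> \<alpha> i} else {i. i < j \<and> \<alpha> i})"
    by (auto simp: less_Suc_eq)
  then show ?thesis by (simp add: cnt_def)
qed

lemma cnt_flip: "even (cnt j (flip i \<alpha>)) \<longleftrightarrow> (if i < j then odd (cnt j \<alpha>) else even (cnt j \<alpha>))"
proof (induction j)
  case 0
  then show ?case by (simp add: cnt_def)
next
  case (Suc j)
  then show ?case by (auto simp: cnt_Suc)
qed

lemma sg_flip: "sg j (flip i \<alpha>) = (if i < j then - sg j \<alpha> else sg j \<alpha> :: 'a::field)"
  by (simp add: sg_def cnt_flip)

lemma sg_Suc: "sg (Suc j) \<alpha> = (if \<alpha> j then - sg j \<alpha> else sg j \<alpha> :: 'a::field)"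
  by (simp add: sg_def cnt_Suc)

lemma sg_sg: "sg j \<alpha> * sg j \<alpha> = (1 :: 'a::field)" "sg j \<alpha> * (sg j \<alpha> * x) = (x :: 'a)"
  by (simp_all add: sg_def)

type_synonym 'a spin = "(nat \<Rightarrow> bool) \<Rightarrow> 'a"

text \<open>The basic spin module, induced from the one-dimensional module of the Hecke algebra on which
  every \<open>T i\<close> acts by \<open>q\<close>. The function \<open>f\<close> stands for the combination of Clifford monomials
  (factors in increasing order) applied to the vacuum vector.\<close>

definition spin_c :: "nat \<Rightarrow> 'a::field spin \<Rightarrow> 'a spin" where
  "spin_c j f = (\<lambda>\<alpha>. sg j \<alpha> * f (flip j \<alpha>))"

text \<open>On the factors with indices i and i + 1 the relations give 1 -> q, C_i -> q C_(i+1),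
  C_(i+1) -> q^-1 C_i + eps C_(i+1) and C_i C_(i+1) -> eps - q^-1 C_i C_(i+1); the cases collect the
  coefficients of each target monomial.\<close>

definition spin_t :: "'a::field \<Rightarrow> nat \<Rightarrow> 'a spin \<Rightarrow> 'a spin" where
  "spin_t q i f = (\<lambda>\<alpha>. let \<beta> = flip i (flip (Suc i) \<alpha>) in
    if \<alpha> i then if \<alpha> (Suc i) then - (inverse q * f \<alpha>) else inverse q * f \<beta>
    else if \<alpha> (Suc i) then q * f \<beta> + eps q * f \<alpha> else q * f \<alpha> + eps q * f \<beta>)"

definition spin_scale :: "'a::field \<Rightarrow> 'a spin \<Rightarrow> 'a spin" where
  "spin_scale a f = (\<lambda>\<alpha>. a * f \<alpha>)"

definition spin_space :: "nat \<Rightarrow> 'a::field spin set" where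
  "spin_space n = {f. \<forall>\<alpha>. f \<alpha> \<noteq> 0 \<longrightarrow> (\<forall>j. \<alpha> j \<longrightarrow> 1 \<le> j \<and> j \<le> n)}"

lemma spin_vector_space: "vector_space (spin_scale :: 'a::field \<Rightarrow> _)"
  by unfold_locales (auto simp: spin_scale_def fun_eq_iff algebra_simps)

lemma spin_t_t:
  assumes "Suc i < j"
  shows "spin_t q i (spin_t q j f) = spin_t q j (spin_t q i f)"
proof
  fix \<alpha>
  show "spin_t q i (spin_t q j f) \<alpha> = spin_t q j (spin_t q i f) \<alpha>" using assms
    by (cases "\<alpha> i"; cases "\<alpha> (Suc i)"; cases "\<alpha> j"; cases "\<alpha> (Suc j)")
      (simp_all add: spin_t_def Let_def flip_commute[of j i] flip_commute[of j "Suc i"]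
        flip_commute[of "Suc j" i] flip_commute[of "Suc j" "Suc i"] algebra_simps)
qed

lemma spin_t_sq:
  assumes "q \<noteq> 0"
  shows "spin_t q i (spin_t q i f) = spin_scale (eps q) (spin_t q i f) + f"
proof
  fix \<alpha>
  have qi: "q * (inverse q * x) = x" "inverse q * (q * x) = x" for x
    using assms by (simp_all flip: mult.assoc)
  show "spin_t q i (spin_t q i f) \<alpha> = (spin_scale (eps q) (spin_t q i f) + f) \<alpha>"
    by (cases "\<alpha> i"; cases "\<alpha> (Suc i)")
      (simp_all add: spin_t_def spin_scale_def Let_def flip_commute[of "Suc i" i] eps_def qi algebra_simps)
qed

lemma spin_c_sq: "spin_c i (spin_c i f) = (f :: 'a::field spin)"
  by (simp add: spin_c_def sg_flip sg_sg flip: mult.assoc)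

lemma spin_c_c: "i \<noteq> j \<Longrightarrow> spin_c i (spin_c j f) = - spin_c j (spin_c i f)"
proof
  fix \<alpha>
  assume "i \<noteq> j"
  then show "spin_c i (spin_c j f) \<alpha> = (- spin_c j (spin_c i f)) \<alpha>"
    by (cases "i < j") (simp_all add: spin_c_def sg_flip flip_commute[of j i])
qed

lemma spin_t_c: "spin_t q i (spin_c i f) = spin_c (Suc i) (spin_t q i f)"
proof
  fix \<alpha>
  show "spin_t q i (spin_c i f) \<alpha> = spin_c (Suc i) (spin_t q i f) \<alpha>"
    by (cases "\<alpha> i"; cases "\<alpha> (Suc i)")
      (simp_all add: spin_t_def spin_c_def Let_def sg_flip sg_Suc flip_commute[of "Suc i" i] algebra_simps)
qed

lemma spin_t_c_Suc: "q \<noteq> 0 \<Longrightarrow> spin_t q i (spin_c (Suc i) f) =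
    spin_c i (spin_t q i f) - spin_scale (eps q) (spin_c i f - spin_c (Suc i) f)"
proof
  fix \<alpha>
  assume "q \<noteq> 0"
  show "spin_t q i (spin_c (Suc i) f) \<alpha> =
      (spin_c i (spin_t q i f) - spin_scale (eps q) (spin_c i f - spin_c (Suc i) f)) \<alpha>"
    by (cases "\<alpha> i"; cases "\<alpha> (Suc i)")
      (simp_all add: spin_t_def spin_c_def spin_scale_def Let_def sg_flip sg_Suc flip_commute[of "Suc i" i]
        eps_def algebra_simps)
qed

lemma spin_t_c_other: "\<lbrakk>j \<noteq> i; j \<noteq> Suc i\<rbrakk> \<Longrightarrow> spin_t q i (spin_c j f) = spin_c j (spin_t q i f)"
proof
  fix \<alpha>
  assume j: "j \<noteq> i" "j \<noteq> Suc i"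
  then have "i < j \<longleftrightarrow> Suc i < j" by auto
  then show "spin_t q i (spin_c j f) \<alpha> = spin_c j (spin_t q i f) \<alpha>" using j
    by (cases "Suc i < j"; cases "\<alpha> i"; cases "\<alpha> (Suc i)")
      (simp_all add: spin_t_def spin_c_def Let_def sg_flip flip_commute[of j i] flip_commute[of j "Suc i"] algebra_simps)
qed

lemma spin_braid:
  assumes "q \<noteq> 0"
  shows "spin_t q i (spin_t q (Suc i) (spin_t q i f)) = spin_t q (Suc i) (spin_t q i (spin_t q (Suc i) f))"
proof
  fix \<alpha>
  have qi: "q * (inverse q * x) = x" "inverse q * (q * x) = x" "q * inverse q = 1" "inverse q * q = 1" for x
    using assms by (simp_all flip: mult.assoc)
  show "spin_t q i (spin_t q (Suc i) (spin_t q i f)) \<alpha> = spin_t q (Suc i) (spin_t q i (spin_t q (Suc i) f)) \<alpha>"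
    using assms
    by (cases "\<alpha> i"; cases "\<alpha> (Suc i)"; cases "\<alpha> (Suc (Suc i))")
      (simp_all add: spin_t_def Let_def flip_commute[of "Suc i" i] flip_commute[of "Suc (Suc i)" i]
        flip_commute[of "Suc (Suc i)" "Suc i"] eps_def qi algebra_simps)
qed

lemma spin_space_closed:
  fixes f :: "'a::field spin"
  shows "f \<in> spin_space n \<Longrightarrow> 1 \<le> j \<Longrightarrow> j \<le> n \<Longrightarrow> spin_c j f \<in> spin_space n"
  "f \<in> spin_space n \<Longrightarrow> 1 \<le> i \<Longrightarrow> i < n \<Longrightarrow> spin_t q i f \<in> spin_space n"
proof -
  have out: "f \<alpha> = 0" if "f \<in> spin_space n" "\<alpha> k" "\<not> (1 \<le> k \<and> k \<le> n)" for f :: "'a spin" and \<alpha> k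
    using that unfolding spin_space_def by blast
  have mem: "f \<in> spin_space n" if "\<And>\<alpha> k. \<alpha> k \<Longrightarrow> \<not> (1 \<le> k \<and> k \<le> n) \<Longrightarrow> f \<alpha> = 0" for f :: "'a spin"
    using that unfolding spin_space_def by blast
  assume f: "f \<in> spin_space n"
  show "spin_c j f \<in> spin_space n" if j: "1 \<le> j" "j \<le> n"
  proof (rule mem)
    fix \<alpha> k assume k: "\<alpha> k" "\<not> (1 \<le> k \<and> k \<le> n)"
    then have "flip j \<alpha> k" using j by auto
    from out[OF f, of "flip j \<alpha>" k] this k(2) show "spin_c j f \<alpha> = 0" by (simp add: spin_c_def)
  qed
  show "spin_t q i f \<in> spin_space n" if i: "1 \<le> i" "i < n"
  proof (rule mem)
    fix \<alpha> k assume k: "\<alpha> k" "\<not> (1 \<le> k \<and> k \<le> n)"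
    then have "flip i (flip (Suc i) \<alpha>) k" using i by auto
    from out[OF f, of "flip i (flip (Suc i) \<alpha>)" k] out[OF f, of \<alpha> k] this k show "spin_t q i f \<alpha> = 0" by (simp add: spin_t_def Let_def)
  qed
qed

lemma spin_subspace: "module.subspace spin_scale (spin_space n :: 'a::field spin set)"
proof -
  interpret vector_space "spin_scale :: 'a \<Rightarrow> _" by (rule spin_vector_space)
  show ?thesis
  proof (rule subspaceI)
    fix x y :: "'a spin" and a :: 'a assume x: "x \<in> spin_space n"
    have *: "x \<alpha> + y \<alpha> \<noteq> 0 \<Longrightarrow> x \<alpha> \<noteq> 0 \<or> y \<alpha> \<noteq> 0" for \<alpha> by auto
    show "x + y \<in> spin_space n" if "y \<in> spin_space n"
      using x that * unfolding spin_space_def plus_fun_apply mem_Collect_eq by blast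
    show "spin_scale a x \<in> spin_space n" using x by (auto simp: spin_space_def spin_scale_def)
  qed (simp add: spin_space_def)
qed

text \<open>V is left arbitrary because the lemma is applied to the whole spin space and to a
  minimal submodule of it.\<close>

lemma spin_hc_rep:
  assumes q: "q \<noteq> 0" and two: "(2 :: 'a::field) \<noteq> 0" and eps: "eps q \<noteq> 0"
    and V: "module.subspace spin_scale V"
    and tV: "\<And>i f. \<lbrakk>1 \<le> i; i < n; f \<in> V\<rbrakk> \<Longrightarrow> spin_t q i f \<in> V"
    and cV: "\<And>i f. \<lbrakk>1 \<le> i; i \<le> n; f \<in> V\<rbrakk> \<Longrightarrow> spin_c i f \<in> V"
  shows "hc_rep spin_scale n (q :: 'a) V (\<lambda>i. if 1 \<le> i \<and> i < n then spin_t q i else id)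
    (\<lambda>i. if 1 \<le> i \<and> i \<le> n then spin_c i else id)"
proof -
  interpret vector_space "spin_scale :: 'a \<Rightarrow> _" by (rule spin_vector_space)
  have lin: "spin_t q i (f + g) = spin_t q i f + spin_t q i g"
    "spin_t q i (spin_scale a f) = spin_scale a (spin_t q i f)"
    "spin_c i (f + g) = spin_c i f + spin_c i g" "spin_c i (spin_scale a f) = spin_scale a (spin_c i f)"
    for i a and f g :: "'a spin"
    by (auto simp: spin_t_def spin_c_def spin_scale_def Let_def fun_eq_iff algebra_simps)
  show ?thesis
  proof unfold_locales
    fix i j :: nat and w :: "'a spin"
    let ?t = "\<lambda>i. if 1 \<le> i \<and> i < n then spin_t q i else id"
    let ?c = "\<lambda>i. if 1 \<le> i \<and> i \<le> n then spin_c i else (id :: 'a spin \<Rightarrow> _)"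
    show "1 \<le> i \<Longrightarrow> Suc i < j \<Longrightarrow> j < n \<Longrightarrow> w \<in> V \<Longrightarrow> ?t i (?t j w) = ?t j (?t i w)"
      using spin_t_t[of i j q w] by simp
    show "1 \<le> i \<Longrightarrow> i \<le> n \<Longrightarrow> 1 \<le> j \<Longrightarrow> j \<le> n \<Longrightarrow> i \<noteq> j \<Longrightarrow> w \<in> V \<Longrightarrow> ?c i (?c j w) = - ?c j (?c i w)"
      using spin_c_c[of i j w] by simp
    show "1 \<le> i \<Longrightarrow> Suc i < n \<Longrightarrow> w \<in> V \<Longrightarrow> ?t i (?t (Suc i) (?t i w)) = ?t (Suc i) (?t i (?t (Suc i) w))"
      using spin_braid[OF q, of i w] by simp
    show "1 \<le> i \<Longrightarrow> i < n \<Longrightarrow> w \<in> V \<Longrightarrow> ?t i (?t i w) = spin_scale (eps q) (?t i w) + w"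
      using spin_t_sq[OF q, of i w] by simp
    show "1 \<le> i \<Longrightarrow> i < n \<Longrightarrow> w \<in> V \<Longrightarrow> ?t i (?c i w) = ?c (Suc i) (?t i w)"
      using spin_t_c[of q i w] by simp
    show "1 \<le> i \<Longrightarrow> i < n \<Longrightarrow> w \<in> V \<Longrightarrow>
        ?t i (?c (Suc i) w) = ?c i (?t i w) - spin_scale (eps q) (?c i w - ?c (Suc i) w)"
      using spin_t_c_Suc[OF q, of i w] by simp
    show "1 \<le> i \<Longrightarrow> i < n \<Longrightarrow> 1 \<le> j \<Longrightarrow> j \<le> n \<Longrightarrow> j \<noteq> i \<Longrightarrow> j \<noteq> Suc i \<Longrightarrow> w \<in> V \<Longrightarrow>
        ?t i (?c j w) = ?c j (?t i w)"
      using spin_t_c_other[of j i q w] by simp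
  qed (use V tV cV two eps in \<open>simp_all add: lin spin_c_sq\<close>)
qed

definition vacuum :: "'a::field spin" where
  "vacuum = (\<lambda>\<alpha>. if \<alpha> = (\<lambda>_. False) then 1 else 0)"

definition monomial :: "(nat \<Rightarrow> bool) \<Rightarrow> 'a::field spin" where
  "monomial \<beta> = (\<lambda>\<alpha>. if \<alpha> = \<beta> then 1 else 0)"

lemma spin_t_vacuum: "spin_t q i vacuum = spin_scale q vacuum"
proof -
  have "flip i (flip (Suc i) \<alpha>) \<noteq> (\<lambda>_. False)" if "\<not> \<alpha> i \<or> \<not> \<alpha> (Suc i)" for \<alpha>
    using that by (auto dest: fun_cong[of _ _ i] fun_cong[of _ _ "Suc i"])
  moreover have "\<alpha> \<noteq> (\<lambda>_. False)" if "\<alpha> i \<or> \<alpha> (Suc i)" for \<alpha> using that by auto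
  ultimately show ?thesis
    by (intro ext) (simp add: spin_t_def vacuum_def spin_scale_def Let_def)
qed

lemma spin_c_monomial: "spin_c j (monomial \<beta>) = spin_scale (sg j \<beta>) (monomial (flip j \<beta>))"
proof -
  have "spin_c j (monomial \<beta>) \<alpha> = spin_scale (sg j \<beta>) (monomial (flip j \<beta>)) \<alpha>" for \<alpha>
  proof (cases "\<alpha> = flip j \<beta>")
    case False
    then have "flip j \<alpha> \<noteq> \<beta>" by (metis flip_flip)
    then show ?thesis using False by (simp add: spin_c_def monomial_def spin_scale_def)
  qed (simp add: spin_c_def monomial_def spin_scale_def sg_flip)
  then show ?thesis by (rule ext)
qed

lemma finite_spin_support: "finite {\<alpha> :: nat \<Rightarrow> bool. \<forall>j. \<alpha> j \<longrightarrow> 1 \<le> j \<and> j \<le> n}"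
proof -
  have "inj_on Collect {\<alpha> :: nat \<Rightarrow> bool. \<forall>j. \<alpha> j \<longrightarrow> 1 \<le> j \<and> j \<le> n}" by (auto simp: inj_on_def)
  moreover have "Collect ` {\<alpha>. \<forall>j. \<alpha> j \<longrightarrow> 1 \<le> j \<and> j \<le> n} \<subseteq> Pow {1..n}" by auto
  then have "finite (Collect ` {\<alpha>. \<forall>j. \<alpha> j \<longrightarrow> 1 \<le> j \<and> j \<le> n})" by (rule finite_subset) simp
  ultimately show ?thesis using finite_imageD by blast
qed

lemma sum_fun_apply: "(\<Sum>i\<in>I. g i) x = (\<Sum>i\<in>I. g i x)"
  for g :: "'i \<Rightarrow> 'x \<Rightarrow> 'b::comm_monoid_add"
  by (induction I rule: infinite_finite_induct) auto

lemma spin_expand: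
  assumes "f \<in> spin_space n"
  shows "f = (\<Sum>\<beta>\<in>{\<alpha>. \<forall>j. \<alpha> j \<longrightarrow> 1 \<le> j \<and> j \<le> n}. spin_scale (f \<beta>) (monomial \<beta>))"
proof
  fix \<alpha>
  let ?A = "{\<alpha>. \<forall>j. \<alpha> j \<longrightarrow> 1 \<le> j \<and> j \<le> n}"
  have "(\<Sum>\<beta>\<in>?A. spin_scale (f \<beta>) (monomial \<beta>)) \<alpha> = (\<Sum>\<beta>\<in>?A. if \<beta> = \<alpha> then f \<alpha> else 0)"
    unfolding sum_fun_apply by (intro sum.cong) (auto simp: spin_scale_def monomial_def)
  also have "\<dots> = f \<alpha>" using assms finite_spin_support[of n] by (auto simp: spin_space_def)
  finally show "f \<alpha> = (\<Sum>\<beta>\<in>?A. spin_scale (f \<beta>) (monomial \<beta>)) \<alpha>" by simp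
qed

text \<open>Up to sign every monomial arises from the vacuum by Clifford generators, so a property
  that is linear and stable under them need only be checked on the vacuum.\<close>

lemma spin_space_generated:
  fixes K :: "'a::field spin set"
  assumes K: "module.subspace spin_scale K" "vacuum \<in> K"
    and cK: "\<And>j f. \<lbrakk>1 \<le> j; j \<le> n; f \<in> K\<rbrakk> \<Longrightarrow> spin_c j f \<in> K"
  shows "spin_space n \<subseteq> K"
proof
  interpret vector_space "spin_scale :: 'a \<Rightarrow> _" by (rule spin_vector_space)
  have mono: "monomial \<beta> \<in> K" if "finite A" "Collect \<beta> = A" "A \<subseteq> {1..n}" for A \<beta>
    using that
  proof (induction A arbitrary: \<beta>)
    case empty
    then have "\<beta> = (\<lambda>_. False)" by auto
    then show ?case using K(2) by (simp add: monomial_def vacuum_def)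
  next
    case (insert j A)
    have "Collect (flip j \<beta>) = A" using insert.hyps(2) insert.prems(1) by (auto simp: set_eq_iff)
    then have "monomial (flip j \<beta>) \<in> K" using insert by auto
    then have "spin_scale (sg j (flip j \<beta>)) (spin_c j (monomial (flip j \<beta>))) \<in> K"
      using cK[of j] insert.prems K(1) subspace_scale by auto
    then show ?case
      by (simp add: spin_c_monomial sg_sg(1) del: scale_scale) (simp add: sg_sg(1))
  qed
  fix f :: "'a spin" assume f: "f \<in> spin_space n"
  have "monomial \<beta> \<in> K" if "\<forall>j. \<beta> j \<longrightarrow> 1 \<le> j \<and> j \<le> n" for \<beta>
    using that by (intro mono[of "Collect \<beta>"]) (auto intro: finite_subset[of _ "{1..n}"])
  then show "f \<in> K"
    by (subst spin_expand[OF f]) (use K(1) in \<open>auto intro!: subspace_sum subspace_scale\<close>)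
qed

text \<open>Parity of the number of Clifford factors; \<open>cnt (Suc n)\<close> includes index
  n.\<close>

definition spin_part :: "nat \<Rightarrow> bit \<Rightarrow> 'a::field spin set" where
  "spin_part n p = {f. \<forall>\<alpha>. f \<alpha> \<noteq> 0 \<longrightarrow> (p = 0 \<longleftrightarrow> even (cnt (Suc n) \<alpha>))}"

lemma spin_part_subspace: "module.subspace spin_scale (spin_part n p :: 'a::field spin set)"
proof -
  interpret vector_space "spin_scale :: 'a \<Rightarrow> _" by (rule spin_vector_space)
  show ?thesis
  proof (rule subspaceI)
    fix x y :: "'a spin" and a :: 'a assume x: "x \<in> spin_part n p"
    have *: "x \<alpha> + y \<alpha> \<noteq> 0 \<Longrightarrow> x \<alpha> \<noteq> 0 \<or> y \<alpha> \<noteq> 0" for \<alpha> by auto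
    show "x + y \<in> spin_part n p" if "y \<in> spin_part n p"
      using x that * unfolding spin_part_def plus_fun_apply mem_Collect_eq by blast
    show "spin_scale a x \<in> spin_part n p" using x by (auto simp: spin_part_def spin_scale_def)
  qed (simp add: spin_part_def)
qed

lemma spin_part_t:
  assumes "1 \<le> i" "i < n" "f \<in> spin_part n p"
  shows "spin_t q i f \<in> spin_part n p"
proof -
  have f: "f \<alpha> = 0" if "(p = 0) \<noteq> even (cnt (Suc n) \<alpha>)" for \<alpha>
    using assms(3) that by (auto simp: spin_part_def)
  have "spin_t q i f \<alpha> = 0" if "(p = 0) \<noteq> even (cnt (Suc n) \<alpha>)" for \<alpha>
    using f[of \<alpha>] f[of "flip i (flip (Suc i) \<alpha>)"] assms(1,2) that by (simp add: spin_t_def Let_def cnt_flip)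
  then show ?thesis unfolding spin_part_def by blast
qed

lemma spin_part_c:
  assumes "1 \<le> i" "i \<le> n" "f \<in> spin_part n p"
  shows "spin_c i f \<in> spin_part n (1 + p)"
proof -
  have f: "f \<alpha> = 0" if "(p = 0) \<noteq> even (cnt (Suc n) \<alpha>)" for \<alpha>
    using assms(3) that by (auto simp: spin_part_def)
  have p: "1 + p = 0 \<longleftrightarrow> p \<noteq> 0" by (cases p) simp_all
  have "spin_c i f \<alpha> = 0" if "(1 + p = 0) \<noteq> even (cnt (Suc n) \<alpha>)" for \<alpha>
  proof -
    have "(p = 0) \<noteq> even (cnt (Suc n) (flip i \<alpha>))" using that assms(1,2) by (cases p) (simp_all add: cnt_flip)
    then show ?thesis using f by (simp add: spin_c_def)
  qed
  then show ?thesis unfolding spin_part_def by blast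
qed

lemma spin_part_inter: "f \<in> spin_part n 0 \<Longrightarrow> f \<in> spin_part n 1 \<Longrightarrow> f = 0"
  by (auto simp: spin_part_def fun_eq_iff)


section \<open>From representations to modules\<close>

context hc_rep
begin

primrec wact :: "gen list \<Rightarrow> 'w \<Rightarrow> 'w" where
  "wact [] v = v"
| "wact (g # ws) v = (case g of T i \<Rightarrow> t i (wact ws v) | C i \<Rightarrow> c i (wact ws v))"

lemma wact_append: "wact (ws @ ws') v = wact ws (wact ws' v)"
  by (induction ws) (auto split: gen.split)

lemma wact_lin: "wact ws (v + w) = wact ws v + wact ws w" "wact ws (a *s v) = a *s wact ws v"
  by (induction ws) (auto simp: lin split: gen.split)

lemma wact_closed [simp]: "v \<in> V \<Longrightarrow> wact ws v \<in> V"
  by (induction ws) (auto split: gen.split)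

text \<open>The action of the free algebra that extends t and c from generators to noncommutative
  polynomials.\<close>

definition rho :: "'a free_alg \<Rightarrow> 'w \<Rightarrow> 'w" where
  "rho x v = (\<Sum>k\<in>Poly_Mapping.keys x. Poly_Mapping.lookup x k *s wact (letters k) v)"

lemma rho_superset:
  "\<lbrakk>finite A; Poly_Mapping.keys x \<subseteq> A\<rbrakk> \<Longrightarrow> rho x v = (\<Sum>k\<in>A. Poly_Mapping.lookup x k *s wact (letters k) v)"
  unfolding rho_def by (rule sum.mono_neutral_left) (auto simp: in_keys_iff)

lemma rho_add: "rho (x + y) v = rho x v + rho y v"
proof -
  let ?A = "Poly_Mapping.keys x \<union> Poly_Mapping.keys y"
  have "rho (x + y) v = (\<Sum>k\<in>?A. Poly_Mapping.lookup (x + y) k *s wact (letters k) v)"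
    by (rule rho_superset) (use Poly_Mapping.keys_add[of x y] in auto)
  also have "\<dots> = rho x v + rho y v"
    by (simp add: rho_superset[of ?A] lookup_add scale_left_distrib sum.distrib)
  finally show ?thesis .
qed

lemma rho_zero: "rho 0 v = 0"
  by (simp add: rho_def)

lemma rho_single: "rho (Poly_Mapping.single k a) v = a *s wact (letters k) v"
  by (simp add: rho_def)

lemma rho_lin: "rho x (v + w) = rho x v + rho x w" "rho x (a *s v) = a *s rho x v"
  by (simp_all add: rho_def wact_lin scale_right_distrib sum.distrib scale_sum_right mult.commute)

lemma rho_closed: "v \<in> V \<Longrightarrow> rho x v \<in> V"
  unfolding rho_def using V_subspace by (intro subspace_sum subspace_scale wact_closed)

lemma rho_neg: "rho (- x) v = - rho x v"
  using rho_add[of "- x" x v] by (simp add: rho_zero eq_neg_iff_add_eq_0)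

lemma rho_diff: "rho (x - y) v = rho x v - rho y v"
  using rho_add[of x "- y" v] by (simp add: rho_neg)

lemma rho_mult_single: "rho (Poly_Mapping.single k a * y) v = rho (Poly_Mapping.single k a) (rho y v)"
proof (induction y rule: update_induct)
  case const
  show ?case by (simp add: rho_zero rho_single wact_lin(2)[of _ 0 0, simplified])
next
  case (update y l b)
  have "rho (Poly_Mapping.single k a * Poly_Mapping.single l b) v =
      rho (Poly_Mapping.single k a) (rho (Poly_Mapping.single l b) v)"
    by (simp add: mult_single rho_single plus_word_def wact_append wact_lin)
  then show ?case using update by (simp add: update_eq_add distrib_left rho_add rho_lin)
qed

lemma rho_mult: "rho (x * y) v = rho x (rho y v)"
proof (induction x rule: update_induct)
  case const
  show ?case by (simp add: rho_zero)
next
  case (update x l b)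
  then show ?case by (simp add: update_eq_add distrib_right rho_add rho_mult_single)
qed

lemma letters_0: "letters 0 = []"
  by (simp add: zero_word_def)

lemma rho_const: "rho (const a) v = a *s v"
  by (simp add: const_def rho_single letters_0)

lemma rho_one: "rho 1 v = v"
  using rho_const[of 1 v] by (simp add: const_1)

lemma rho_var: "rho (var (T i)) v = t i v" "rho (var (C i)) v = c i v"
  by (simp_all add: var_def rho_single)

lemmas rho_simps = rho_diff rho_mult rho_add rho_neg rho_const rho_one rho_var

lemma rho_relators:
  assumes "r \<in> relators n q" "v \<in> V"
  shows "rho r v = 0"
  using assms unfolding relators_def Let_def
  apply (elim UnE CollectE exE conjE)
  subgoal by (simp only: rho_simps t_sq[of _ v] atLeastLessThan_iff) simp
  subgoal for i j using t_t'[of i j v] by (simp add: rho_simps; linarith)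
  subgoal for i using braid[of i v] by (simp add: rho_simps)
  subgoal for i using c_sq[of i v] by (simp add: rho_simps)
  subgoal for i j using c_c[of i j v] by (simp only: rho_simps) simp
  subgoal for i using t_c[of i v] by (simp add: rho_simps)
  subgoal for i using t_c_Suc[of i v] by (simp add: rho_simps)
  subgoal for i j using t_c_other[of i j v] by (simp add: rho_simps)
  done

text \<open>The elements acting as zero on V form a two-sided ideal that contains the
  relators.\<close>

lemma rho_relation_ideal:
  assumes "r \<in> relation_ideal n q" "v \<in> V"
  shows "rho r v = 0"
proof -
  let ?K = "{x \<in> carrier (free_ring n). \<forall>v\<in>V. rho x v = 0}"
  have rz: "rho x 0 = 0" for x using rho_lin(2)[of x 0 0] by simp
  have "ideal ?K (free_ring n)"
  proof (rule idealI[OF free_ring_ring])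
    show "subgroup ?K (add_monoid (free_ring n))"
    proof (rule group.subgroupI)
      show "Group.group (add_monoid (free_ring n :: 'a free_alg ring))"
        using abelian_group.a_group[OF ring.is_abelian_group[OF free_ring_ring]] .
      show "inv\<^bsub>add_monoid (free_ring n)\<^esub> x \<in> ?K" if x: "x \<in> ?K" for x
      proof -
        have "\<ominus>\<^bsub>free_ring n\<^esub> x = - x"
          using x abelian_group.minus_equality[OF ring.is_abelian_group[OF free_ring_ring[of n]], of "- x" x]
          by (simp add: free_ring_simps free_ring_uminus)
        then show ?thesis using x by (simp add: a_inv_def free_ring_uminus rho_neg)
      qed
      show "x \<otimes>\<^bsub>add_monoid (free_ring n)\<^esub> y \<in> ?K" if "x \<in> ?K" "y \<in> ?K" for x y
        using that by (simp add: free_ring_simps free_ring_add rho_add)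
    qed (auto intro!: exI[of _ 0] simp: free_ring_zero rho_zero)
    show "x \<otimes>\<^bsub>free_ring n\<^esub> a \<in> ?K" if "a \<in> ?K" "x \<in> carrier (free_ring n)" for a x
      using that by (simp add: free_ring_simps free_ring_mult rho_mult rz)
    show "a \<otimes>\<^bsub>free_ring n\<^esub> x \<in> ?K" if "a \<in> ?K" "x \<in> carrier (free_ring n)" for a x
      using that by (simp add: free_ring_simps free_ring_mult rho_mult rho_closed)
  qed
  moreover have "relators n q \<subseteq> ?K" using relators_carrier rho_relators by blast
  ultimately have "relation_ideal n q \<subseteq> ?K"
    unfolding relation_ideal_def by (rule ring.genideal_minimal[OF free_ring_ring])
  then show ?thesis using assms by blast
qed

text \<open>Well-definedness of the action of the quotient algebra.\<close>

lemma rho_proj_cong: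
  assumes "proj n q x = proj n q y" "x \<in> carrier (free_ring n)" "y \<in> carrier (free_ring n)" "v \<in> V"
  shows "rho x v = rho y v"
proof -
  interpret I: ideal "relation_ideal n q" "free_ring n" by (rule relation_ideal_ideal)
  have "\<zero>\<^bsub>free_ring n\<^esub> \<in> relation_ideal n q"
    using additive_subgroup.zero_closed[OF I.is_additive_subgroup] .
  then have "x \<in> proj n q x"
    unfolding proj_def a_r_coset_def' by (intro UN_I) (auto simp: free_ring_simps)
  then have "x \<in> proj n q y" using assms(1) by simp
  then obtain r where "r \<in> relation_ideal n q" "x = r + y"
    unfolding proj_def a_r_coset_def' by (auto simp: free_ring_simps)
  then show ?thesis using rho_relation_ideal assms(4) by (simp add: rho_add)
qed

end

text \<open>L_k - 1 maps an invariant complement of the fixed space into itself and, by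
  \<open>un\<close>, into the fixed space. It therefore vanishes on the complement.\<close>

lemma (in hc_transport) fixed_if_semisimple_unipotent:
  assumes k: "1 \<le> k" "k \<le> n" and ss: "acts_semisimply n q M (JM n q k)"
    and un: "\<And>w. w \<in> V \<Longrightarrow> L k (L k w) = L k w + L k w - w" and v: "v \<in> V"
  shows "L k v = v"
proof -
  let ?U = "{w \<in> V. L k w = w}"
  have "subspace ?U" by (rule subspaceI) (simp_all add: lin_L L_zero)
  then have "subspace ?U \<and> ?U \<subseteq> V \<and> (\<forall>u\<in>?U. L k u \<in> ?U)" by auto
  from ss[unfolded acts_semisimply_iff[OF k], rule_format, OF this]
  obtain U' where U': "subspace U'" "U' \<subseteq> V" "\<forall>u\<in>U'. L k u \<in> U'" "?U \<inter> U' = {0}"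
    "\<forall>v\<in>V. \<exists>u\<in>?U. \<exists>u'\<in>U'. v = u + u'" by blast
  obtain u u' where u: "u \<in> ?U" "u' \<in> U'" "v = u + u'" using U'(5) v by blast
  have u'V: "u' \<in> V" using u U' by blast
  have "L k (L k u' - u') = L k u' - u'" using un[OF u'V] by (simp add: lin_L)
  moreover have "L k u' - u' \<in> U'" using U' u subspace_diff by blast
  ultimately have "L k u' - u' \<in> ?U \<inter> U'" using U'(2) by blast
  then have "L k u' - u' = 0" unfolding U'(4) by simp
  then show ?thesis using u by (simp add: lin_L)
qed

text \<open>Realizes a representation as a module with elements in a prescribed type. The injection
  \<iota> is arbitrary, since all operations are transported along it.\<close>

locale graded_rep = hc_rep scale n q V t c
    for scale :: "'a::field \<Rightarrow> 'w::ab_group_add \<Rightarrow> 'w" (infixr "*s" 75) and n q V t c +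
  fixes P :: "bit \<Rightarrow> 'w set" and \<iota> :: "'w \<Rightarrow> 'v"
  assumes P_subspace: "subspace (P p)" and P_V: "P p \<subseteq> V"
    and P_sum: "v \<in> V \<Longrightarrow> \<exists>v0\<in>P 0. \<exists>v1\<in>P 1. v = v0 + v1"
    and P_inter: "\<lbrakk>v \<in> P 0; v \<in> P 1\<rbrakk> \<Longrightarrow> v = 0"
    and P_t: "\<lbrakk>1 \<le> i; i < n; v \<in> P p\<rbrakk> \<Longrightarrow> t i v \<in> P p"
    and P_c: "\<lbrakk>1 \<le> i; i \<le> n; v \<in> P p\<rbrakk> \<Longrightarrow> c i v \<in> P (1 + p)"
    and iota_inj: "inj_on \<iota> V"
begin

text \<open>The scalar action evaluates a chosen representative of the class;
  \<open>rho_proj_cong\<close> makes the choice immaterial.\<close>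

definition M :: "('a, 'v) HC_mod" where
  "M = \<lparr>carrier = \<iota> ` V, mult = (\<lambda>_ _. \<iota> 0), one = \<iota> 0, zero = \<iota> 0,
    add = (\<lambda>x y. \<iota> (inv_into V \<iota> x + inv_into V \<iota> y)),
    smult = (\<lambda>a m. \<iota> (rho (SOME x. x \<in> carrier (free_ring n) \<and> proj n q x = a) (inv_into V \<iota> m))),
    part = (\<lambda>p. \<iota> ` P p)\<rparr>"

lemma M_simps: "carrier M = \<iota> ` V" "\<zero>\<^bsub>M\<^esub> = \<iota> 0" "part M p = \<iota> ` P p"
  by (simp_all add: M_def)

lemma M_add: "\<lbrakk>v \<in> V; w \<in> V\<rbrakk> \<Longrightarrow> \<iota> v \<oplus>\<^bsub>M\<^esub> \<iota> w = \<iota> (v + w)"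
  by (simp add: M_def inv_into_f_f[OF iota_inj])

lemma M_smult:
  assumes "x \<in> carrier (free_ring n)" "v \<in> V"
  shows "proj n q x \<odot>\<^bsub>M\<^esub> \<iota> v = \<iota> (rho x v)"
proof -
  define y where "y = (SOME y. y \<in> carrier (free_ring n) \<and> proj n q y = proj n q x)"
  have "y \<in> carrier (free_ring n) \<and> proj n q y = proj n q x"
    unfolding y_def by (rule someI[of _ x]) (simp add: assms)
  then have "rho y v = rho x v" using rho_proj_cong assms by blast
  then show ?thesis using assms by (simp add: M_def inv_into_f_f[OF iota_inj] y_def)
qed

lemma M_abelian_group: "abelian_group M"
proof (rule abelian_groupI)
  fix x assume "x \<in> carrier M"
  then obtain v where v: "v \<in> V" "x = \<iota> v" by (auto simp: M_simps)
  then have "\<iota> (- v) \<oplus>\<^bsub>M\<^esub> x = \<zero>\<^bsub>M\<^esub>" by (simp add: M_add M_simps)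
  then show "\<exists>y\<in>carrier M. y \<oplus>\<^bsub>M\<^esub> x = \<zero>\<^bsub>M\<^esub>" using v by (auto simp: M_simps)
qed (auto simp: M_simps M_add ac_simps)

lemma M_left_module: "left_module (HC n q) M"
proof (intro left_module.intro left_module_axioms.intro HC_ring M_abelian_group)
  fix a x assume a: "a \<in> carrier (HC n q)" and x: "x \<in> carrier M"
  obtain f where f: "f \<in> carrier (free_ring n)" "a = proj n q f" using a by (rule HC_carrierE)
  obtain v where v: "v \<in> V" "x = \<iota> v" using x by (auto simp: M_simps)
  show "a \<odot>\<^bsub>M\<^esub> x \<in> carrier M" using f v by (simp add: M_smult rho_closed M_simps)
  show "a \<odot>\<^bsub>M\<^esub> (x \<oplus>\<^bsub>M\<^esub> y) = a \<odot>\<^bsub>M\<^esub> x \<oplus>\<^bsub>M\<^esub> a \<odot>\<^bsub>M\<^esub> y" if y: "y \<in> carrier M" for y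
  proof -
    obtain w where w: "w \<in> V" "y = \<iota> w" using y by (auto simp: M_simps)
    show ?thesis using f v w by (simp add: M_smult M_add rho_closed rho_lin)
  qed
  fix b assume b: "b \<in> carrier (HC n q)"
  obtain g where g: "g \<in> carrier (free_ring n)" "b = proj n q g" using b by (rule HC_carrierE)
  have "(a \<oplus>\<^bsub>HC n q\<^esub> b) \<odot>\<^bsub>M\<^esub> x = proj n q (f + g) \<odot>\<^bsub>M\<^esub> \<iota> v" using f g v by (simp add: proj_add)
  also have "\<dots> = a \<odot>\<^bsub>M\<^esub> x \<oplus>\<^bsub>M\<^esub> b \<odot>\<^bsub>M\<^esub> x"
    using f g v by (simp add: M_smult free_ring_add rho_add M_add rho_closed)
  finally show "(a \<oplus>\<^bsub>HC n q\<^esub> b) \<odot>\<^bsub>M\<^esub> x = a \<odot>\<^bsub>M\<^esub> x \<oplus>\<^bsub>M\<^esub> b \<odot>\<^bsub>M\<^esub> x" .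
  have "(a \<otimes>\<^bsub>HC n q\<^esub> b) \<odot>\<^bsub>M\<^esub> x = proj n q (f * g) \<odot>\<^bsub>M\<^esub> \<iota> v" using f g v by (simp add: proj_mult)
  also have "\<dots> = a \<odot>\<^bsub>M\<^esub> (b \<odot>\<^bsub>M\<^esub> x)"
    using f g v by (simp add: M_smult free_ring_mult rho_mult rho_closed)
  finally show "(a \<otimes>\<^bsub>HC n q\<^esub> b) \<odot>\<^bsub>M\<^esub> x = a \<odot>\<^bsub>M\<^esub> (b \<odot>\<^bsub>M\<^esub> x)" .
next
  fix x assume "x \<in> carrier M"
  then obtain v where v: "v \<in> V" "x = \<iota> v" by (auto simp: M_simps)
  then show "\<one>\<^bsub>HC n q\<^esub> \<odot>\<^bsub>M\<^esub> x = x" unfolding proj_one[symmetric]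
    by (simp add: M_smult free_ring_one rho_one)
qed

sublocale M: HC_left_module n q M
  by (intro HC_left_module.intro M_left_module)

sublocale M: hc_transport scale n q V t c M \<iota>
proof unfold_locales
  show "bij_betw \<iota> V (carrier M)" using iota_inj by (simp add: bij_betw_def M_simps)
  show "\<iota> (v + w) = \<iota> v \<oplus>\<^bsub>M\<^esub> \<iota> w" if "v \<in> V" "w \<in> V" for v w using that by (simp add: M_add)
  show "\<iota> (a *s v) = M.act (const a) (\<iota> v)" if "v \<in> V" for a v
    using that by (simp add: M.act_def M_smult free_ring_const rho_const)
  show "\<iota> (t i v) = M.act (var (T i)) (\<iota> v)" if "1 \<le> i" "i < n" "v \<in> V" for i v
    using that by (simp add: M.act_def M_smult free_ring_var T_gens rho_var)
  show "\<iota> (c i v) = M.act (var (C i)) (\<iota> v)" if "1 \<le> i" "i \<le> n" "v \<in> V" for i v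
    using that by (simp add: M.act_def M_smult free_ring_var C_gens rho_var)
qed

lemma wact_part: "\<lbrakk>set ws \<subseteq> gens n; v \<in> P r\<rbrakk> \<Longrightarrow> wact ws v \<in> P (parity (Word ws) + r)"
proof (induction ws)
  case Nil
  then show ?case by (simp only: parity_Nil wact.simps add_0)
next
  case (Cons g ws)
  then have IH: "wact ws v \<in> P (parity (Word ws) + r)" and g: "g \<in> gens n" by simp_all
  show ?case
  proof (cases g)
    case (T i)
    then have "t i (wact ws v) \<in> P (parity (Word ws) + r)" using g P_t[OF _ _ IH] by (simp add: T_gens)
    then show ?thesis by (simp only: T parity_Cons gen.case wact.simps add_0)
  next
    case (C i)
    then have "c i (wact ws v) \<in> P (1 + (parity (Word ws) + r))" using g P_c[OF _ _ IH] by (simp only: C_gens)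
    then show ?thesis by (simp only: C parity_Cons gen.case wact.simps add.assoc)
  qed
qed

lemma M_HC_module: "HC_module n q M"
  unfolding HC_module_def
proof (intro conjI allI ballI M_left_module)
  show "subgroup (part M r) (add_monoid M)" for r
    using M.lin_subspace_image[OF P_subspace P_V] by (simp add: lin_subspace_def M_simps)
  have "P 0 \<inter> P 1 = {0}" using P_inter subspace_0[OF P_subspace] by blast
  then show "direct_sum_of M (part M 0) (part M 1)"
    using M.direct_sum_image[OF P_V P_V, of 0 1] P_sum by (simp add: M_simps)
  fix p r a x assume a: "a \<in> HC_part n q p" and x: "x \<in> part M r"
  obtain f where f: "f \<in> carrier (free_ring n)" "\<forall>w\<in>Poly_Mapping.keys f. parity w = p" "a = proj n q f"
    using a by (auto simp: HC_part_def)
  obtain v where v: "v \<in> P r" "x = \<iota> v" using x by (auto simp: M_simps)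
  have "wact (letters k) v \<in> P (p + r)" if k: "k \<in> Poly_Mapping.keys f" for k
    using wact_part[OF _ v(1), of "letters k"] f k by (auto simp: free_ring_carrier_iff)
  then have "rho f v \<in> P (p + r)"
    unfolding rho_def by (intro subspace_sum[OF P_subspace] subspace_scale[OF P_subspace])
  moreover have "a \<odot>\<^bsub>M\<^esub> x = \<iota> (rho f v)" using f v P_V M_smult by blast
  ultimately show "a \<odot>\<^bsub>M\<^esub> x \<in> part M (p + r)" by (simp add: M_simps)
qed

lemma graded_submoduleE:
  assumes S: "graded_submodule n q M S"
  obtains U where "subspace U" "U \<subseteq> V" "S = \<iota> ` U"
    "\<And>i u. \<lbrakk>1 \<le> i; i < n; u \<in> U\<rbrakk> \<Longrightarrow> t i u \<in> U" "\<And>i u. \<lbrakk>1 \<le> i; i \<le> n; u \<in> U\<rbrakk> \<Longrightarrow> c i u \<in> U"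
    "\<And>u. u \<in> U \<Longrightarrow> \<exists>u0\<in>U \<inter> P 0. \<exists>u1\<in>U \<inter> P 1. u = u0 + u1"
proof -
  have sub: "submodule S (HC n q) M" using S by (simp add: graded_submodule_def)
  have act: "M.act x m \<in> S" if "x \<in> carrier (free_ring n)" "m \<in> S" for x m
    unfolding M.act_def using submodule.smult_closed[OF sub proj_closed[OF that(1)] that(2)] .
  have "lin_subspace n q M S"
    using sub act[OF free_ring_const] by (simp add: lin_subspace_def submodule_def M.act_def)
  then obtain U where U: "subspace U" "U \<subseteq> V" "S = \<iota> ` U" by (rule M.lin_subspaceE)
  have mem: "\<iota> v \<in> S \<longleftrightarrow> v \<in> U" if "v \<in> V" for v
    using inj_on_image_mem_iff[OF iota_inj that U(2)] U(3) by simp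
  show thesis
  proof (rule that[OF U])
    fix u assume u: "u \<in> U"
    then have uV: "u \<in> V" using U by blast
    show "t i u \<in> U" if "1 \<le> i" "i < n" for i
      using act[of "var (T i)" "\<iota> u"] M.psi_t[of i u] mem[of "t i u"] mem[of u] that u uV
      by (simp add: free_ring_var T_gens)
    show "c i u \<in> U" if "1 \<le> i" "i \<le> n" for i
      using act[of "var (C i)" "\<iota> u"] M.psi_c[of i u] mem[of "c i u"] mem[of u] that u uV
      by (simp add: free_ring_var C_gens)
    have "S = (S \<inter> part M 0) <+>\<^bsub>M\<^esub> (S \<inter> part M 1)" using S by (simp add: graded_submodule_def)
    moreover have "\<iota> u \<in> S" using u mem uV by simp
    ultimately have "\<iota> u \<in> (S \<inter> part M 0) <+>\<^bsub>M\<^esub> (S \<inter> part M 1)" by simp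
    then obtain u0 u1 where "u0 \<in> P 0" "u1 \<in> P 1" "\<iota> u0 \<in> S" "\<iota> u1 \<in> S" "\<iota> u = \<iota> u0 \<oplus>\<^bsub>M\<^esub> \<iota> u1"
      by (auto simp: set_add_def' M_simps)
    moreover from this have "u0 \<in> V" "u1 \<in> V" using P_V by blast+
    ultimately show "\<exists>u0\<in>U \<inter> P 0. \<exists>u1\<in>U \<inter> P 1. u = u0 + u1"
      using mem uV M.psi_inj[of u "u0 + u1"] by (auto simp: M_add)
  qed
qed

lemma M_irreducible:
  assumes nz: "V \<noteq> {0}"
    and minimal: "\<And>U. \<lbrakk>subspace U; U \<subseteq> V; \<And>i u. \<lbrakk>1 \<le> i; i < n; u \<in> U\<rbrakk> \<Longrightarrow> t i u \<in> U;
      \<And>i u. \<lbrakk>1 \<le> i; i \<le> n; u \<in> U\<rbrakk> \<Longrightarrow> c i u \<in> U;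
      \<And>u. u \<in> U \<Longrightarrow> \<exists>u0\<in>U \<inter> P 0. \<exists>u1\<in>U \<inter> P 1. u = u0 + u1; U \<noteq> {0}\<rbrakk> \<Longrightarrow> U = V"
  shows "irreducible_HC_module n q M"
  unfolding irreducible_HC_module_def
proof (intro conjI allI impI M_HC_module)
  have "\<iota> ` V \<noteq> \<iota> ` {0}"
    using nz inj_on_image_eq_iff[OF iota_inj, of V "{0}"] by simp
  then show "carrier M \<noteq> {\<zero>\<^bsub>M\<^esub>}" by (simp add: M_simps)
  fix S assume "graded_submodule n q M S"
  then show "S = {\<zero>\<^bsub>M\<^esub>} \<or> S = carrier M"
  proof (rule graded_submoduleE)
    fix U assume U: "subspace U" "U \<subseteq> V" "S = \<iota> ` U"
      "\<And>i u. \<lbrakk>1 \<le> i; i < n; u \<in> U\<rbrakk> \<Longrightarrow> t i u \<in> U" "\<And>i u. \<lbrakk>1 \<le> i; i \<le> n; u \<in> U\<rbrakk> \<Longrightarrow> c i u \<in> U"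
      "\<And>u. u \<in> U \<Longrightarrow> \<exists>u0\<in>U \<inter> P 0. \<exists>u1\<in>U \<inter> P 1. u = u0 + u1"
    show ?thesis
    proof (cases "U = {0}")
      case False
      then have "U = V" using minimal[OF U(1,2,4,5,6)] by blast
      then show ?thesis using U by (simp add: M_simps)
    qed (simp add: U(3) M_simps)
  qed
qed

end

text \<open>A member of least dimension is minimal. This produces an irreducible submodule of the
  basic spin module without deciding whether that module is itself irreducible.\<close>

lemma (in vector_space) minimal_subspace_exists:
  assumes B: "finite B" and F: "\<And>U. U \<in> F \<Longrightarrow> subspace U \<and> U \<subseteq> span B" and U0: "U0 \<in> F" "U0 \<noteq> {0}"
  shows "\<exists>N\<in>F. N \<noteq> {0} \<and> (\<forall>U\<in>F. U \<noteq> {0} \<longrightarrow> U \<subseteq> N \<longrightarrow> U = N)"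
proof -
  define N where "N = arg_min dim (\<lambda>U. U \<in> F \<and> U \<noteq> {0})"
  have N: "N \<in> F \<and> N \<noteq> {0}" unfolding N_def by (rule arg_min_natI[of _ U0]) (use U0 in simp)
  have min: "dim N \<le> dim U" if "U \<in> F" "U \<noteq> {0}" for U
    unfolding N_def by (rule arg_min_nat_le) (use that in simp)
  show ?thesis
  proof (intro bexI conjI ballI impI)
    show "N \<in> F" "N \<noteq> {0}" using N by simp_all
    fix U assume U: "U \<in> F" "U \<noteq> {0}" "U \<subseteq> N"
    obtain D where D: "D \<subseteq> U" "independent D" "U \<subseteq> span D" "card D = dim U" using basis_exists by blast
    obtain E where E: "E \<subseteq> N" "independent E" "N \<subseteq> span E" "card E = dim N" using basis_exists by blast
    have "E \<subseteq> span B" using E N F by blast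
    then have finE: "finite E" using independent_span_bound[OF B E(2)] by simp
    have "N \<subseteq> span D"
    proof
      fix x assume x: "x \<in> N"
      show "x \<in> span D"
      proof (rule ccontr)
        assume nx: "x \<notin> span D"
        then have "independent (insert x D)" using D(2) by (simp add: independent_insert)
        moreover have "insert x D \<subseteq> span E" using x D U E by blast
        ultimately have "finite (insert x D) \<and> card (insert x D) \<le> card E"
          by (rule independent_span_bound[OF finE])
        moreover have "x \<notin> D" using nx span_base by blast
        ultimately show False using min[OF U(1,2)] D(4) E(4) by (auto simp: card_insert_if)
      qed
    qed
    moreover have "span D \<subseteq> U" using D(1) F U(1) span_minimal by blast
    ultimately show "U = N" using U by blast
  qed
qed

lemma spin_part_sum:
  fixes f :: "'a::field spin"
  assumes "f \<in> spin_space n"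
  shows "\<exists>f0\<in>spin_space n \<inter> spin_part n 0. \<exists>f1\<in>spin_space n \<inter> spin_part n 1. f = f0 + f1"
proof -
  let ?f = "\<lambda>b \<alpha>. if even (cnt (Suc n) \<alpha>) = b then f \<alpha> else 0"
  have "?f b \<in> spin_space n" for b using assms by (auto simp: spin_space_def)
  moreover have "?f True \<in> spin_part n 0" "?f False \<in> spin_part n 1" by (auto simp: spin_part_def)
  moreover have "f = ?f True + ?f False" by (rule ext) simp
  ultimately show ?thesis by blast
qed

text \<open>Elements are determined by their coordinates along a finite list of index functions.
  Such sequences have the type from which an injection into 'v is given.\<close>

lemma spin_space_embedding:
  "\<exists>j :: 'a::field spin \<Rightarrow> nat \<Rightarrow> 'a. inj_on j (spin_space n)"
proof -
  let ?D = "{\<alpha> :: nat \<Rightarrow> bool. \<forall>j. \<alpha> j \<longrightarrow> 1 \<le> j \<and> j \<le> n}"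
  obtain xs where xs: "set xs = ?D" using finite_list[OF finite_spin_support] by blast
  have "inj_on (\<lambda>f k. f (xs ! k)) (spin_space n :: 'a spin set)"
  proof (rule inj_onI)
    fix f g :: "'a spin" assume f: "f \<in> spin_space n" and g: "g \<in> spin_space n"
      and eq: "(\<lambda>k. f (xs ! k)) = (\<lambda>k. g (xs ! k))"
    have "f \<alpha> = g \<alpha>" for \<alpha>
    proof (cases "\<alpha> \<in> ?D")
      case True
      then obtain k where "\<alpha> = xs ! k" using xs by (metis in_set_conv_nth)
      then show ?thesis using fun_cong[OF eq, of k] by simp
    next
      case False
      then have "f \<alpha> = 0" "g \<alpha> = 0" using f g by (auto simp: spin_space_def)
      then show ?thesis by simp
    qed
    then show "f = g" by (rule ext)
  qed
  then show ?thesis by blast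
qed

lemma (in root_of_unity) irreducible_not_completely_splittable:
  fixes \<iota> :: "(nat \<Rightarrow> 'a) \<Rightarrow> 'v"
  assumes hn: "h < n" and \<iota>: "inj \<iota>"
  shows "\<exists>M :: ('a, 'v) HC_mod. irreducible_HC_module n q M \<and> \<not> completely_splittable n q M"
proof -
  let ?t = "\<lambda>i. if 1 \<le> i \<and> i < n then spin_t q i else id"
  let ?c = "\<lambda>i. if 1 \<le> i \<and> i \<le> n then spin_c i else (id :: 'a spin \<Rightarrow> _)"
  interpret S: hc_rep spin_scale n q "spin_space n" ?t ?c
    by (rule spin_hc_rep[OF q_neq_0 two_neq_0' eps_neq_0' spin_subspace])
      (use spin_space_closed in auto)
  define F :: "'a spin set set" where "F = {U. S.subspace U \<and> U \<subseteq> spin_space n \<and>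
    (\<forall>i u. 1 \<le> i \<longrightarrow> i < n \<longrightarrow> u \<in> U \<longrightarrow> spin_t q i u \<in> U) \<and>
    (\<forall>i u. 1 \<le> i \<longrightarrow> i \<le> n \<longrightarrow> u \<in> U \<longrightarrow> spin_c i u \<in> U) \<and>
    (\<forall>u\<in>U. \<exists>u0\<in>U \<inter> spin_part n 0. \<exists>u1\<in>U \<inter> spin_part n 1. u = u0 + u1)}"
  have "vacuum \<in> spin_space n" by (auto simp: vacuum_def spin_space_def)
  moreover have "(vacuum :: 'a spin) \<noteq> 0" by (auto simp: vacuum_def fun_eq_iff)
  ultimately have nz: "spin_space n \<noteq> {0 :: 'a spin}" by blast
  have SF: "spin_space n \<in> F"
    unfolding F_def using spin_part_sum S.V_subspace spin_space_closed by blast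
  let ?B = "monomial ` {\<alpha>. \<forall>j. \<alpha> j \<longrightarrow> 1 \<le> j \<and> j \<le> n} :: 'a spin set"
  have finB: "finite ?B" using finite_spin_support by blast
  have spB: "spin_space n \<subseteq> S.span ?B"
  proof
    fix f :: "'a spin" assume f: "f \<in> spin_space n"
    show "f \<in> S.span ?B"
      by (subst spin_expand[OF f], rule S.span_sum, rule S.span_scale, rule S.span_base, rule imageI)
  qed
  have FB: "S.subspace U \<and> U \<subseteq> S.span ?B" if "U \<in> F" for U
  proof
    show "S.subspace U" using that by (simp add: F_def)
    have "U \<subseteq> spin_space n" using that by (simp add: F_def)
    then show "U \<subseteq> S.span ?B" using spB by (rule order_trans)
  qed
  obtain N where N: "N \<in> F" "N \<noteq> {0}" "\<And>U. \<lbrakk>U \<in> F; U \<noteq> {0}; U \<subseteq> N\<rbrakk> \<Longrightarrow> U = N"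
    using S.minimal_subspace_exists[OF finB FB SF nz] by metis
  have NF: "S.subspace N" "N \<subseteq> spin_space n"
    "\<And>i u. \<lbrakk>1 \<le> i; i < n; u \<in> N\<rbrakk> \<Longrightarrow> spin_t q i u \<in> N"
    "\<And>i u. \<lbrakk>1 \<le> i; i \<le> n; u \<in> N\<rbrakk> \<Longrightarrow> spin_c i u \<in> N"
    "\<And>u. u \<in> N \<Longrightarrow> \<exists>u0\<in>N \<inter> spin_part n 0. \<exists>u1\<in>N \<inter> spin_part n 1. u = u0 + u1"
    using N(1) by (simp_all add: F_def)
  obtain j :: "'a spin \<Rightarrow> nat \<Rightarrow> 'a" where j: "inj_on j (spin_space n)"
    using spin_space_embedding by blast
  interpret N: hc_rep spin_scale n q N ?t ?c
    by (rule spin_hc_rep[OF q_neq_0 two_neq_0' eps_neq_0' NF(1)]) (use NF in auto)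
  interpret G: graded_rep spin_scale n q N ?t ?c "\<lambda>p. N \<inter> spin_part n p" "\<iota> \<circ> j"
  proof
    show "S.subspace (N \<inter> spin_part n p)" for p
      using S.subspace_inter[OF NF(1) spin_part_subspace] .
    show "inj_on (\<iota> \<circ> j) N"
      using comp_inj_on[OF inj_on_subset[OF j NF(2)]] \<iota> by (meson inj_on_subset subset_UNIV)
    show "\<exists>v0\<in>N \<inter> spin_part n 0. \<exists>v1\<in>N \<inter> spin_part n 1. v = v0 + v1" if "v \<in> N" for v
      using NF(5)[OF that] .
    show "v = 0" if "v \<in> N \<inter> spin_part n 0" "v \<in> N \<inter> spin_part n 1" for v
      using that spin_part_inter by blast
    show "?t i v \<in> N \<inter> spin_part n p" if "1 \<le> i" "i < n" "v \<in> N \<inter> spin_part n p" for i v p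
      using that NF(3) spin_part_t by auto
    show "?c i v \<in> N \<inter> spin_part n (1 + p)" if i: "1 \<le> i" "i \<le> n" and v: "v \<in> N \<inter> spin_part n p" for i v p
    proof -
      have "spin_c i v \<in> N \<inter> spin_part n (1 + p)" using i v NF(4) spin_part_c by blast
      then show ?thesis using i by presburger
    qed
  qed blast
  have irr: "irreducible_HC_module n q G.M"
  proof (rule G.M_irreducible[OF N(2)])
    fix U assume U: "S.subspace U" "U \<subseteq> N" "\<And>i u. \<lbrakk>1 \<le> i; i < n; u \<in> U\<rbrakk> \<Longrightarrow> ?t i u \<in> U"
      "\<And>i u. \<lbrakk>1 \<le> i; i \<le> n; u \<in> U\<rbrakk> \<Longrightarrow> ?c i u \<in> U"
      "\<And>u. u \<in> U \<Longrightarrow> \<exists>u0\<in>U \<inter> (N \<inter> spin_part n 0). \<exists>u1\<in>U \<inter> (N \<inter> spin_part n 1). u = u0 + u1"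
      "U \<noteq> {0}"
    have "spin_t q i u \<in> U" if "1 \<le> i" "i < n" "u \<in> U" for i u using U(3)[OF that] that by simp
    moreover have "spin_c i u \<in> U" if "1 \<le> i" "i \<le> n" "u \<in> U" for i u using U(4)[OF that] that by simp
    moreover have "\<exists>u0\<in>U \<inter> spin_part n 0. \<exists>u1\<in>U \<inter> spin_part n 1. u = u0 + u1" if "u \<in> U" for u
      using U(5)[OF that] by blast
    ultimately have "U \<in> F" unfolding F_def using U(1,2) NF(2) by blast
    then show "U = N" using N(3) U(2,6) by blast
  qed
  have unip: "spin_space n \<subseteq> S.unip (Suc k)" if k: "k = h - 1 \<or> k = h" for k
  proof (rule spin_space_generated[OF S.unip_subspace])
    have kn: "Suc k \<le> n" using k hn h_ge_3 by auto
    have "S.L (Suc k) (S.L (Suc k) vacuum) = S.L (Suc k) vacuum + S.L (Suc k) vacuum - vacuum"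
    proof (rule S.L_vacuum_quadratic[OF \<open>vacuum \<in> spin_space n\<close> _ q_neq_0 kn])
      show "?t i vacuum = spin_scale q vacuum" if "1 \<le> i" "i < n" for i
        using that by (simp add: spin_t_vacuum)
      show "q ^ (2 * k) * q ^ (2 * k) + 1 + S.wnorm k = 2 * q ^ (2 * k)"
        using wnorm_special[OF k] by (simp only: S.wnorm_sum)
    qed
    then show "vacuum \<in> S.unip (Suc k)" using \<open>vacuum \<in> spin_space n\<close> by (simp only: S.unip_def mem_Collect_eq)
    fix i f assume i: "1 \<le> i" "i \<le> n" "f \<in> S.unip (Suc k)"
    then have "?c i f \<in> S.unip (Suc k)" by (intro S.unip_c) (use kn in auto)
    then show "spin_c i f \<in> S.unip (Suc k)" using i by presburger
  qed
  have "\<not> completely_splittable n q G.M"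
  proof
    assume cs: "completely_splittable n q G.M"
    have fixed: "N.L (Suc k) w = w" if k: "k = h - 1 \<or> k = h" and w: "w \<in> N" for k w
    proof (rule G.M.fixed_if_semisimple_unipotent[OF _ _ _ _ w])
      show kn: "1 \<le> Suc k" "Suc k \<le> n" using k hn h_ge_3 by auto
      show "acts_semisimply n q G.M (JM n q (Suc k))"
        using cs kn unfolding completely_splittable_def by (meson atLeastAtMost_iff)
      show "N.L (Suc k) (N.L (Suc k) x) = N.L (Suc k) x + N.L (Suc k) x - x" if "x \<in> N" for x
      proof -
        \<comment> \<open>\<open>N.L\<close> and \<open>S.L\<close> are the same operators, built
          from the same \<open>?t\<close> and \<open>?c\<close>; only the distinguished subspace
          differs.\<close>
        have "x \<in> S.unip (Suc k)" using that NF(2) unip[OF k] by blast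
        then show ?thesis by (simp only: S.unip_def mem_Collect_eq)
      qed
    qed
    have "0 \<in> N" using S.subspace_0[OF NF(1)] .
    then obtain v where v: "v \<in> N" "v \<noteq> 0" using N(2) by blast
    have h: "1 \<le> h" "Suc (h - 1) = h" using h_ge_3 by auto
    show False
      by (rule N.not_both_one[OF h(1) hn v])
        (use fixed[of "h - 1"] fixed[of h] h in simp_all)
  qed
  then show ?thesis using irr by blast
qed


section \<open>Partitions\<close>

lemma sum_parts_le:
  assumes \<mu>: "\<mu> \<in> partitions n" and I: "finite I"
  shows "sum \<mu> I \<le> n"
proof -
  have "sum \<mu> I = sum \<mu> {r \<in> I. \<mu> r \<noteq> 0}" using I by (intro sum.mono_neutral_right) auto
  also have "\<dots> \<le> sum \<mu> {r. \<mu> r \<noteq> 0}" using \<mu> by (intro sum_mono2) (auto simp: partitions_def)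
  finally show ?thesis using \<mu> by (simp add: partitions_def)
qed

lemma first_two_parts: "\<mu> \<in> partitions n \<Longrightarrow> \<mu> 0 + \<mu> 1 \<le> n"
  using sum_parts_le[of \<mu> n "{0, 1}"] by simp

lemma part_le: "\<mu> \<in> partitions n \<Longrightarrow> \<mu> r \<le> n"
  using sum_parts_le[of \<mu> n "{r}"] by simp

lemma first_part_pos: "\<mu> \<in> partitions n \<Longrightarrow> 1 \<le> n \<Longrightarrow> 1 \<le> \<mu> 0"
proof (rule ccontr)
  assume \<mu>: "\<mu> \<in> partitions n" "1 \<le> n" "\<not> 1 \<le> \<mu> 0"
  have "\<mu> r = 0" for r
    using antimonoD[of \<mu> 0 r] \<mu>(1,3) by (simp add: partitions_def)
  then show False using \<mu>(1,2) by (simp add: partitions_def)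
qed

lemma CSP_first_part_less:
  assumes "3 \<le> h" "\<mu> \<in> CSP h n"
  shows "\<mu> 0 < h"
proof -
  have "(h + 1) div 2 < h" using assms(1) by linarith
  then show ?thesis using assms unfolding CSP_def by force
qed

lemma strict_partition_Suc:
  assumes "\<mu> \<in> strict_partitions n" "\<mu> r = \<mu> (Suc r)"
  shows "\<mu> r = 0"
proof (rule ccontr)
  assume "\<mu> r \<noteq> 0"
  then have "\<mu> (Suc r) \<noteq> 0" using assms(2) by simp
  moreover have "inj_on \<mu> {r. \<mu> r \<noteq> 0}" using assms(1) by (simp add: strict_partitions_def)
  ultimately have "r = Suc r"
    using inj_onD[of \<mu> "{r. \<mu> r \<noteq> 0}" r "Suc r"] assms(2) \<open>\<mu> r \<noteq> 0\<close> by blast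
  then show False by simp
qed

text \<open>All parts are below h, so repetitions occur only among zeros and no difference reaches
  h. This holds for every n.\<close>

lemma CSP_subset_RP:
  assumes h: "3 \<le> h"
  shows "CSP h n \<subseteq> RP h n"
proof
  fix \<mu> assume \<mu>: "\<mu> \<in> CSP h n"
  then have s: "\<mu> \<in> strict_partitions n" and p: "\<mu> \<in> partitions n"
    by (simp_all add: CSP_def strict_partitions_def)
  have lt: "\<mu> r < h" for r
  proof -
    have "\<mu> r \<le> \<mu> 0" using p antimonoD[of \<mu> 0 r] by (simp add: partitions_def)
    then show ?thesis using CSP_first_part_less[OF h \<mu>] by simp
  qed
  have "h_strict h \<mu>" unfolding h_strict_def using strict_partition_Suc[OF s] by (metis dvd_0_right)
  moreover have "h_restricted h \<mu>"
    unfolding h_restricted_def using lt by (meson diff_le_self le_less_trans less_imp_le)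
  ultimately show "\<mu> \<in> RP h n" using p by (simp add: RP_def)
qed

text \<open>For n <= h a part equal to h would be the whole partition, and a drop from h to 0 is not
  h-restricted. So the parts are below h, where h-strict means strict, and the first two parts
  together are at most h.\<close>

lemma RP_subset_CSP:
  assumes h: "3 \<le> h" "odd h" and n: "1 \<le> n" "n \<le> h"
  shows "RP h n \<subseteq> CSP h n"
proof
  fix \<mu> assume "\<mu> \<in> RP h n"
  then have p: "\<mu> \<in> partitions n" and st: "h_strict h \<mu>" and re: "h_restricted h \<mu>"
    by (simp_all add: RP_def)
  have anti: "\<mu> s \<le> \<mu> r" if "r \<le> s" for r s
    using p antimonoD[of \<mu> r s] that by (simp add: partitions_def)
  have pair: "\<mu> r + \<mu> s \<le> n" if "r \<noteq> s" for r s
    using sum_parts_le[OF p, of "{r, s}"] that by simp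
  have lt: "\<mu> r < h" for r
  proof (rule ccontr)
    assume "\<not> \<mu> r < h"
    then have "\<mu> r = h" using part_le[OF p, of r] n by simp
    moreover from this have "\<mu> (Suc r) = 0" using pair[of r "Suc r"] n by simp
    ultimately show False using re unfolding h_restricted_def by (metis diff_zero dvd_refl less_irrefl)
  qed
  have strict: "\<mu> (Suc r) < \<mu> r" if "\<mu> r \<noteq> 0" for r
  proof (rule ccontr)
    assume "\<not> \<mu> (Suc r) < \<mu> r"
    then have "\<mu> r = \<mu> (Suc r)" using anti[of r "Suc r"] by simp
    then have "h dvd \<mu> r" using st by (simp add: h_strict_def)
    then show False using lt[of r] that by (simp add: nat_dvd_not_less)
  qed
  have "inj_on \<mu> {r. \<mu> r \<noteq> 0}"
  proof (rule linorder_inj_onI)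
    fix r s assume "r < s" "r \<in> {r. \<mu> r \<noteq> 0}"
    then have "\<mu> s \<le> \<mu> (Suc r)" "\<mu> (Suc r) < \<mu> r" using anti[of "Suc r" s] strict by simp_all
    then show "\<mu> r \<noteq> \<mu> s" by simp
  qed auto
  then have s: "\<mu> \<in> strict_partitions n" using p by (simp add: strict_partitions_def)
  show "\<mu> \<in> CSP h n"
  proof (cases "\<mu> 0 \<le> (h + 1) div 2")
    case True
    then show ?thesis using s first_part_pos[OF p n(1)] by (simp add: CSP_def)
  next
    case False
    \<comment> \<open>The first part determines u; the upper bound on u uses that h is odd.\<close>
    define u where "u = h - \<mu> 0"
    have "1 \<le> u" "\<mu> 0 = h - u" using lt[of 0] by (simp_all add: u_def)
    moreover have "u \<le> (h - 3) div 2" using False h by (auto simp: u_def elim!: oddE)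
    moreover have "\<mu> 1 \<le> u" using first_two_parts[OF p] n by (simp add: u_def)
    ultimately show ?thesis using s by (auto simp: CSP_def)
  qed
qed

text \<open>The witness has as many parts h as possible, followed by the remainder. If h divides n,
  the last h is broken into h - 1 and 1, because dropping from h to 0 is forbidden.\<close>

lemma RP_first_part_h:
  assumes h: "3 \<le> h" and n: "h < n"
  shows "\<exists>\<mu>\<in>RP h n. \<mu> 0 = h"
proof -
  obtain k x y where nk: "n = k * h + x + y" and k: "1 \<le> k" and x: "1 \<le> x" "x < h" and y: "y \<le> 1" "y < x"
  proof (cases "n mod h = 0")
    case False
    have "1 \<le> n div h" using n h by (simp add: div_greater_zero_iff Suc_le_eq)
    then show ?thesis using False h by (intro that[of "n div h" "n mod h" 0]) simp_all
  next
    case True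
    then have nh: "n = n div h * h" by (simp add: mult.commute dvd_eq_mod_eq_0)
    then have "n div h \<noteq> 0" "n div h \<noteq> 1" using n by (metis mult_0 not_less0, metis mult_1 less_irrefl)
    then obtain m where m: "n div h = Suc (Suc m)" by (metis One_nat_def not0_implies_Suc)
    show ?thesis using h nh by (intro that[of "Suc m" "h - 1" 1]) (simp_all add: m)
  qed
  define \<mu> where "\<mu> r = (if r < k then h else if r = k then x else if r = Suc k then y else 0)" for r
  have supp: "{r. \<mu> r \<noteq> 0} \<subseteq> {..Suc k}" by (auto simp: \<mu>_def)
  have "sum \<mu> {r. \<mu> r \<noteq> 0} = sum \<mu> {..Suc k}"
    using supp by (intro sum.mono_neutral_left) auto
  also have "\<dots> = sum \<mu> {..<k} + x + y" by (simp add: \<mu>_def lessThan_Suc_atMost[symmetric])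
  also have "sum \<mu> {..<k} = k * h" by (simp add: \<mu>_def)
  finally have "sum \<mu> {r. \<mu> r \<noteq> 0} = n" using nk by simp
  moreover have "antimono \<mu>" unfolding antimono_def using x y by (auto simp: \<mu>_def)
  moreover have "finite {r. \<mu> r \<noteq> 0}" using supp by (rule finite_subset) simp
  ultimately have "\<mu> \<in> partitions n" by (simp add: partitions_def)
  moreover have "h_strict h \<mu>" using x y by (auto simp: h_strict_def \<mu>_def)
  moreover have "h_restricted h \<mu>"
    unfolding h_restricted_def using h x y by (auto simp: \<mu>_def)
  ultimately have "\<mu> \<in> RP h n" by (simp add: RP_def)
  moreover have "\<mu> 0 = h" using k by (simp add: \<mu>_def)
  ultimately show ?thesis by blast
qed

lemma CSP_eq_RP_iff:
  assumes "3 \<le> h" "odd h" "1 \<le> n"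
  shows "CSP h n = RP h n \<longleftrightarrow> n \<le> h"
proof
  assume eq: "CSP h n = RP h n"
  show "n \<le> h"
  proof (rule ccontr)
    assume "\<not> n \<le> h"
    then obtain \<mu> where "\<mu> \<in> RP h n" "\<mu> 0 = h" using RP_first_part_h assms(1) by (metis not_le)
    then show False using CSP_first_part_less[OF assms(1), of \<mu> n] eq by simp
  qed
next
  assume "n \<le> h"
  then show "CSP h n = RP h n" using CSP_subset_RP RP_subset_CSP assms by (metis subset_antisym)
qed

theorem lemma6p5:
  fixes h n :: nat
  assumes "h \<ge> 3" and "odd h" and "n \<ge> 1"
  shows "(CSP h n = RP h n \<longleftrightarrow> h \<ge> n) \<and>
    (\<forall>q :: 'a::alg_closed_field.
      CHAR('a) \<noteq> 2 \<and> primitive_root_of_unity h q \<and>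
      (\<exists>\<iota> :: (nat \<Rightarrow> 'a) \<Rightarrow> 'v. inj \<iota>) \<longrightarrow>
      ((\<forall>M :: ('a, 'v) HC_mod.
          irreducible_HC_module n q M \<longrightarrow> completely_splittable n q M) \<longleftrightarrow> h \<ge> n))"
proof (intro conjI allI impI)
  show "CSP h n = RP h n \<longleftrightarrow> h \<ge> n" by (rule CSP_eq_RP_iff[OF assms])
  fix q :: 'a
  assume q: "CHAR('a) \<noteq> 2 \<and> primitive_root_of_unity h q \<and> (\<exists>\<iota> :: (nat \<Rightarrow> 'a) \<Rightarrow> 'v. inj \<iota>)"
  then obtain \<iota> :: "(nat \<Rightarrow> 'a) \<Rightarrow> 'v" where \<iota>: "inj \<iota>" by blast
  \<comment> \<open>A characteristic dividing 2 would be 1 or 2, and 1 is impossible in a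
    field.\<close>
  have "\<not> CHAR('a) dvd 2"
    using q CHAR_not_1[where ?'a = 'a] two_is_prime_nat by (auto simp: prime_nat_iff)
  then have "(of_nat 2 :: 'a) \<noteq> 0" by (simp only: of_nat_eq_0_iff_char_dvd not_False_eq_True)
  then have "(2 :: 'a) \<noteq> 0" by simp
  then have R: "root_of_unity h q" using assms q by (intro root_of_unity.intro) simp_all
  show "(\<forall>M :: ('a, 'v) HC_mod. irreducible_HC_module n q M \<longrightarrow> completely_splittable n q M) \<longleftrightarrow> h \<ge> n"
  proof
    assume "\<forall>M :: ('a, 'v) HC_mod. irreducible_HC_module n q M \<longrightarrow> completely_splittable n q M"
    then show "h \<ge> n"
      using root_of_unity.irreducible_not_completely_splittable[OF R _ \<iota>, of n] by (metis not_le)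
  next
    assume "h \<ge> n"
    then show "\<forall>M :: ('a, 'v) HC_mod. irreducible_HC_module n q M \<longrightarrow> completely_splittable n q M"
      using irreducible_completely_splittable[OF R] by blast
  qed
qed

end
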